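(* In the up/down storage model described in the context, assume that there is a finite random variable $W(\infty)$ such that, for every $\alpha\ge 0$, $$\frac1t\int_0^t e^{-\alpha W(s)}\,ds\to E e^{-\alpha W(\infty)}\quad\text{a.s. as }t\to\infty ,$$ and that there is a constant $p_d$ such that $$\frac1t\int_0^t J(s)\,ds\to p_d\le \frac{\varphi'(0)}{\eta'(0)+\varphi'(0)}\quad\text{a.s. as }t\to\infty .$$ Then there exists a nonnegative random variable $W_d$ such that, if $p_d>0$, then a.s. as $t\to\infty$ $$\frac{\int_0^t e^{-\alpha W(s)}J(s)\,ds}{\int_0^t J(s)\,ds}\to E e^{-\alpha W_d}$$ for every $\alpha\ge 0$. Moreover, with $$\pi_\ell=1-\left(1+\frac{\eta'(0)}{\varphi'(0)}\right)p_d\qquad\text{and}\qquad \pi=\frac{\eta'(0)}{\eta'(0)+\varphi'(0)},$$ we have $$E e^{-\alpha W(\infty)}=\pi_\ell\,\frac{\varphi'(0)\alpha}{\varphi(\alpha)}+(1-\pi_\ell)\left(1-\pi+\pi\,\frac{\eta(\alpha)}{\eta'(0)\alpha}\,\frac{\varphi'(0)\alpha}{\varphi(\alpha)}\right)E e^{-\alpha W_d}.$$ (The last identity is for $\alpha>0$, the value at $\alpha=0$ being read as the limit $\alpha\downarrow0$; if $\eta'(0)=0$, so that $\pi=0$, the term with factor $\pi$ is read as $0$.)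
   Context: Notation: $1_A$ is the indicator of $A$; $a^-=\min(a,0)$ (so $a^-\le 0$); a.s. means almost surely; $g(t-)$ is the left limit of $g$ at $t$; derivatives at $0$ of functions on $[0,\infty)$ are right derivatives. Up/down storage model. Let $\{\mathcal F_t\mid t\ge 0\}$ be a standard filtration (right-continuous, complete) on a probability space. Let $(X_u,X_d)$ be a c\`adl\`ag two-dimensional L\'evy process with respect to $\{\mathcal F_t\}$, with components as follows. - $X_u$ is a one-dimensional L\'evy process with no negative jumps which is not a subordinator (not nondecreasing), with Laplace-Stieltjes exponent $\varphi(\alpha)=\log Ee^{-\alpha X_u(1)}$, $\alpha\ge 0$, $$\varphi(\alpha)=-c_u\alpha+\frac{\sigma_u^2\alpha^2}{2}+\int_{(0,\infty)}\left(e^{-\alpha x}-1+\alpha x1_{\{x\le 1\}}\right)\nu_u(dx),$$ and $EX_u(1)=-\varphi'(0)=c_u+\int_{(1,\infty)}x\,\nu_u(dx)<0$. - $X_d$ is a right-continuous subordinator (nondecreasing L\'evy process) with $Ee^{-\alpha X_d(1)}=e^{-\eta(\alpha)}$, $\alpha\ge0$, where $$\eta(\alpha)=c_d\alpha+\int_{(0,\infty)}(1-e^{-\alpha x})\,\nu_d(dx),\qquad c_d\ge 0,$$ and $EX_d(1)=\eta'(0)<\infty$. Let $0=T_0\le S_1\le T_1\le S_2\le T_2\le\cdots$ be a sequence of a.s. finite stopping times with respect to $\{\mathcal F_t\}$ with $T_{n-1}<T_n$ for all $n\ge1$ and $T_n\to\infty$ a.s. The intervals $(T_{n-1},S_n]$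 are called down periods and the intervals $(S_n,T_n]$ up periods. Set $N(t)=\sup\{n\mid T_n\le t\}$ and $J(t)=1_{\{S_{N(t)+1}>t\}}$, so $J=1$ during down periods and $J=0$ during up periods. Let $W(0)\ge 0$ be a finite $\mathcal F_0$-measurable random variable and define $$\tilde X_d(t)=\int_{(0,t]}J(s-)\,dX_d(s),\quad \tilde X_u(t)=\int_{(0,t]}(1-J(s-))\,dX_u(s),\quad \tilde X(t)=\tilde X_u(t)+\tilde X_d(t),$$ $$L(t)=-\inf_{0\le s\le t}\left(W(0)+\tilde X(s)\right)^-,\qquad W(t)=W(0)+\tilde X(t)+L(t).$$ *)

theory Defs
  imports "HOL-Probability.Probability"
begin

section \<open>Filtrations, stopping times, Levy processes\<close>

text \<open>Time is the set of nonnegative reals.  Filtrations and processes are functions of a real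
  argument whose values at negative arguments are never constrained or used.\<close>

definition standard_filtration :: "'a measure \<Rightarrow> (real \<Rightarrow> 'a measure) \<Rightarrow> bool" where
  "standard_filtration M F \<longleftrightarrow>
     (\<forall>t\<ge>0. subalgebra M (F t)) \<and>
     (\<forall>s\<ge>0. \<forall>t\<ge>s. sets (F s) \<subseteq> sets (F t)) \<and>
     (\<forall>t\<ge>0. (\<Inter>u\<in>{t<..}. sets (F u)) = sets (F t)) \<and>
     complete_measure M \<and> null_sets M \<subseteq> sets (F 0)"

text \<open>Stopping times take values in the extended half-line; the library notion
  \<open>stopping_time\<close> would force them to have the (real) type of the time index.\<close>

definition ext_stopping_time :: "(real \<Rightarrow> 'a measure) \<Rightarrow> ('a \<Rightarrow> ennreal) \<Rightarrow> bool" where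
  "ext_stopping_time F T \<longleftrightarrow> (\<forall>t\<ge>0. Measurable.pred (F t) (\<lambda>\<omega>. T \<omega> \<le> ennreal t))"

definition left_lim :: "(real \<Rightarrow> 'b::t2_space) \<Rightarrow> real \<Rightarrow> 'b" where
  "left_lim f t = Lim (at_left t) f"

definition cadlag :: "(real \<Rightarrow> 'b::t2_space) \<Rightarrow> bool" where
  "cadlag f \<longleftrightarrow> (\<forall>t\<ge>0. continuous (at_right t) f) \<and> (\<forall>t>0. \<exists>l. (f \<longlongrightarrow> l) (at_left t))"

definition levy_process ::
    "'a measure \<Rightarrow> (real \<Rightarrow> 'a measure) \<Rightarrow> (real \<Rightarrow> 'a \<Rightarrow> 'b::euclidean_space) \<Rightarrow> bool" where
  "levy_process M F X \<longleftrightarrow>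
     (\<forall>t\<ge>0. X t \<in> borel_measurable (F t)) \<and>
     (AE \<omega> in M. X 0 \<omega> = 0) \<and>
     (AE \<omega> in M. cadlag (\<lambda>t. X t \<omega>)) \<and>
     (\<forall>s\<ge>0. \<forall>t\<ge>s.
        prob_space.indep_set M (sets (F s))
          (sets (vimage_algebra (space M) (\<lambda>\<omega>. X t \<omega> - X s \<omega>) borel)) \<and>
        distr M borel (\<lambda>\<omega>. X t \<omega> - X s \<omega>) = distr M borel (X (t - s)))"

definition nondecreasing_paths :: "'a measure \<Rightarrow> (real \<Rightarrow> 'a \<Rightarrow> real) \<Rightarrow> bool" where
  "nondecreasing_paths M X \<longleftrightarrow> (AE \<omega> in M. mono_on {0..} (\<lambda>t. X t \<omega>))"

definition no_negative_jumps :: "'a measure \<Rightarrow> (real \<Rightarrow> 'a \<Rightarrow> real) \<Rightarrow> bool" where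
  "no_negative_jumps M X \<longleftrightarrow> (AE \<omega> in M. \<forall>t>0. left_lim (\<lambda>s. X s \<omega>) t \<le> X t \<omega>)"

section \<open>Laplace exponents\<close>

definition levy_measure :: "real measure \<Rightarrow> bool" where
  "levy_measure \<nu> \<longleftrightarrow> sets \<nu> = sets borel \<and> emeasure \<nu> {..0} = 0 \<and>
     (\<integral>\<^sup>+x. ennreal (min 1 (x\<^sup>2)) \<partial>\<nu>) < \<infinity>"

definition subordinator_levy_measure :: "real measure \<Rightarrow> bool" where
  "subordinator_levy_measure \<nu> \<longleftrightarrow> sets \<nu> = sets borel \<and> emeasure \<nu> {..0} = 0 \<and>
     (\<integral>\<^sup>+x. ennreal (min 1 x) \<partial>\<nu>) < \<infinity>"

definition spectrally_positive_exponent ::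
    "real \<Rightarrow> real \<Rightarrow> real measure \<Rightarrow> real \<Rightarrow> real" where
  "spectrally_positive_exponent c \<sigma> \<nu> \<alpha> =
     - c * \<alpha> + \<sigma>\<^sup>2 * \<alpha>\<^sup>2 / 2 +
     (LINT x:{0<..}|\<nu>. exp (- \<alpha> * x) - 1 + \<alpha> * x * indicator {..1} x)"

definition subordinator_exponent :: "real \<Rightarrow> real measure \<Rightarrow> real \<Rightarrow> real" where
  "subordinator_exponent c \<nu> \<alpha> = c * \<alpha> + (LINT x:{0<..}|\<nu>. 1 - exp (- \<alpha> * x))"

definition right_deriv :: "(real \<Rightarrow> real) \<Rightarrow> real \<Rightarrow> real" where
  "right_deriv f x = (THE D. (f has_real_derivative D) (at_right x))"

section \<open>Pathwise integral of a step function\<close>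

text \<open>The integral of \<open>H\<close> over \<open>(a,b]\<close> with respect to \<open>g\<close>, for a function \<open>H\<close> that is constant on
  the cells \<open>(p i, p (i+1)]\<close> of a finite partition.  No bounded variation of \<open>g\<close> is needed.  For
  the integrands used below (left limits of the indicator of the down periods) this is, path by
  path, the stochastic integral.\<close>

definition has_step_integral ::
    "(real \<Rightarrow> real) \<Rightarrow> (real \<Rightarrow> real) \<Rightarrow> real \<Rightarrow> real \<Rightarrow> real \<Rightarrow> bool" where
  "has_step_integral H g a b I \<longleftrightarrow>
     (\<exists>k (p :: nat \<Rightarrow> real). p 0 = a \<and> p k = b \<and>
        (\<forall>i<k. p i \<le> p (Suc i) \<and> (\<forall>s\<in>{p i<..p (Suc i)}. H s = H (p (Suc i)))) \<and>
        I = (\<Sum>i<k. H (p (Suc i)) * (g (p (Suc i)) - g (p i))))"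

definition step_integral :: "(real \<Rightarrow> real) \<Rightarrow> (real \<Rightarrow> real) \<Rightarrow> real \<Rightarrow> real \<Rightarrow> real" where
  "step_integral H g a b = (THE I. has_step_integral H g a b I)"

lemma step_partition_unique:
  fixes p q :: "nat \<Rightarrow> real"
  assumes "p 0 = a" "p k = b" "q 0 = a" "q m = b"
    and "\<forall>i<k. p i \<le> p (Suc i) \<and> (\<forall>s\<in>{p i<..p (Suc i)}. H s = H (p (Suc i)))"
    and "\<forall>i<m. q i \<le> q (Suc i) \<and> (\<forall>s\<in>{q i<..q (Suc i)}. H s = H (q (Suc i)))"
  shows "(\<Sum>i<k. H (p (Suc i)) * (g (p (Suc i)) - g (p i) :: real)) =
         (\<Sum>i<m. H (q (Suc i)) * (g (q (Suc i)) - g (q i)))"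
  using assms
proof (induction "k + m" arbitrary: k m p q b rule: less_induct)
  case less
  have zero: "(\<Sum>i<n. H (r (Suc i)) * (g (r (Suc i)) - g (r i))) = 0"
    if "r 0 = r n" "\<forall>i<n. r i \<le> r (Suc i)" for n and r :: "nat \<Rightarrow> real"
  proof -
    have mono: "r i \<le> r j" if "i \<le> j" "j \<le> n" for i j
      using that
    proof (induction j rule: dec_induct)
      case (step j)
      then have "r i \<le> r j" "r j \<le> r (Suc j)"
        using \<open>\<forall>i<n. r i \<le> r (Suc i)\<close> by simp_all
      then show ?case by (rule order_trans)
    qed simp
    have "r (Suc i) = r i" if "i < n" for i
      using mono[of 0 i] mono[of "Suc i" n] mono[of i "Suc i"] that \<open>r 0 = r n\<close> by linarith
    then show ?thesis by simp
  qed
  have main: "(\<Sum>i<Suc k. H (p (Suc i)) * (g (p (Suc i)) - g (p i))) =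
      (\<Sum>i<Suc m. H (q (Suc i)) * (g (q (Suc i)) - g (q i)))"
    if IH: "\<And>k' m' p q b. k' + m' < Suc k + Suc m \<Longrightarrow> p 0 = a \<Longrightarrow> p k' = b \<Longrightarrow> q 0 = a \<Longrightarrow> q m' = b
        \<Longrightarrow> \<forall>i<k'. p i \<le> p (Suc i) \<and> (\<forall>s\<in>{p i<..p (Suc i)}. H s = H (p (Suc i)))
        \<Longrightarrow> \<forall>i<m'. q i \<le> q (Suc i) \<and> (\<forall>s\<in>{q i<..q (Suc i)}. H s = H (q (Suc i)))
        \<Longrightarrow> (\<Sum>i<k'. H (p (Suc i)) * (g (p (Suc i)) - g (p i))) =
            (\<Sum>i<m'. H (q (Suc i)) * (g (q (Suc i)) - g (q i)))"
      and p: "p 0 = a" "p (Suc k) = b" and q: "q 0 = a" "q (Suc m) = b"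
      and P: "\<forall>i<Suc k. p i \<le> p (Suc i) \<and> (\<forall>s\<in>{p i<..p (Suc i)}. H s = H (p (Suc i)))"
      and Q: "\<forall>i<Suc m. q i \<le> q (Suc i) \<and> (\<forall>s\<in>{q i<..q (Suc i)}. H s = H (q (Suc i)))"
      and le: "p k \<le> q m"
    for k m b and p q :: "nat \<Rightarrow> real"
  proof -
    define p' where "p' = p(Suc k := q m)"
    have qb: "q m \<le> b" using Q q by auto
    have P': "\<forall>i<Suc k. p' i \<le> p' (Suc i) \<and> (\<forall>s\<in>{p' i<..p' (Suc i)}. H s = H (p' (Suc i)))"
    proof (intro allI impI)
      fix i assume i: "i < Suc k"
      show "p' i \<le> p' (Suc i) \<and> (\<forall>s\<in>{p' i<..p' (Suc i)}. H s = H (p' (Suc i)))"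
      proof (cases "i = k")
        case True
        have cell: "\<forall>s\<in>{p k<..b}. H s = H b" using P p by auto
        have "\<forall>s\<in>{p k<..q m}. H s = H (q m)"
        proof
          fix s assume "s \<in> {p k<..q m}"
          then have "s \<in> {p k<..b}" "q m \<in> {p k<..b}" using qb by simp_all
          then show "H s = H (q m)" using cell by metis
        qed
        moreover have "p' i = p k" "p' (Suc i) = q m" using True by (simp_all add: p'_def)
        ultimately show ?thesis using le by metis
      next
        case False
        then have "p' i = p i" "p' (Suc i) = p (Suc i)" using i by (simp_all add: p'_def)
        then show ?thesis using P i by metis
      qed
    qed
    have 1: "(\<Sum>i<Suc k. H (p' (Suc i)) * (g (p' (Suc i)) - g (p' i))) =
        (\<Sum>i<m. H (q (Suc i)) * (g (q (Suc i)) - g (q i)))"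
    proof (rule IH[where b = "q m", OF _ _ _ q(1) refl P'])
      show "\<forall>i<m. q i \<le> q (Suc i) \<and> (\<forall>s\<in>{q i<..q (Suc i)}. H s = H (q (Suc i)))"
        using Q by (meson less_SucI)
    qed (use p in \<open>simp_all add: p'_def\<close>)
    have "H (q m) * (g (q m) - g (p k)) = H b * (g (q m) - g (p k))"
    proof (cases "q m = p k")
      case False
      then have "q m \<in> {p k<..p (Suc k)}" using le qb p by auto
      then show ?thesis using P p(2) by (metis lessI)
    qed simp
    then have 2: "(\<Sum>i<Suc k. H (p (Suc i)) * (g (p (Suc i)) - g (p i))) =
        (\<Sum>i<Suc k. H (p' (Suc i)) * (g (p' (Suc i)) - g (p' i))) + H b * (g b - g (q m))"
      using p by (simp add: p'_def algebra_simps)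
    show ?thesis unfolding 2 1 using q by simp
  qed
  show ?case
  proof (cases "k = 0 \<or> m = 0")
    case True
    have "a = b" using True less.prems(1-4) by auto
    then have "p 0 = p k" "q 0 = q m" using less.prems(1-4) by simp_all
    moreover have "\<forall>i<k. p i \<le> p (Suc i)" "\<forall>i<m. q i \<le> q (Suc i)"
      using less.prems(5,6) by blast+
    ultimately show ?thesis using zero[of p k] zero[of q m] by presburger
  next
    case False
    then obtain k' m' where k: "k = Suc k'" and m: "m = Suc m'"
      by (metis not0_implies_Suc)
    note IH = less.hyps[unfolded k m]
    note prems = less.prems[unfolded k m]
    show ?thesis
    proof (cases "p k' \<le> q m'")
      case True
      show ?thesis unfolding k m
        by (rule main[OF IH prems True])
    next
      case False
      then have "q m' \<le> p k'" by simp
      have IH': "(\<Sum>i<ka. H (p (Suc i)) * (g (p (Suc i)) - g (p i))) =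
            (\<Sum>i<ma. H (q (Suc i)) * (g (q (Suc i)) - g (q i)))"
        if "ka + ma < Suc m' + Suc k'" "p 0 = a" "p ka = b" "q 0 = a" "q ma = b"
          "\<forall>i<ka. p i \<le> p (Suc i) \<and> (\<forall>s\<in>{p i<..p (Suc i)}. H s = H (p (Suc i)))"
          "\<forall>i<ma. q i \<le> q (Suc i) \<and> (\<forall>s\<in>{q i<..q (Suc i)}. H s = H (q (Suc i)))"
        for ka ma b and p q :: "nat \<Rightarrow> real"
        by (rule IH[OF _ that(2-7)]) (use that(1) in simp)
      show ?thesis unfolding k m
        by (rule main[OF IH' prems(3,4,1,2,6,5) \<open>q m' \<le> p k'\<close>, symmetric])
    qed
  qed
qed

lemma has_step_integral_unique:
  assumes "has_step_integral H g a b I" "has_step_integral H g a b I'"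
  shows "I = I'"
proof -
  obtain k and p :: "nat \<Rightarrow> real" where p: "p 0 = a" "p k = b"
      "\<forall>i<k. p i \<le> p (Suc i) \<and> (\<forall>s\<in>{p i<..p (Suc i)}. H s = H (p (Suc i)))"
    and I: "I = (\<Sum>i<k. H (p (Suc i)) * (g (p (Suc i)) - g (p i)))"
    using assms(1) unfolding has_step_integral_def by blast
  obtain m and q :: "nat \<Rightarrow> real" where q: "q 0 = a" "q m = b"
      "\<forall>i<m. q i \<le> q (Suc i) \<and> (\<forall>s\<in>{q i<..q (Suc i)}. H s = H (q (Suc i)))"
    and I': "I' = (\<Sum>i<m. H (q (Suc i)) * (g (q (Suc i)) - g (q i)))"
    using assms(2) unfolding has_step_integral_def by blast
  show ?thesis unfolding I I' by (rule step_partition_unique[OF p(1,2) q(1,2) p(3) q(3)])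
qed

lemma step_integral_eqI: "has_step_integral H g a b I \<Longrightarrow> step_integral H g a b = I"
  unfolding step_integral_def by (blast intro: the_equality has_step_integral_unique)

section \<open>The up/down storage process, path by path\<close>

text \<open>Here \<open>T\<close> and \<open>S\<close> are the realized switching times.  \<open>S 0\<close> is never used.\<close>

definition num_cycles :: "(nat \<Rightarrow> ennreal) \<Rightarrow> real \<Rightarrow> nat" where
  "num_cycles T t = Sup {n. T n \<le> ennreal t}"

definition down_ind :: "(nat \<Rightarrow> ennreal) \<Rightarrow> (nat \<Rightarrow> ennreal) \<Rightarrow> real \<Rightarrow> real" where
  "down_ind S T t = of_bool (S (num_cycles T t + 1) > ennreal t)"

definition net_input ::
    "(nat \<Rightarrow> ennreal) \<Rightarrow> (nat \<Rightarrow> ennreal) \<Rightarrow> (real \<Rightarrow> real) \<Rightarrow> (real \<Rightarrow> real) \<Rightarrow> real \<Rightarrow> real" where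
  "net_input S T xu xd t =
     step_integral (\<lambda>s. 1 - left_lim (down_ind S T) s) xu 0 t +
     step_integral (left_lim (down_ind S T)) xd 0 t"

definition regulator :: "real \<Rightarrow> (real \<Rightarrow> real) \<Rightarrow> real \<Rightarrow> real" where
  "regulator w0 x t = - (INF s\<in>{0..t}. min (w0 + x s) 0)"

definition reflected :: "real \<Rightarrow> (real \<Rightarrow> real) \<Rightarrow> real \<Rightarrow> real" where
  "reflected w0 x t = w0 + x t + regulator w0 x t"

end

theory Submission
  imports Defs
begin

text \<open>The content process satisfies a balance equation. With \<open>\<phi>\<close> and \<open>\<eta>\<close> the Laplace exponents
  of the two inputs, the process
  \<open>Z t = exp (- \<alpha> * W t) - exp (- \<alpha> * W 0) + \<alpha> * L t - \<phi> \<alpha> * U t + \<eta> \<alpha> * D t\<close>, where \<open>U t\<close> and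
  \<open>D t\<close> are the integrals of \<open>exp (- \<alpha> * W s)\<close> over the up and the down periods before time
  \<open>t\<close>, is the martingale of Kella and Whitt, and its second moment grows at most linearly.
  Hence \<open>Z (n\<^sup>2) / n\<^sup>2\<close> tends to zero almost surely (\<open>Kella_Whitt_ergodic\<close>). Dividing by \<open>t\<close>,
  with \<open>E\<close> the limiting time average of \<open>exp (- \<alpha> * W s)\<close>, \<open>G\<close> that of
  \<open>exp (- \<alpha> * W s) * J s\<close>, and \<open>l\<close> the limit of \<open>L t / t\<close>, one obtains the linear equation
  \<open>(\<phi> \<alpha> + \<eta> \<alpha>) * G \<alpha> = \<phi> \<alpha> * E \<alpha> - \<alpha> * l\<close>. Solved for \<open>E\<close>, it is the asserted decomposition
  (\<open>decomposition_identity\<close>).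

  Three points need an argument. First, the rate \<open>l\<close>. Since \<open>J s - exp (- \<alpha> * W s) * J s\<close> lies
  between zero and \<open>1 - exp (- \<alpha> * W s)\<close>, the balance equation encloses \<open>L t / t\<close>, for every
  fixed \<open>\<alpha>\<close>, between two bounds that depend on \<open>\<alpha>\<close>, \<open>E \<alpha>\<close> and \<open>p\<close> only. Both tend to
  \<open>\<phi>' - (\<phi>' + \<eta>') * p\<close> as \<open>\<alpha>\<close> tends to zero, because \<open>E\<close> is the transform of a finite random
  variable (\<open>regulator_rate_squeeze\<close>). Second, \<open>G / p\<close> must be the Laplace transform of a
  random variable. It is a limit of transforms of occupation measures of a single path, and it
  tends to one at the origin; so these measures are tight and Helly's theorem provides a limit
  law (\<open>Laplace_limit_is_transform\<close>). Third, convergence along squares extends to all times,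
  because the integral over the down periods is monotone in time
  (\<open>tendsto_interpolate_squares\<close>).

  The second moment bound comes from a discretisation. On the grid of mesh \<open>1/m\<close> the reflected
  process is replaced by a Lindley recursion whose increments come from the input selected at
  the left end point of each cell. For this recursion the balance equation holds exactly
  (\<open>lindley_exp_identity\<close>), with a sum of martingale differences in place of \<open>Z\<close>; the second
  moment of this sum up to time \<open>N\<close> is at most \<open>N * C\<close> for every \<open>m\<close>
  (\<open>grid_martingale_second_moment\<close>). As \<open>m\<close> grows, the recursion converges to the reflected
  process path by path, and the sum converges to \<open>Z N\<close> (\<open>grid_martingale_limit\<close>); the absence
  of downward jumps enters here, since it makes the individual pushes of the regulator
  uniformly small. Fatou's lemma carries the bound over to \<open>Z\<close>.\<close>

section \<open>Right-continuous paths, vanishing drops and Riemann sums\<close>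

text \<open>A one-sided modulus of continuity: over a short time the path may jump up but cannot
  fall by much. In this form the absence of negative jumps passes to switched paths and to
  grids.\<close>

definition drops_vanish_on :: "(real \<Rightarrow> real) \<Rightarrow> real \<Rightarrow> bool" where
  "drops_vanish_on f b \<longleftrightarrow>
     (\<forall>\<epsilon>>0. \<exists>\<delta>>0. \<forall>s t. 0 \<le> s \<longrightarrow> s \<le> t \<longrightarrow> t \<le> b \<longrightarrow> t - s < \<delta> \<longrightarrow> f s - \<epsilon> < f t)"

lemma tendsto_at_left_real_eps:
  fixes f :: "real \<Rightarrow> real"
  assumes "(f \<longlongrightarrow> l) (at_left c)" "e > 0"
  shows "\<exists>d>0. \<forall>x. c - d < x \<longrightarrow> x < c \<longrightarrow> \<bar>f x - l\<bar> < e"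
proof -
  have "eventually (\<lambda>x. \<bar>f x - l\<bar> < e) (at_left c)"
    using tendstoD[OF assms] by (simp add: dist_real_def)
  then obtain b where "b < c" "\<forall>y>b. y < c \<longrightarrow> \<bar>f y - l\<bar> < e"
    unfolding eventually_at_left_field by blast
  then show ?thesis by (intro exI[of _ "c - b"]) auto
qed

lemma continuous_at_right_real_eps:
  fixes f :: "real \<Rightarrow> real"
  assumes "continuous (at_right c) f" "e > 0"
  shows "\<exists>d>0. \<forall>x. c \<le> x \<longrightarrow> x < c + d \<longrightarrow> \<bar>f x - f c\<bar> < e"
proof -
  have "(f \<longlongrightarrow> f c) (at_right c)" using assms(1) by (simp add: continuous_within)
  then have "eventually (\<lambda>x. \<bar>f x - f c\<bar> < e) (at_right c)"
    using tendstoD[OF _ assms(2)] by (fastforce simp: dist_real_def)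
  then obtain b where b: "b > c" "\<forall>y>c. y < b \<longrightarrow> \<bar>f y - f c\<bar> < e"
    unfolding eventually_at_right_field by blast
  have "\<bar>f x - f c\<bar> < e" if "c \<le> x" "x < c + (b - c)" for x
    using that b(2) assms(2) by (cases "x = c") auto
  then show ?thesis using b(1) by (intro exI[of _ "b - c"]) auto
qed

text \<open>Close to a point \<open>c\<close> the path is near its left limit before \<open>c\<close> and near its value after
  \<open>c\<close>, and the step between the two goes upwards. The Heine-Borel lemma makes these local
  bounds uniform.\<close>

lemma cadlag_drops_vanish_on:
  assumes cad: "cadlag f" and jump: "\<And>t. t > 0 \<Longrightarrow> left_lim f t \<le> f t"
  shows "drops_vanish_on f b"
  unfolding drops_vanish_on_def
proof (intro allI impI)
  fix \<epsilon> :: real assume \<epsilon>: "\<epsilon> > 0"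
  have loc: "\<exists>d>0. \<forall>s t. 0 \<le> s \<longrightarrow> s \<le> t \<longrightarrow> s \<in> ball c d \<longrightarrow> t \<in> ball c d \<longrightarrow> f s - \<epsilon> < f t" if "c \<ge> 0" for c
  proof -
    have "continuous (at_right c) f" using cad that unfolding cadlag_def by blast
    from continuous_at_right_real_eps[OF this, of "\<epsilon>/2"] \<epsilon>
    obtain d1 where d1: "d1 > 0" "\<And>x. c \<le> x \<Longrightarrow> x < c + d1 \<Longrightarrow> \<bar>f x - f c\<bar> < \<epsilon>/2" by auto
    show ?thesis
    proof (cases "c = 0")
      case True
      have "f s - \<epsilon> < f t" if "0 \<le> s" "s \<le> t" "s \<in> ball c d1" "t \<in> ball c d1" for s t
      proof -
        have "\<bar>f s - f c\<bar> < \<epsilon>/2" "\<bar>f t - f c\<bar> < \<epsilon>/2"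
          using d1(2)[of s] d1(2)[of t] that True by (auto simp: dist_real_def)
        then show ?thesis by linarith
      qed
      then show ?thesis using d1(1) by blast
    next
      case False
      then have c: "c > 0" using that by simp
      then obtain l where l: "(f \<longlongrightarrow> l) (at_left c)" using cad unfolding cadlag_def by blast
      have "left_lim f c = l" unfolding left_lim_def using l by (intro tendsto_Lim) auto
      then have lf: "l \<le> f c" using jump[OF c] by simp
      from tendsto_at_left_real_eps[OF l, of "\<epsilon>/2"] \<epsilon>
      obtain d2 where d2: "d2 > 0" "\<And>x. c - d2 < x \<Longrightarrow> x < c \<Longrightarrow> \<bar>f x - l\<bar> < \<epsilon>/2" by auto
      have "f s - \<epsilon> < f t" if "s \<le> t" "s \<in> ball c (min d1 d2)" "t \<in> ball c (min d1 d2)" for s t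
      proof -
        have s: "c - d2 < s" "s < c + d1" and t: "c - d2 < t" "t < c + d1"
          using that by (auto simp: dist_real_def)
        consider "t < c" | "s < c" "c \<le> t" | "c \<le> s" using that by linarith
        then show ?thesis
        proof cases
          case 1
          then have "\<bar>f s - l\<bar> < \<epsilon>/2" "\<bar>f t - l\<bar> < \<epsilon>/2" using d2(2) s t that(1) by auto
          then show ?thesis by linarith
        next
          case 2
          then have "\<bar>f s - l\<bar> < \<epsilon>/2" "\<bar>f t - f c\<bar> < \<epsilon>/2" using d1(2) d2(2) s t by auto
          then show ?thesis using lf by linarith
        next
          case 3
          then have "\<bar>f s - f c\<bar> < \<epsilon>/2" "\<bar>f t - f c\<bar> < \<epsilon>/2" using d1(2) s t that(1) by auto
          then show ?thesis by linarith
        qed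
      qed
      then show ?thesis using d1(1) d2(1) by (intro exI[of _ "min d1 d2"]) auto
    qed
  qed
  then obtain d where d: "\<And>c. c \<ge> 0 \<Longrightarrow> d c > 0"
      "\<And>c s t. c \<ge> 0 \<Longrightarrow> 0 \<le> s \<Longrightarrow> s \<le> t \<Longrightarrow> s \<in> ball c (d c) \<Longrightarrow> t \<in> ball c (d c) \<Longrightarrow> f s - \<epsilon> < f t"
    by metis
  have "{0..b} \<subseteq> \<Union>((\<lambda>c. ball c (d c)) ` {0..b})"
  proof
    fix x assume "x \<in> {0..b}"
    then show "x \<in> \<Union>((\<lambda>c. ball c (d c)) ` {0..b})" using d(1)[of x] by force
  qed
  from Heine_Borel_lemma[OF compact_Icc this] obtain e where e: "0 < e"
    "\<And>x. x \<in> {0..b} \<Longrightarrow> \<exists>G\<in>(\<lambda>c. ball c (d c)) ` {0..b}. ball x e \<subseteq> G" by auto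
  have "f s - \<epsilon> < f t" if "0 \<le> s" "s \<le> t" "t \<le> b" "t - s < e" for s t
  proof -
    obtain c where c: "c \<in> {0..b}" "ball s e \<subseteq> ball c (d c)" using e(2)[of s] \<open>0 \<le> s\<close> \<open>s \<le> t\<close> \<open>t \<le> b\<close> by auto
    have "s \<in> ball s e" "t \<in> ball s e" using that e(1) by (auto simp: dist_real_def)
    then have "s \<in> ball c (d c)" "t \<in> ball c (d c)" using c(2) by blast+
    with d(2) c(1) that show ?thesis by (meson atLeastAtMost_iff)
  qed
  then show "\<exists>\<delta>>0. \<forall>s t. 0 \<le> s \<longrightarrow> s \<le> t \<longrightarrow> t \<le> b \<longrightarrow> t - s < \<delta> \<longrightarrow> f s - \<epsilon> < f t"
    using e(1) by blast
qed

lemma mono_on_drops_vanish_on: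
  assumes "mono_on {0..} f"
  shows "drops_vanish_on f b"
  unfolding drops_vanish_on_def
proof (intro allI impI exI[of _ "1::real"] conjI)
  fix \<epsilon> s t :: real assume *: "\<epsilon> > 0" "0 \<le> s" "s \<le> t"
  have "f s \<le> f t" using assms * by (auto simp: mono_on_def)
  then show "f s - \<epsilon> < f t" using * by simp
qed auto

definition right_cont :: "(real \<Rightarrow> real) \<Rightarrow> bool" where
  "right_cont f \<longleftrightarrow> (\<forall>t\<ge>0. continuous (at_right t) f)"

lemma grid_ceiling_bounds:
  fixes s :: real assumes "0 \<le> s" "0 < m"
  shows "s \<le> real (nat \<lceil>real m * s\<rceil>) / real m" "real (nat \<lceil>real m * s\<rceil>) / real m < s + 1 / real m"
proof -
  have a: "0 \<le> real m * s" using assms by simp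
  have b: "real (nat \<lceil>real m * s\<rceil>) = of_int \<lceil>real m * s\<rceil>" using a by simp
  have "real m * s \<le> of_int \<lceil>real m * s\<rceil>" "of_int \<lceil>real m * s\<rceil> < real m * s + 1" by linarith+
  then show "s \<le> real (nat \<lceil>real m * s\<rceil>) / real m" "real (nat \<lceil>real m * s\<rceil>) / real m < s + 1 / real m"
    using assms unfolding b by (simp_all add: field_simps)
qed

text \<open>Rounding up approaches \<open>s\<close> from the right, where the path is continuous.\<close>

lemma right_cont_grid_tendsto:
  assumes "right_cont f" "0 \<le> s"
  shows "(\<lambda>m. f (real (nat \<lceil>real m * s\<rceil>) / real m)) \<longlonglongrightarrow> f s"
proof (rule LIMSEQ_I)
  fix e :: real assume "e > 0"
  have "continuous (at_right s) f" using assms unfolding right_cont_def by blast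
  from continuous_at_right_real_eps[OF this \<open>e > 0\<close>]
  obtain d where d: "d > 0" "\<And>x. s \<le> x \<Longrightarrow> x < s + d \<Longrightarrow> \<bar>f x - f s\<bar> < e" by auto
  obtain n where n: "n > 0" "1 / real n < d" using d(1) by (metis nat_approx_posE zero_less_Suc)
  have "norm (f (real (nat \<lceil>real m * s\<rceil>) / real m) - f s) < e" if "m \<ge> n" for m
  proof -
    have m: "m > 0" using that n by simp
    have "1 / real m \<le> 1 / real n" using that n by (simp add: frac_le)
    then show ?thesis using grid_ceiling_bounds[OF assms(2) m] d(2) n by simp
  qed
  then show "\<exists>n0. \<forall>m\<ge>n0. norm (f (real (nat \<lceil>real m * s\<rceil>) / real m) - f s) < e" by blast
qed

lemma right_cont_measurable:
  assumes "right_cont f"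
  shows "set_borel_measurable borel {0..t} f"
proof -
  have m: "(\<lambda>s. indicator {0..t} s * f (real (nat \<lceil>real m * s\<rceil>) / real m)) \<in> borel_measurable borel" for m
    by (intro borel_measurable_times) (auto intro!: measurable_compose_countable[where g="\<lambda>s. nat \<lceil>real m
        * s\<rceil>"])
  show ?thesis unfolding set_borel_measurable_def real_scaleR_def
  proof (rule borel_measurable_LIMSEQ_real[OF _ m])
    fix s :: real
    show "(\<lambda>m. indicator {0..t} s * f (real (nat \<lceil>real m * s\<rceil>) / real m)) \<longlonglongrightarrow> indicator {0..t} s * f s"
      by (cases "s \<in> {0..t}") (use right_cont_grid_tendsto[OF assms, of s] in simp_all)
  qed
qed

lemma right_cont_set_integrable:
  assumes "right_cont f" "\<And>s. 0 \<le> s \<Longrightarrow> \<bar>f s\<bar> \<le> B"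
  shows "set_integrable lborel {0..t::real} f"
proof -
  have "set_borel_measurable lborel {0..t} f"
    using right_cont_measurable[OF assms(1), of t] by (simp add: set_borel_measurable_def)
  moreover have "set_integrable lborel {0..t} (\<lambda>_. B)"
    unfolding set_integrable_def by (intro integrable_scaleR_left) (auto simp: emeasure_lborel_Icc_eq)
  ultimately show ?thesis unfolding set_integrable_def set_borel_measurable_def
    apply -
    apply (rule Bochner_Integration.integrable_bound, assumption, assumption)
    using assms(2) by (auto simp: indicator_def abs_mult intro!: order_trans[OF assms(2)])
qed

lemma set_integral_grid_cells:
  fixes g :: "nat \<Rightarrow> real" assumes m: "m > 0"
  shows "set_integrable lborel {0<..real n / real m} (\<lambda>s. g (nat \<lceil>real m * s\<rceil>))" (is ?i)
    and "(LBINT s:{0<..real n / real m}. g (nat \<lceil>real m * s\<rceil>)) = (\<Sum>k<n. g (Suc k)) / real m" (is ?v)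
proof -
  have "?i \<and> ?v"
  proof (induction n)
    case 0 then show ?case by (simp add: set_integrable_def set_lebesgue_integral_def)
  next
    case (Suc n)
    have eq: "nat \<lceil>real m * s\<rceil> = Suc n" if "s \<in> {real n / real m<..real (Suc n) / real m}" for s
    proof -
      have "real n < real m * s" "real m * s \<le> real n + 1" using that m by (auto simp: field_simps)
      then have "\<lceil>real m * s\<rceil> = int n + 1" by (intro ceiling_unique) auto
      then show ?thesis by simp
    qed
    let ?c = "{real n / real m<..real (Suc n) / real m}"
    have c: "set_integrable lborel ?c (\<lambda>_. g (Suc n))"
      unfolding set_integrable_def using m
          by (intro integrable_scaleR_left integrable_real_indicator) (auto simp: divide_right_mono)
    have c1: "set_integrable lborel ?c (\<lambda>s. g (nat \<lceil>real m * s\<rceil>))"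
      using c eq by (subst set_integrable_cong[OF refl, where f'="\<lambda>_. g (Suc n)"]) auto
    have c2: "(LBINT s:?c. g (nat \<lceil>real m * s\<rceil>)) = g (Suc n) / real m"
    proof -
      have "(LBINT s:?c. g (nat \<lceil>real m * s\<rceil>)) = (LBINT s:?c. g (Suc n))"
        using eq by (intro set_lebesgue_integral_cong) auto
      also have "\<dots> = g (Suc n) / real m" using m
        by (simp add: set_lebesgue_integral_def divide_right_mono diff_divide_distrib[symmetric])
      finally show ?thesis .
    qed
    have un: "{0<..real (Suc n) / real m} = {0<..real n / real m} \<union> ?c"
      using m by (intro ivl_disj_un_two(6)[symmetric]) (auto simp: divide_right_mono)
    have dis: "{0<..real n / real m} \<inter> ?c = {}" by auto
    have "set_integrable lborel {0<..real (Suc n) / real m} (\<lambda>s. g (nat \<lceil>real m * s\<rceil>))"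
      unfolding un using Suc c1 by (intro set_integrable_Un) auto
    moreover have "(LBINT s:{0<..real (Suc n) / real m}. g (nat \<lceil>real m * s\<rceil>)) = (\<Sum>k<Suc n. g (Suc k)) / real m"
      unfolding un using Suc c1 c2 by (subst set_integral_Un[OF dis]) (auto simp: add_divide_distrib)
    ultimately show ?case by simp
  qed
  then show ?i ?v by auto
qed

text \<open>Sums over right end points are integrals of step functions that converge pointwise, so
  dominated convergence applies although the integrand may jump. Sums over left end points
  differ from these by a telescoping term of order \<open>1 / m\<close>.\<close>

lemma Riemann_sum_tendsto:
  assumes rc: "right_cont f" and B: "\<And>s. 0 \<le> s \<Longrightarrow> \<bar>f s\<bar> \<le> B"
  shows "(\<lambda>m. (\<Sum>k<N * m. f (real k / real m)) / real m) \<longlonglongrightarrow> (LBINT s:{0..real N}. f s)"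
proof -
  let ?g = "\<lambda>m s. f (real (nat \<lceil>real m * s\<rceil>) / real m)"
  have ind: "(LBINT s:{0..real N}. f s) = (LBINT s:{0<..real N}. f s)"
    by (rule set_integral_discrete_difference[of "{0}"]) auto
  have "(\<lambda>m. LBINT s:{0<..real N}. ?g m s) \<longlonglongrightarrow> (LBINT s:{0<..real N}. f s)"
    unfolding set_lebesgue_integral_def
  proof (rule integral_dominated_convergence[where w="\<lambda>s. indicator {0<..real N} s *\<^sub>R B"])
    show "(\<lambda>s. indicator {0<..real N} s *\<^sub>R f s) \<in> borel_measurable lborel"
    proof -
      have "set_borel_measurable borel {0<..real N} f"
        by (rule set_borel_measurable_subset[OF right_cont_measurable[OF rc, of "real N"]]) auto
      then show ?thesis by (simp add: set_borel_measurable_def)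
    qed
    show "(\<lambda>s. indicator {0<..real N} s *\<^sub>R ?g m s) \<in> borel_measurable lborel" for m
      by (intro borel_measurable_scaleR) (auto intro!: measurable_compose_countable[where g="\<lambda>s. nat \<lceil>real m
          * s\<rceil>"])
    show "integrable lborel (\<lambda>s. indicator {0<..real N} s *\<^sub>R B)"
      by (intro integrable_scaleR_left) auto
    show "AE x in lborel. (\<lambda>i. indicator {0<..real N} x *\<^sub>R ?g i x) \<longlonglongrightarrow> indicator {0<..real N} x *\<^sub>R f x"
      using right_cont_grid_tendsto[OF rc] by (auto simp: indicator_def)
    show "AE x in lborel. norm (indicator {0<..real N} x *\<^sub>R ?g i x) \<le> indicator {0<..real N} x *\<^sub>R B" for i
    proof (intro AE_I2)
      fix x
      have "\<bar>?g i x\<bar> \<le> B" by (rule B) simp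
      then show "norm (indicator {0<..real N} x *\<^sub>R ?g i x) \<le> indicator {0<..real N} x *\<^sub>R B"
        by (cases "x \<in> {0<..real N}") simp_all
    qed
  qed
  then have 1: "(\<lambda>m. LBINT s:{0<..real N}. ?g m s) \<longlonglongrightarrow> (LBINT s:{0..real N}. f s)" using ind by simp
  have 2: "(LBINT s:{0<..real N}. ?g m s) = (\<Sum>k<N*m. f (real (Suc k) / real m)) / real m" if "m > 0" for m
    using set_integral_grid_cells(2)[OF that, of "N*m" "\<lambda>k. f (real k / real m)"] that by simp
  have 3: "(\<Sum>k<N * m. f (real k / real m)) / real m = (\<Sum>k<N*m. f (real (Suc k) / real m)) / real m
      + (f 0 - f (real N)) / real m"
    if "m > 0" for m
  proof -
    have "(\<Sum>k<N*m. f (real (Suc k) / real m)) - (\<Sum>k<N * m. f (real k / real m))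
        = f (real (N*m) / real m) - f (real 0 / real m)"
      by (subst sum_subtractf[symmetric], rule sum_lessThan_telescope)
    then have "(\<Sum>k<N * m. f (real k / real m)) = (\<Sum>k<N*m. f (real (Suc k) / real m)) + (f 0 - f (real N))"
      using that by (simp add: algebra_simps)
    then show ?thesis by (simp only: add_divide_distrib)
  qed
  have "(\<lambda>m. (LBINT s:{0<..real N}. ?g m s) + (f 0 - f (real N)) / real m) \<longlonglongrightarrow> (LBINT s:{0..real N}. f s) + 0"
    by (intro tendsto_add 1 lim_const_over_n)
  moreover have "eventually (\<lambda>m. (LBINT s:{0<..real N}. ?g m s) + (f 0 - f (real N)) / real m
      = (\<Sum>k<N * m. f (real k / real m)) / real m) sequentially"
    using eventually_gt_at_top[of 0] by eventually_elim (simp add: 2 3)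
  ultimately show ?thesis by (simp add: filterlim_cong tendsto_cong)
qed

section \<open>Reflection at zero and the Lindley recursion\<close>

lemma right_cont_iff_eps:
  "right_cont f \<longleftrightarrow> (\<forall>t\<ge>0. \<forall>e>0. \<exists>d>0. \<forall>x. t \<le> x \<longrightarrow> x < t + d \<longrightarrow> \<bar>f x - f t\<bar> < e)"
proof
  assume "right_cont f"
  then show "\<forall>t\<ge>0. \<forall>e>0. \<exists>d>0. \<forall>x. t \<le> x \<longrightarrow> x < t + d \<longrightarrow> \<bar>f x - f t\<bar> < e"
    unfolding right_cont_def using continuous_at_right_real_eps by blast
next
  assume *: "\<forall>t\<ge>0. \<forall>e>0. \<exists>d>0. \<forall>x. t \<le> x \<longrightarrow> x < t + d \<longrightarrow> \<bar>f x - f t\<bar> < e"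
  show "right_cont f" unfolding right_cont_def continuous_within
  proof (intro allI impI tendstoI)
    fix t e :: real assume "t \<ge> 0" "e > 0"
    then obtain d where d: "d > 0" "\<forall>x. t \<le> x \<longrightarrow> x < t + d \<longrightarrow> \<bar>f x - f t\<bar> < e" using * by blast
    then show "eventually (\<lambda>x. dist (f x) (f t) < e) (at_right t)"
      unfolding eventually_at_right_field by (intro exI[of _ "t + d"]) (auto simp: dist_real_def)
  qed
qed

lemma grid_floor:
  fixes s :: real assumes "0 \<le> s" "0 < m"
  obtains j :: nat where "real j / real m \<le> s" "s < real j / real m + 1 / real m"
proof
  have a: "0 \<le> real m * s" using assms by simp
  have b: "real (nat \<lfloor>real m * s\<rfloor>) = of_int \<lfloor>real m * s\<rfloor>" using a by simp
  have "of_int \<lfloor>real m * s\<rfloor> \<le> real m * s" "real m * s < of_int \<lfloor>real m * s\<rfloor> + 1" by linarith+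
  then show "real (nat \<lfloor>real m * s\<rfloor>) / real m \<le> s" "s < real (nat \<lfloor>real m * s\<rfloor>) / real m + 1 / real m"
    using assms unfolding b by (simp_all add: field_simps)
qed

lemma drops_vanish_on_grid:
  assumes "drops_vanish_on f b" "e > 0"
  shows "\<exists>m0>0. \<forall>m\<ge>m0. \<forall>s t. 0 \<le> s \<longrightarrow> s \<le> t \<longrightarrow> t \<le> b \<longrightarrow> t - s \<le> 1 / real m \<longrightarrow> f s - e < f t"
proof -
  obtain d where d: "d > 0" "\<forall>s t. 0 \<le> s \<longrightarrow> s \<le> t \<longrightarrow> t \<le> b \<longrightarrow> t - s < d \<longrightarrow> f s - e < f t"
    using assms unfolding drops_vanish_on_def by blast
  obtain n where n: "n > 0" "1 / real n < d" using d(1) by (metis nat_approx_posE zero_less_Suc)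
  have "1 / real m < d" if "m \<ge> n" for m
    using that n frac_le[of 1 1 "real n" "real m"] by simp
  then show ?thesis using d(2) n(1) by (intro exI[of _ n]) force
qed

lemma drops_vanish_on_bdd_below:
  assumes "drops_vanish_on f b"
  shows "bdd_below (f ` {0..b})"
proof -
  obtain m where m: "m > 0" "\<And>s t. 0 \<le> s \<Longrightarrow> s \<le> t \<Longrightarrow> t \<le> b \<Longrightarrow> t - s \<le> 1 / real m \<Longrightarrow> f s - 1 < f t"
    using drops_vanish_on_grid[OF assms zero_less_one] by blast
  let ?A = "(\<lambda>j. f (real j / real m)) ` {..nat \<lceil>b * real m\<rceil>}"
  have "Min ?A - 1 \<le> f t" if t: "t \<in> {0..b}" for t
  proof -
    obtain j :: nat where j: "real j / real m \<le> t" "t < real j / real m + 1 / real m"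
      using grid_floor[of t m] t m(1) by auto
    have "real j \<le> t * real m" using j(1) m(1) by (simp add: field_simps)
    also have "\<dots> \<le> b * real m" using t by (simp add: mult_right_mono)
    finally have "j \<le> nat \<lceil>b * real m\<rceil>" by linarith
    then have "Min ?A \<le> f (real j / real m)" by (intro Min_le) auto
    moreover have "f (real j / real m) - 1 < f t" using m(2)[of "real j / real m" t] j t by auto
    ultimately show ?thesis by linarith
  qed
  then show ?thesis by (intro bdd_belowI2)
qed

text \<open>The regulator is the least nonnegative upper bound of \<open>- (w + x s)\<close> over \<open>s \<le> t\<close>. These
  three properties replace the infimum in its definition.\<close>

lemma regulator_bounds:
  assumes "bdd_below (x ` {0..t})" "0 \<le> t"
  shows regulator_nonneg: "0 \<le> regulator w x t"
    and regulator_lower: "0 \<le> s \<Longrightarrow> s \<le> t \<Longrightarrow> - (w + x s) \<le> regulator w x t"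
    and regulator_upper: "0 \<le> c \<Longrightarrow> (\<And>s. 0 \<le> s \<Longrightarrow> s \<le> t \<Longrightarrow> - (w + x s) \<le> c) \<Longrightarrow> regulator w x t \<le> c"
proof -
  obtain B where B: "\<And>s. s \<in> {0..t} \<Longrightarrow> B \<le> x s" using assms(1) unfolding bdd_below_def by (meson imageI)
  have bdd: "bdd_below ((\<lambda>s. min (w + x s) 0) ` {0..t})"
    by (rule bdd_belowI2[of _ "min (w + B) 0"]) (use B in \<open>fastforce intro: min.mono add_left_mono\<close>)
  have low: "(INF s\<in>{0..t}. min (w + x s) 0) \<le> min (w + x s) 0" if "0 \<le> s" "s \<le> t" for s
    by (rule cINF_lower[OF bdd]) (use that in auto)
  show "0 \<le> regulator w x t" using low[of 0] assms(2) unfolding regulator_def by linarith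
  show "- (w + x s) \<le> regulator w x t" if "0 \<le> s" "s \<le> t" using low[OF that] unfolding regulator_def by linarith
  show "regulator w x t \<le> c" if "0 \<le> c" "\<And>s. 0 \<le> s \<Longrightarrow> s \<le> t \<Longrightarrow> - (w + x s) \<le> c"
  proof -
    have "- c \<le> (INF s\<in>{0..t}. min (w + x s) 0)"
      by (rule cINF_greatest) (use assms(2) that in \<open>force+\<close>)
    then show ?thesis unfolding regulator_def by linarith
  qed
qed

lemma right_cont_reflected:
  assumes rc: "right_cont x" and dv: "\<And>b. drops_vanish_on x b"
  shows "right_cont (reflected w x)"
  unfolding right_cont_iff_eps
proof (intro allI impI)
  fix t e :: real assume t: "t \<ge> 0" and e: "e > 0"
  note bb = regulator_bounds[OF drops_vanish_on_bdd_below[OF dv]]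
  obtain d1 where d1: "d1 > 0" "\<And>y. t \<le> y \<Longrightarrow> y < t + d1 \<Longrightarrow> \<bar>x y - x t\<bar> < e / 2"
    using rc t e unfolding right_cont_iff_eps by (meson half_gt_zero)
  have "\<bar>reflected w x y - reflected w x t\<bar> < e" if y: "t \<le> y" "y < t + d1" for y
  proof -
    have "regulator w x t \<le> regulator w x y"
      by (rule bb(3)) (use bb(1)[of y w] bb(2)[of y _ w] t y in auto)
    moreover have "regulator w x y \<le> regulator w x t + e / 2"
    proof (rule bb(3))
      fix s assume s: "0 \<le> s" "s \<le> y"
      show "- (w + x s) \<le> regulator w x t + e / 2"
      proof (cases "s \<le> t")
        case True then show ?thesis using bb(2)[OF t s(1) True, of w] e by simp
      next
        case False
        then have "\<bar>x s - x t\<bar> < e / 2" using d1(2)[of s] s y by auto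
        then show ?thesis using bb(2)[OF t t order_refl, of w] by linarith
      qed
    qed (use t y e bb(1)[OF t, of w] in auto)
    ultimately show ?thesis using d1(2)[OF y] unfolding reflected_def by linarith
  qed
  then show "\<exists>d>0. \<forall>y. t \<le> y \<longrightarrow> y < t + d \<longrightarrow> \<bar>reflected w x y - reflected w x t\<bar> < e"
    using d1(1) by blast
qed

lemma reflected_nonneg:
  assumes "bdd_below (x ` {0..t})" "0 \<le> t"
  shows "0 \<le> reflected w x t"
  using regulator_lower[OF assms, of t w] assms(2) unfolding reflected_def by simp

fun lindley :: "real \<Rightarrow> (nat \<Rightarrow> real) \<Rightarrow> nat \<Rightarrow> real" where
  "lindley w d 0 = w"
| "lindley w d (Suc k) = max 0 (lindley w d k + d k)"

text \<open>The push that keeps the recursion nonnegative in step \<open>k\<close>.\<close>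

definition lindley_reg :: "real \<Rightarrow> (nat \<Rightarrow> real) \<Rightarrow> nat \<Rightarrow> real" where
  "lindley_reg w d k = max 0 (- (lindley w d k + d k))"

lemma lindley_nonneg: "0 \<le> w \<Longrightarrow> 0 \<le> lindley w d k"
  by (cases k) auto

lemma lindley_decomp: "lindley w d k = w + (\<Sum>l<k. d l) + (\<Sum>l<k. lindley_reg w d l)"
  by (induction k) (auto simp: lindley_reg_def max_def)

text \<open>Discrete counterpart of the properties of the regulator: the accumulated push is the
  running maximum of zero and the negative of the free walk.\<close>

lemma lindley_reg_sum_bounds:
  assumes "0 \<le> w"
  shows "j \<le> k \<Longrightarrow> - (w + (\<Sum>l<j. d l)) \<le> (\<Sum>l<k. lindley_reg w d l)"
    and "(\<Sum>l<k. lindley_reg w d l) = 0 \<or> (\<exists>j\<le>k. (\<Sum>l<k. lindley_reg w d l) = - (w + (\<Sum>l<j. d l)))"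
proof -
  show "- (w + (\<Sum>l<j. d l)) \<le> (\<Sum>l<k. lindley_reg w d l)" if "j \<le> k"
  proof -
    have "(\<Sum>l<j. lindley_reg w d l) \<le> (\<Sum>l<k. lindley_reg w d l)"
      by (rule sum_mono2) (use that in \<open>auto simp: lindley_reg_def\<close>)
    then show ?thesis using lindley_nonneg[OF assms, of d j] lindley_decomp[of w d j] by linarith
  qed
  show "(\<Sum>l<k. lindley_reg w d l) = 0 \<or> (\<exists>j\<le>k. (\<Sum>l<k. lindley_reg w d l) = - (w + (\<Sum>l<j. d l)))"
  proof (induction k)
    case (Suc k)
    show ?case
    proof (cases "lindley_reg w d k = 0")
      case True then show ?thesis using Suc by (auto simp: le_Suc_eq)
    next
      case False
      then have "lindley w d (Suc k) = 0" by (auto simp: lindley_reg_def max_def split: if_splits)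
      then show ?thesis using lindley_decomp[of w d "Suc k"]
        by (intro disjI2 exI[of _ "Suc k"]) linarith
    qed
  qed simp
qed

text \<open>The balance equation of the recursion. A step that ends at or above zero is not pushed;
  one that would end at \<open>- r\<close> is pushed by \<open>r\<close>, and its exponential would have exceeded \<open>1\<close> by
  exactly \<open>exp (a * r) - 1\<close>.\<close>

lemma lindley_exp_identity:
  "exp (- a * lindley w d n) - exp (- a * w) =
    (\<Sum>k<n. exp (- a * lindley w d k) * (exp (- a * d k) - 1)) - (\<Sum>k<n. exp (a * lindley_reg w d k) - 1)"
proof (induction n)
  case (Suc n)
  have "exp (- a * lindley w d (Suc n)) - exp (- a * lindley w d n) =
     exp (- a * lindley w d n) * (exp (- a * d n) - 1) - (exp (a * lindley_reg w d n) - 1)"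
    by (cases "lindley w d n + d n \<ge> 0") (simp_all add: lindley_reg_def algebra_simps flip: exp_add)
  then show ?case using Suc by simp
qed simp

text \<open>Both regulators are running maxima. The one on the grid misses only what the path falls
  between two neighbouring grid points, which is at most \<open>e\<close>.\<close>

lemma lindley_close_to_reflected:
  assumes w: "0 \<le> w" and m: "0 < m" and e: "0 \<le> e"
    and drop: "\<And>s t. 0 \<le> s \<Longrightarrow> s \<le> t \<Longrightarrow> t \<le> b \<Longrightarrow> t - s \<le> 1 / real m \<Longrightarrow> x s - e \<le> x t"
    and close: "\<And>j. real j / real m \<le> b \<Longrightarrow> \<bar>(\<Sum>l<j. d l) - x (real j / real m)\<bar> \<le> e"
    and bdd: "bdd_below (x ` {0..b})" and k: "real k / real m \<le> b"
  shows "\<bar>(\<Sum>l<k. lindley_reg w d l) - regulator w x (real k / real m)\<bar> \<le> 2 * e"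
    and "\<bar>lindley w d k - reflected w x (real k / real m)\<bar> \<le> 3 * e"
proof -
  let ?t = "real k / real m"
  have t0: "0 \<le> ?t" by simp
  have bdd': "bdd_below (x ` {0..?t})" by (rule bdd_below_mono[OF bdd]) (use k in auto)
  note bb = regulator_bounds[OF bdd' t0]
  let ?l = "\<Sum>l<k. lindley_reg w d l"
  have le_b: "real j / real m \<le> b" if "j \<le> k" for j
    using that k m by (meson divide_right_mono of_nat_0_le_iff of_nat_mono order_trans)
  have "?l \<le> regulator w x ?t + e"
  proof (cases "?l = 0")
    case True then show ?thesis using bb(1)[of w] e by simp
  next
    case False
    then obtain j where j: "j \<le> k" "?l = - (w + (\<Sum>l<j. d l))" using lindley_reg_sum_bounds(2)[OF w] by blast
    have "real j / real m \<le> ?t" using j m by (simp add: divide_right_mono)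
    then show ?thesis using bb(2)[of "real j / real m" w] close[OF le_b[OF j(1)]] j(2) by simp
  qed
  moreover have "regulator w x ?t \<le> ?l + 2 * e"
  proof (rule bb(3))
    show "0 \<le> ?l + 2 * e" using e by (auto intro!: add_nonneg_nonneg sum_nonneg simp: lindley_reg_def)
    fix s assume s: "0 \<le> s" "s \<le> ?t"
    obtain j :: nat where j: "real j / real m \<le> s" "s < real j / real m + 1 / real m"
      using grid_floor[OF s(1) m] by blast
    have jk: "j \<le> k" using j(1) s(2) m by (metis dual_order.trans divide_le_cancel of_nat_0_less_iff
        of_nat_le_iff order.asym)
    have "x (real j / real m) - e \<le> x s" using drop[of "real j / real m" s] j s k by auto
    then show "- (w + x s) \<le> ?l + 2 * e"
      using lindley_reg_sum_bounds(1)[OF w jk, of d] close[OF le_b[OF jk]] by linarith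
  qed
  ultimately show 1: "\<bar>?l - regulator w x ?t\<bar> \<le> 2 * e" using e by linarith
  show "\<bar>lindley w d k - reflected w x ?t\<bar> \<le> 3 * e"
    using 1 close[OF k] lindley_decomp[of w d k] unfolding reflected_def by linarith
qed

section \<open>Switched paths and their discretisation\<close>

text \<open>The mode is read off at the left end of each cell. It is thus known before the
  increment, as the martingale property requires.\<close>

definition grid_input :: "(real \<Rightarrow> real) \<Rightarrow> (real \<Rightarrow> real) \<Rightarrow> (real \<Rightarrow> real) \<Rightarrow> nat \<Rightarrow> nat \<Rightarrow> real" where
  "grid_input J xu xd m l = (if J (real l / real m) = 1
     then xd (real (Suc l) / real m) - xd (real l / real m)
     else xu (real (Suc l) / real m) - xu (real l / real m))"

lemma unbounded_sequence_cell:
  fixes p :: "nat \<Rightarrow> real"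
  assumes "p 0 \<le> s" "\<exists>i. s < p i"
  obtains i where "p i \<le> s" "s < p (Suc i)"
proof -
  define k where "k = (LEAST j. s < p j)"
  have k: "s < p k" unfolding k_def using assms(2) by (rule LeastI_ex)
  then have "k \<noteq> 0" using assms(1) by (metis not_le)
  then obtain i where i: "k = Suc i" by (cases k) auto
  then have "\<not> s < p i" using not_less_Least[of i "\<lambda>j. s < p j"] k_def by simp
  then show ?thesis using that k i by force
qed

text \<open>One path of the model. All switching times form a single sequence in which even indices
  start down periods, and \<open>X\<close> collects the increments of \<open>xd\<close> and \<open>xu\<close> in turn.\<close>

locale switched_path =
  fixes p :: "nat \<Rightarrow> real" and J xu xd X :: "real \<Rightarrow> real"
  assumes p0: "p 0 = 0" and p_step: "p i \<le> p (Suc i)" and p_unbounded: "\<exists>i. b < p i"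
    and J_eq: "p i \<le> s \<Longrightarrow> s < p (Suc i) \<Longrightarrow> J s = of_bool (even i)"
    and X_eq: "0 \<le> t \<Longrightarrow> t \<le> p K \<Longrightarrow>
        X t = (\<Sum>i<K. (if even i then xd else xu) (min (p (Suc i)) t) - (if even i then xd else xu)
            (min (p i) t))"
    and xu_rc: "right_cont xu" and xd_rc: "right_cont xd"
    and xu_dv: "drops_vanish_on xu b" and xd_dv: "drops_vanish_on xd b"
begin

definition mode :: "nat \<Rightarrow> real \<Rightarrow> real" where
  "mode i = (if even i then xd else xu)"

lemma X_mode:
  "0 \<le> t \<Longrightarrow> t \<le> p K \<Longrightarrow> X t = (\<Sum>i<K. mode i (min (p (Suc i)) t) - mode i (min (p i) t))"
  unfolding mode_def by (rule X_eq)

lemma p_mono: "i \<le> j \<Longrightarrow> p i \<le> p j"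
  using p_step by (rule lift_Suc_mono_le)

lemma p_nonneg: "0 \<le> p i" using p_mono[of 0 i] p0 by simp

lemma cell: assumes "0 \<le> s" obtains i where "p i \<le> s" "s < p (Suc i)"
  by (rule unbounded_sequence_cell[of p s]) (use assms p0 p_unbounded in auto)

lemma J_01: "0 \<le> s \<Longrightarrow> J s = 0 \<or> J s = 1"
  by (rule cell[of s]) (simp_all add: J_eq)

lemma J_bounds: "0 \<le> s \<Longrightarrow> 0 \<le> J s" "0 \<le> s \<Longrightarrow> J s \<le> 1"
  using J_01[of s] by auto

lemma J_right_cont: "right_cont J"
  unfolding right_cont_iff_eps
proof (intro allI impI)
  fix t e :: real assume "t \<ge> 0" "e > 0"
  obtain i where i: "p i \<le> t" "t < p (Suc i)" using cell[OF \<open>t \<ge> 0\<close>] .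
  have "\<bar>J x - J t\<bar> < e" if "t \<le> x" "x < t + (p (Suc i) - t)" for x
    using J_eq[OF i] J_eq[of i x] i that \<open>e > 0\<close> by simp
  then show "\<exists>d>0. \<forall>x. t \<le> x \<longrightarrow> x < t + d \<longrightarrow> \<bar>J x - J t\<bar> < e"
    using i by (intro exI[of _ "p (Suc i) - t"]) auto
qed

lemma right_cont_stopped:
  assumes "right_cont f"
  shows "right_cont (\<lambda>t. f (min q t))"
  unfolding right_cont_iff_eps
proof (intro allI impI)
  fix t e :: real assume t: "t \<ge> 0" and e: "e > 0"
  obtain d where d: "d > 0" "\<And>x. t \<le> x \<Longrightarrow> x < t + d \<Longrightarrow> \<bar>f x - f t\<bar> < e"
    using assms t e unfolding right_cont_iff_eps by meson
  show "\<exists>d>0. \<forall>x. t \<le> x \<longrightarrow> x < t + d \<longrightarrow> \<bar>f (min q x) - f (min q t)\<bar> < e"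
  proof (cases "q \<le> t")
    case True then show ?thesis using e by (intro exI[of _ 1]) (auto simp: min_def)
  next
    case False
    then show ?thesis using d by (intro exI[of _ "min d (q - t)"]) (auto simp: min_def)
  qed
qed

lemma mode_right_cont: "right_cont (mode i)"
  using xu_rc xd_rc by (simp add: mode_def)

lemma X_right_cont: "right_cont X"
  unfolding right_cont_def
proof (intro allI impI)
  fix t :: real assume t: "0 \<le> t"
  obtain K where K: "t < p K" using p_unbounded by blast
  let ?Y = "\<lambda>t. \<Sum>i<K. mode i (min (p (Suc i)) t) - mode i (min (p i) t)"
  have "continuous (at_right t) ?Y"
  proof (intro continuous_sum continuous_diff)
    fix i
    show "continuous (at_right t) (\<lambda>t. mode i (min (p (Suc i)) t))"
        "continuous (at_right t) (\<lambda>t. mode i (min (p i) t))"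
      using right_cont_stopped[OF mode_right_cont] t unfolding right_cont_def by blast+
  qed
  then have "(?Y \<longlongrightarrow> ?Y t) (at_right t)" by (simp add: continuous_within)
  moreover have "eventually (\<lambda>s. X s = ?Y s) (at_right t)"
    unfolding eventually_at_right_field
    using K t X_mode[of _ K] by (intro exI[of _ "p K"]) simp
  ultimately have "(X \<longlongrightarrow> X t) (at_right t)"
    using X_mode[of t K] t K by (simp add: filterlim_cong tendsto_cong)
  then show "continuous (at_right t) X" by (simp add: continuous_within)
qed

text \<open>An increment of \<open>X\<close> over \<open>{s..t}\<close> is a sum of increments of \<open>xu\<close> and \<open>xd\<close> over disjoint
  subintervals, whose number is bounded on \<open>{0..b}\<close>.\<close>

lemma X_drops_vanish: "drops_vanish_on X b"
  unfolding drops_vanish_on_def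
proof (intro allI impI)
  fix e :: real assume e: "e > 0"
  obtain K where K: "b < p K" using p_unbounded by blast
  (* at most K pieces of the path meet {0..b} *)
  define e' where "e' = e / (real K + 1)"
  have e': "e' > 0" using e by (simp add: e'_def)
  obtain d1 where d1: "d1 > 0" "\<And>s t. 0 \<le> s \<Longrightarrow> s \<le> t \<Longrightarrow> t \<le> b \<Longrightarrow> t - s < d1 \<Longrightarrow> xu s - e' < xu t"
    using xu_dv[of b] e' unfolding drops_vanish_on_def by meson
  obtain d2 where d2: "d2 > 0" "\<And>s t. 0 \<le> s \<Longrightarrow> s \<le> t \<Longrightarrow> t \<le> b \<Longrightarrow> t - s < d2 \<Longrightarrow> xd s - e' < xd t"
    using xd_dv[of b] e' unfolding drops_vanish_on_def by meson
  have "X s - e < X t" if st: "0 \<le> s" "s \<le> t" "t \<le> b" "t - s < min d1 d2" for s t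
  proof -
    have piece: "- e' \<le> (mode i (min (p (Suc i)) t) - mode i (min (p i) t)) -
        (mode i (min (p (Suc i)) s) - mode i (min (p i) s))" (is "_ \<le> ?r") for i
    proof -
      have dm: "mode i s' - e' < mode i t'" if "0 \<le> s'" "s' \<le> t'" "t' \<le> b" "t' - s' < min d1 d2" for s' t'
        using d1(2)[of s' t'] d2(2)[of s' t'] that by (auto simp: mode_def)
      consider "t \<le> p i" | "p (Suc i) \<le> s" | "p i < t" "s < p (Suc i)" by linarith
      then show ?thesis
      proof cases
        case 1
        then have "min (p (Suc i)) t = t" "min (p i) t = t" "min (p (Suc i)) s = s" "min (p i) s = s"
          using st p_step[of i] by auto
        then have "?r = 0" by simp
        then show ?thesis using e' by simp
      next
        case 2
        then have "min (p (Suc i)) t = p (Suc i)" "min (p i) t = p i" "min (p (Suc i)) s = p (Suc i)"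
            "min (p i) s = p i"
          using st p_step[of i] by auto
        then have "?r = 0" by simp
        then show ?thesis using e' by simp
      next
        case 3
        then have "?r = mode i (min (p (Suc i)) t) - mode i (max (p i) s)"
          using st by (simp add: min_def max_def)
        moreover have "mode i (max (p i) s) - e' < mode i (min (p (Suc i)) t)"
          by (rule dm) (use st 3 p_step[of i] p_nonneg[of i] in auto)
        ultimately show ?thesis by linarith
      qed
    qed
    have "X t - X s = (\<Sum>i<K. (mode i (min (p (Suc i)) t) - mode i (min (p i) t)) -
        (mode i (min (p (Suc i)) s) - mode i (min (p i) s)))"
      using X_mode[of t K] X_mode[of s K] st K by (simp add: sum_subtractf)
    also have "\<dots> \<ge> (\<Sum>i<K. - e')" by (rule sum_mono[OF piece])
    finally have "- (real K * e') \<le> X t - X s" by simp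
    moreover have "real K * e' < e" using e by (simp add: e'_def field_simps)
    ultimately show ?thesis by linarith
  qed
  then show "\<exists>d>0. \<forall>s t. 0 \<le> s \<longrightarrow> s \<le> t \<longrightarrow> t \<le> b \<longrightarrow> t - s < d \<longrightarrow> X s - e < X t"
    using d1(1) d2(1) by (intro exI[of _ "min d1 d2"]) auto
qed

text \<open>On the grid a switch takes effect at the first grid point \<open>a i / m\<close> not before \<open>p i\<close>.
  The accumulated input is therefore the sum that defines \<open>X\<close>, with \<open>p i\<close> replaced by
  \<open>a i / m\<close>.\<close>

lemma grid_input_sum:
  assumes m: "m > 0"
  defines "a \<equiv> \<lambda>i. nat \<lceil>real m * p i\<rceil>"
  assumes k: "k \<le> a K"
  shows "(\<Sum>l<k. grid_input J xu xd m l) =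
    (\<Sum>i<K. mode i (real (min (a (Suc i)) k) / real m) - mode i (real (min (a i) k) / real m))"
  using k
proof (induction k)
  case (Suc k)
  have a_le: "a i \<le> l \<longleftrightarrow> p i \<le> real l / real m" for i l
  proof -
    have "a i \<le> l \<longleftrightarrow> real m * p i \<le> real l"
      unfolding a_def by (simp add: nat_le_iff ceiling_le_iff)
    then show ?thesis using m by (simp add: field_simps)
  qed
  have a_mono: "a i \<le> a j" if "i \<le> j" for i j
    unfolding a_def using p_mono[OF that] by (intro nat_mono ceiling_mono mult_left_mono) auto
  obtain i where i: "p i \<le> real k / real m" "real k / real m < p (Suc i)"
    using cell[of "real k / real m"] by auto
  have ai: "a i \<le> k" "k < a (Suc i)" using i a_le[of i k] a_le[of "Suc i" k] by auto
  have iK: "i < K"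
  proof (rule ccontr)
    assume "\<not> i < K"
    then have "a K \<le> a i" using a_mono by simp
    then show False using ai Suc.prems by simp
  qed
  have grid: "grid_input J xu xd m k = mode i (real (Suc k) / real m) - mode i (real k / real m)"
    using J_eq[OF i] by (simp add: grid_input_def mode_def)
  let ?F = "\<lambda>k i. mode i (real (min (a (Suc i)) k) / real m) - mode i (real (min (a i) k) / real m)"
  have step: "?F (Suc k) j = ?F k j + (if j = i then grid_input J xu xd m k else 0)" for j
  proof -
    consider "j < i" | "j = i" | "i < j" by linarith
    then show ?thesis
    proof cases
      case 1
      then have "a (Suc j) \<le> k" "a j \<le> k" using a_mono[of "Suc j" i] a_mono[of j i] ai by auto
      then show ?thesis using 1 by (simp add: min_def)
    next
      case 2
      have "min (a (Suc i)) (Suc k) = Suc k" "min (a (Suc i)) k = k" "min (a i) (Suc k) = a i"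
          "min (a i) k = a i"
        using ai by auto
      then show ?thesis using 2 grid by simp
    next
      case 3
      then have "k < a (Suc j)" "k < a j" using a_mono[of "Suc i" "Suc j"] a_mono[of "Suc i" j] ai by auto
      then have "min (a (Suc j)) (Suc k) = Suc k" "min (a (Suc j)) k = k" "min (a j) (Suc k) = Suc k"
          "min (a j) k = k"
        by auto
      then show ?thesis using 3 by simp
    qed
  qed
  have "(\<Sum>j<K. ?F (Suc k) j) = (\<Sum>j<K. ?F k j) + grid_input J xu xd m k"
    unfolding step sum.distrib using iK by (simp add: sum.delta)
  then show ?case using Suc by simp
qed simp

text \<open>The error does not depend on \<open>k\<close>: it comes only from the displacement of finitely many
  switching times, each to the right and by less than \<open>1 / m\<close>.\<close>

lemma grid_input_close:
  "\<exists>e. e \<longlonglongrightarrow> 0 \<and> (\<forall>m k. 0 < m \<longrightarrow> real k / real m \<le> b \<longrightarrow> \<bar>(\<Sum>l<k. grid_input J xu xd m l) - X (real k / real m)\<bar>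
      \<le> e m)"
proof -
  obtain K where K: "b < p K" using p_unbounded by blast
  let ?a = "\<lambda>m i. nat \<lceil>real m * p i\<rceil>"
  let ?e = "\<lambda>m. \<Sum>i<K. \<bar>mode i (real (?a m (Suc i)) / real m) - mode i (p (Suc i))\<bar>
      + \<bar>mode i (real (?a m i) / real m) - mode i (p i)\<bar>"
  have "?e \<longlonglongrightarrow> (\<Sum>i<K. \<bar>mode i (p (Suc i)) - mode i (p (Suc i))\<bar> + \<bar>mode i (p i) - mode i (p i)\<bar>)"
    by (intro tendsto_sum tendsto_add tendsto_rabs tendsto_diff tendsto_const right_cont_grid_tendsto
        mode_right_cont p_nonneg)
  then have lim: "?e \<longlonglongrightarrow> 0" by (simp only: diff_self abs_zero add_0 sum.neutral_const)
  have bound: "\<bar>(\<Sum>l<k. grid_input J xu xd m l) - X (real k / real m)\<bar> \<le> ?e m" if m: "0 < m" and k: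
      "real k / real m \<le> b" for m k
  proof -
    let ?t = "real k / real m"
    have kK: "k \<le> ?a m K"
    proof -
      have "?t \<le> p K" using k K by simp
      then have "real k \<le> real m * p K" using m by (simp add: field_simps)
      then show ?thesis by linarith
    qed
    have one: "\<bar>mode i (real (min (?a m j) k) / real m) - mode i (min (p j) ?t)\<bar>
        \<le> \<bar>mode i (real (?a m j) / real m) - mode i (p j)\<bar>" for i j
    proof (cases "?t \<le> p j")
      case True
      then have "real k \<le> real m * p j" using m by (simp add: field_simps)
      then have "k \<le> ?a m j" by linarith
      then have "min (?a m j) k = k" "min (p j) ?t = ?t" using True by auto
      then show ?thesis by simp
    next
      case False
      then have "real m * p j \<le> real k" using m by (simp add: field_simps)
      then have "?a m j \<le> k" by linarith
      then have "min (?a m j) k = ?a m j" "min (p j) ?t = p j" using False by auto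
      then show ?thesis by simp
    qed
    have tri: "\<bar>(a - b) - (c - d)\<bar> \<le> \<bar>a - c\<bar> + \<bar>b - d\<bar>" for a b c d :: real by linarith
    have eq: "(\<Sum>l<k. grid_input J xu xd m l) - X ?t
        = (\<Sum>i<K. (mode i (real (min (?a m (Suc i)) k) / real m) - mode i (real (min (?a m i) k) / real m))
       - (mode i (min (p (Suc i)) ?t) - mode i (min (p i) ?t)))"
    proof -
      have "X ?t = (\<Sum>i<K. mode i (min (p (Suc i)) ?t) - mode i (min (p i) ?t))"
        by (rule X_mode) (use k K in auto)
      then show ?thesis using grid_input_sum[OF m kK] by (simp only: sum_subtractf)
    qed
    show ?thesis unfolding eq
    proof (rule order_trans[OF sum_abs sum_mono])
      fix i
      show "\<bar>(mode i (real (min (?a m (Suc i)) k) / real m) - mode i (real (min (?a m i) k) / real m))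
       - (mode i (min (p (Suc i)) ?t) - mode i (min (p i) ?t))\<bar>
           \<le> \<bar>mode i (real (?a m (Suc i)) / real m) - mode i (p (Suc i))\<bar> + \<bar>mode i (real (?a m i) / real m)
           - mode i (p i)\<bar>"
        by (rule order_trans[OF tri add_mono[OF one[of i "Suc i"] one[of i i]]])
    qed
  qed
  show ?thesis proof (intro exI conjI allI impI)
    show "?e \<longlonglongrightarrow> 0" by (rule lim)
    show "\<bar>(\<Sum>l<k. grid_input J xu xd m l) - X (real k / real m)\<bar> \<le> ?e m" if "0 < m" "real k / real m \<le> b"
        for m k
      by (rule bound[OF that])
  qed
qed

end

section \<open>Path limit of the discrete balance equation\<close>

lemma exp_increment_limit: "(\<lambda>m. real m * (exp (x / real m) - 1)) \<longlonglongrightarrow> x"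
proof (cases "x = 0")
  case False
  have "((\<lambda>h::real. (exp (0 + h) - exp 0) / h) \<longlongrightarrow> exp 0) (at 0)"
    using DERIV_exp[of "0::real"] unfolding DERIV_def .
  then have d: "((\<lambda>h::real. (exp h - 1) / h) \<longlongrightarrow> 1) (at 0)" by simp
  have "filterlim (\<lambda>m. x / real m) (at 0) sequentially"
    unfolding filterlim_at using False lim_const_over_n[of x]
    by (auto simp: eventually_sequentially intro!: exI[of _ 1])
  then have "((\<lambda>m. (exp (x / real m) - 1) / (x / real m)) \<longlongrightarrow> 1) sequentially"
    by (rule filterlim_compose[OF d])
  then have "((\<lambda>m. x * ((exp (x / real m) - 1) / (x / real m))) \<longlongrightarrow> x * 1) sequentially"
    by (intro tendsto_mult tendsto_const)
  then show ?thesis using False by (simp add: mult.commute)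
qed simp

lemma exp_neg_Lipschitz:
  fixes x y a :: real assumes "0 \<le> x" "0 \<le> y" "0 \<le> a"
  shows "\<bar>exp (- a * x) - exp (- a * y)\<bar> \<le> a * \<bar>x - y\<bar>"
proof -
  have one: "exp (- a * u) - exp (- a * v) \<le> a * (v - u)" if "0 \<le> u" "u \<le> v" for u v
  proof -
    have "1 - a * (v - u) \<le> exp (- (a * (v - u)))" using exp_ge_add_one_self[of "- (a * (v - u))"] by simp
    then have "1 - exp (- (a * (v - u))) \<le> a * (v - u)" by simp
    moreover have "exp (- a * u) * (1 - exp (- (a * (v - u)))) \<le> 1 * (1 - exp (- (a * (v - u))))"
      using that assms by (intro mult_right_mono) (auto simp: mult_nonneg_nonneg)
    moreover have "exp (- a * u) - exp (- a * v) = exp (- a * u) * (1 - exp (- (a * (v - u))))"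
      by (simp add: algebra_simps flip: exp_add)
    ultimately show ?thesis by (simp only: mult_1)
  qed
  show ?thesis
  proof (cases "x \<le> y")
    case True
    then have "exp (- a * y) \<le> exp (- a * x)" using assms by (simp add: mult_left_mono)
    then show ?thesis using one[OF assms(1) True] True by simp
  next
    case False
    then have "exp (- a * x) \<le> exp (- a * y)" using assms by (simp add: mult_left_mono)
    then show ?thesis using one[OF assms(2), of x] False by simp
  qed
qed

text \<open>The mean of the exponential of a grid increment in the mode in force.\<close>

definition grid_rate :: "(real \<Rightarrow> real) \<Rightarrow> real \<Rightarrow> real \<Rightarrow> nat \<Rightarrow> nat \<Rightarrow> real" where
  "grid_rate J \<phi> \<eta> m k = (if J (real k / real m) = 1 then exp (- \<eta> / real m) else exp (\<phi> / real m))"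

context switched_path
begin

lemma grid_lindley_close:
  assumes w: "0 \<le> w" and e: "0 < e"
  shows "eventually (\<lambda>m. \<forall>k. real k / real m \<le> b \<longrightarrow>
      \<bar>(\<Sum>l<k. lindley_reg w (grid_input J xu xd m) l) - regulator w X (real k / real m)\<bar> \<le> e \<and>
      \<bar>lindley w (grid_input J xu xd m) k - reflected w X (real k / real m)\<bar> \<le> e) sequentially"
proof -
  obtain r where r: "r \<longlonglongrightarrow> 0"
    "\<And>m k. 0 < m \<Longrightarrow> real k / real m \<le> b \<Longrightarrow> \<bar>(\<Sum>l<k. grid_input J xu xd m l) - X (real k / real m)\<bar> \<le> r m"
    using grid_input_close[of b] by blast
  have e3: "e / 3 > 0" using e by simp
  obtain m0 where m0: "\<And>m s t. m \<ge> m0 \<Longrightarrow> 0 \<le> s \<Longrightarrow> s \<le> t \<Longrightarrow> t \<le> b \<Longrightarrow> t - s \<le> 1 / real m \<Longrightarrow> X s - e / 3 < X t"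
    using drops_vanish_on_grid[OF X_drops_vanish[of b] e3] by blast
  have "eventually (\<lambda>m. r m < e / 3) sequentially" using order_tendstoD(2)[OF r(1) e3] .
  moreover have "eventually (\<lambda>m. m \<ge> m0) sequentially" by (rule eventually_ge_at_top)
  moreover have "eventually (\<lambda>m. m > 0) sequentially" by (rule eventually_gt_at_top)
  ultimately show ?thesis
  proof eventually_elim
    case (elim m)
    show ?case
    proof (intro allI impI)
      fix k assume k: "real k / real m \<le> b"
      have drop: "X s - e / 3 \<le> X t" if "0 \<le> s" "s \<le> t" "t \<le> b" "t - s \<le> 1 / real m" for s t
        using m0[OF elim(2) that] by simp
      have cl: "\<bar>(\<Sum>l<j. grid_input J xu xd m l) - X (real j / real m)\<bar> \<le> e / 3" if "real j / real m \<le> b" for j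
        using r(2)[OF elim(3) that] elim(1) by linarith
      have e0: "0 \<le> e / 3" using e by simp
      note L = lindley_close_to_reflected[OF w elim(3) e0 drop cl
          drops_vanish_on_bdd_below[OF X_drops_vanish] k]
      show "\<bar>(\<Sum>l<k. lindley_reg w (grid_input J xu xd m) l) - regulator w X (real k / real m)\<bar> \<le> e \<and>
        \<bar>lindley w (grid_input J xu xd m) k - reflected w X (real k / real m)\<bar> \<le> e"
        using L e by auto
    qed
  qed
qed

lemma grid_lindley_reg_small:
  assumes w: "0 \<le> w" and e: "0 < e"
  shows "eventually (\<lambda>m. \<forall>k<N * m. lindley_reg w (grid_input J xu xd m) k \<le> e) sequentially"
proof -
  obtain m1 where m1: "\<And>m s t. m \<ge> m1 \<Longrightarrow> 0 \<le> s \<Longrightarrow> s \<le> t \<Longrightarrow> t \<le> real N \<Longrightarrow> t - s \<le> 1 / real m \<Longrightarrow> xu s - e < xu t"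
    using drops_vanish_on_grid[OF xu_dv[of "real N"] e] by blast
  obtain m2 where m2: "\<And>m s t. m \<ge> m2 \<Longrightarrow> 0 \<le> s \<Longrightarrow> s \<le> t \<Longrightarrow> t \<le> real N \<Longrightarrow> t - s \<le> 1 / real m \<Longrightarrow> xd s - e < xd t"
    using drops_vanish_on_grid[OF xd_dv[of "real N"] e] by blast
  have "eventually (\<lambda>m. m \<ge> m1) sequentially" "eventually (\<lambda>m. m \<ge> m2) sequentially"
    "eventually (\<lambda>m::nat. m > 0) sequentially" by (rule eventually_ge_at_top eventually_gt_at_top)+
  then show ?thesis
  proof eventually_elim
    case (elim m)
    show ?case
    proof (intro allI impI)
      fix k assume k: "k < N * m"
      have "real (Suc k) \<le> real (N * m)" using k by (simp only: of_nat_le_iff Suc_le_eq)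
      then have tN: "real (Suc k) / real m \<le> real N" using elim(3) by (simp add: field_simps)
      have d: "real (Suc k) / real m - real k / real m \<le> 1 / real m"
          by (simp add: diff_divide_distrib[symmetric])
      have st: "real k / real m \<le> real (Suc k) / real m" by (simp add: divide_right_mono)
      have "- e \<le> grid_input J xu xd m k"
        using m1[OF elim(1) _ st tN d] m2[OF elim(2) _ st tN d] unfolding grid_input_def by auto
      then show "lindley_reg w (grid_input J xu xd m) k \<le> e"
        using lindley_nonneg[OF w, of "grid_input J xu xd m" k] e unfolding lindley_reg_def by auto
    qed
  qed
qed

lemma reflected_X_nonneg: "0 \<le> t \<Longrightarrow> 0 \<le> reflected w X t"
  by (rule reflected_nonneg[OF drops_vanish_on_bdd_below[OF X_drops_vanish]])

lemma reflected_right_cont: "right_cont (reflected w X)"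
  by (rule right_cont_reflected[OF X_right_cont X_drops_vanish])

lemma right_cont_exp_mult:
  assumes "right_cont g"
  shows "right_cont (\<lambda>t. exp (- a * reflected w X t) * g t)"
  using reflected_right_cont[of w] assms unfolding right_cont_def
  by (intro allI impI continuous_mult continuous_exp continuous_const) auto

lemma exp_reflected_bounds:
  assumes "0 \<le> t" "0 \<le> a"
  shows "0 < exp (- a * reflected w X t)" "exp (- a * reflected w X t) \<le> 1"
  using reflected_X_nonneg[OF assms(1), of w] assms(2) by (auto simp: mult_nonneg_nonneg)

lemma lindley_regulator_limit:
  assumes w: "0 \<le> w"
  shows "(\<lambda>m. \<Sum>l<N * m. lindley_reg w (grid_input J xu xd m) l) \<longlonglongrightarrow> regulator w X (real N)"
    and "(\<lambda>m. lindley w (grid_input J xu xd m) (N * m)) \<longlonglongrightarrow> reflected w X (real N)"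
proof -
  have ev: "eventually (\<lambda>m. \<bar>(\<Sum>l<N * m. lindley_reg w (grid_input J xu xd m) l) - regulator w X (real N)\<bar> < e \<and>
      \<bar>lindley w (grid_input J xu xd m) (N * m) - reflected w X (real N)\<bar> < e) sequentially" if e: "0 < e" for e
    using grid_lindley_close[OF w half_gt_zero[OF e], of "real N"] eventually_gt_at_top[of 0]
  proof eventually_elim
    case (elim m)
    have "real (N * m) / real m = real N" using elim(2) by simp
    then show ?case using elim(1)[rule_format, of "N * m"] e by auto
  qed
  show "(\<lambda>m. \<Sum>l<N * m. lindley_reg w (grid_input J xu xd m) l) \<longlonglongrightarrow> regulator w X (real N)"
    by (rule tendstoI, rule eventually_mono[OF ev]) (auto simp: dist_real_def)
  show "(\<lambda>m. lindley w (grid_input J xu xd m) (N * m)) \<longlonglongrightarrow> reflected w X (real N)"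
    by (rule tendstoI, rule eventually_mono[OF ev]) (auto simp: dist_real_def)
qed

text \<open>Each push is uniformly small, so \<open>exp y - 1\<close> differs from \<open>y\<close> by at most \<open>y\<^sup>2\<close>, and the
  squares of the pushes sum up to at most the largest push times the total push.\<close>

lemma lindley_reg_exp_limit:
  assumes w: "0 \<le> w" and a: "0 \<le> a"
  shows "(\<lambda>m. \<Sum>l<N * m. exp (a * lindley_reg w (grid_input J xu xd m) l) - 1) \<longlonglongrightarrow> a * regulator w X (real N)"
proof -
  let ?r = "\<lambda>m l. lindley_reg w (grid_input J xu xd m) l"
  let ?B = "regulator w X (real N) + 1"
  have B: "0 < ?B"
    using regulator_nonneg[OF drops_vanish_on_bdd_below[OF X_drops_vanish], of "real N" w] by simp
  have "(\<lambda>m. \<Sum>l<N * m. exp (a * ?r m l) - 1 - a * ?r m l) \<longlonglongrightarrow> 0"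
  proof (rule tendstoI)
    fix e :: real assume e: "0 < e"
    have cancel: "e / (2 * q) * q = e / 2" if "q \<noteq> 0" for q :: real using that by (simp add: field_simps)
    (* the first bound gives a * d \<le> 1, where exp y \<le> 1 + y + y^2 applies; the second one makes
       d times the total push small *)
    define d where "d = min (1 / (a + 1)) (e / (2 * (a\<^sup>2 * ?B + 1)))"
    have q: "0 < a\<^sup>2 * ?B + 1" using B by (intro add_nonneg_pos mult_nonneg_nonneg) auto
    have d: "0 < d" using a e q by (auto simp: d_def)
    have ad: "a * d \<le> 1"
    proof -
      have "a * d \<le> a * (1 / (a + 1))" using a by (intro mult_left_mono) (auto simp: d_def)
      also have "\<dots> \<le> 1" using a by simp
      finally show ?thesis .
    qed
    have "d * (a\<^sup>2 * ?B) \<le> d * (a\<^sup>2 * ?B + 1)" using d by simp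
    also have "\<dots> \<le> e / (2 * (a\<^sup>2 * ?B + 1)) * (a\<^sup>2 * ?B + 1)"
      using q by (intro mult_right_mono) (auto simp: d_def)
    also have "\<dots> = e / 2" by (rule cancel[OF less_imp_neq[OF q, symmetric]])
    finally have small: "d * (a\<^sup>2 * ?B) \<le> e / 2" .
    have "eventually (\<lambda>m. (\<Sum>l<N * m. ?r m l) < ?B) sequentially"
      by (rule order_tendstoD(2)[OF lindley_regulator_limit(1)[OF w]]) simp
    with grid_lindley_reg_small[OF w d, of N]
    show "eventually (\<lambda>m. dist (\<Sum>l<N * m. exp (a * ?r m l) - 1 - a * ?r m l) 0 < e) sequentially"
    proof eventually_elim
      case (elim m)
      have r0: "0 \<le> ?r m l" for l by (simp add: lindley_reg_def)
      have "0 \<le> (\<Sum>l<N * m. exp (a * ?r m l) - 1 - a * ?r m l)"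
        by (intro sum_nonneg) (use exp_ge_add_one_self in \<open>simp add: algebra_simps\<close>)
      moreover have "(\<Sum>l<N * m. exp (a * ?r m l) - 1 - a * ?r m l) \<le> (\<Sum>l<N * m. (a\<^sup>2 * d) * ?r m l)"
      proof (rule sum_mono)
        fix l assume "l \<in> {..<N * m}"
        then have rl: "?r m l \<le> d" using elim(1) by simp
        have y: "0 \<le> a * ?r m l" "a * ?r m l \<le> 1"
          using a r0 order_trans[OF mult_left_mono[OF rl a] ad] by auto
        have "exp (a * ?r m l) - 1 - a * ?r m l \<le> (a * ?r m l)\<^sup>2" using exp_bound[OF y] by simp
        also have "\<dots> = a\<^sup>2 * (?r m l * ?r m l)" by (simp add: power2_eq_square algebra_simps)
        also have "\<dots> \<le> a\<^sup>2 * (d * ?r m l)" using rl r0 by (intro mult_left_mono mult_right_mono) auto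
        finally show "exp (a * ?r m l) - 1 - a * ?r m l \<le> (a\<^sup>2 * d) * ?r m l" by (simp add: mult.assoc)
      qed
      moreover have "(\<Sum>l<N * m. (a\<^sup>2 * d) * ?r m l) = (a\<^sup>2 * d) * (\<Sum>l<N * m. ?r m l)"
        by (rule sum_distrib_left[symmetric])
      moreover have "(a\<^sup>2 * d) * (\<Sum>l<N * m. ?r m l) \<le> (a\<^sup>2 * d) * ?B"
        using elim(2) d by (intro mult_left_mono) auto
      moreover have "(a\<^sup>2 * d) * ?B = d * (a\<^sup>2 * ?B)" by (simp only: ac_simps)
      ultimately show ?case using small e by (simp add: dist_real_def)
    qed
  qed
  then have "(\<lambda>m. (\<Sum>l<N * m. exp (a * ?r m l) - 1 - a * ?r m l) + a * (\<Sum>l<N * m. ?r m l))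
      \<longlonglongrightarrow> 0 + a * regulator w X (real N)"
    by (intro tendsto_add tendsto_mult tendsto_const lindley_regulator_limit(1)[OF w])
  then show ?thesis by (simp add: sum_subtractf sum_distrib_left)
qed

text \<open>Replacing the recursion by the reflected path changes the sum by at most \<open>N * a\<close> times
  their uniform distance; what remains is a Riemann sum.\<close>

lemma lindley_Riemann_limit:
  assumes w: "0 \<le> w" and a: "0 \<le> a" and g: "right_cont g" "\<And>t. 0 \<le> t \<Longrightarrow> \<bar>g t\<bar> \<le> 1"
  shows "(\<lambda>m. (\<Sum>k<N * m. exp (- a * lindley w (grid_input J xu xd m) k) * g (real k / real m)) / real m)
    \<longlonglongrightarrow> (LBINT s:{0..real N}. exp (- a * reflected w X s) * g s)"
proof -
  let ?f = "\<lambda>s. exp (- a * reflected w X s) * g s"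
  let ?S = "\<lambda>m. (\<Sum>k<N * m. exp (- a * lindley w (grid_input J xu xd m) k) * g (real k / real m)) / real m"
  let ?R = "\<lambda>m. (\<Sum>k<N * m. ?f (real k / real m)) / real m"
  have R: "?R \<longlonglongrightarrow> (LBINT s:{0..real N}. ?f s)"
  proof (rule Riemann_sum_tendsto[OF right_cont_exp_mult[OF g(1)]])
    show "\<bar>?f s\<bar> \<le> 1" if "0 \<le> s" for s
      using exp_reflected_bounds[OF that a, of w] g(2)[OF that] by (simp add: abs_mult mult_le_one)
  qed
  have "(\<lambda>m. ?S m - ?R m) \<longlonglongrightarrow> 0"
  proof (rule tendstoI)
    fix e :: real assume e: "0 < e"
    have cancel: "e / (2 * q) * q = e / 2" if "q \<noteq> 0" for q :: real using that by (simp add: field_simps)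
    (* N * m cells of length 1 / m, each contributing an error of at most a * d / m *)
    define d where "d = e / (2 * (real N * a + 1))"
    have q: "0 < real N * a + 1" using a by (intro add_nonneg_pos) auto
    have d: "0 < d" using e q by (simp add: d_def)
    have "(real N * a) * d \<le> (real N * a + 1) * d" using d by simp
    also have "\<dots> = e / 2" using cancel[OF less_imp_neq[OF q, symmetric]] by (simp only: d_def mult.commute)
    finally have small: "real N * (a * d) \<le> e / 2" by (simp add: mult.assoc)
    show "eventually (\<lambda>m. dist (?S m - ?R m) 0 < e) sequentially"
      using grid_lindley_close[OF w d, of "real N"] eventually_gt_at_top[of 0]
    proof eventually_elim
      case (elim m)
      have cell_diff: "\<bar>exp (- a * lindley w (grid_input J xu xd m) k) * g (real k / real m)
          - ?f (real k / real m)\<bar> \<le> a * d"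
        if "k \<in> {..<N * m}" for k
      proof -
        have "real k \<le> real (N * m)" using that by (simp only: of_nat_le_iff lessThan_iff less_imp_le)
        then have k: "real k / real m \<le> real N" using elim(2) by (simp add: field_simps)
        have "\<bar>exp (- a * lindley w (grid_input J xu xd m) k) - exp (- a * reflected w X (real k / real m))\<bar>
            \<le> a * \<bar>lindley w (grid_input J xu xd m) k - reflected w X (real k / real m)\<bar>"
          by (rule exp_neg_Lipschitz) (use lindley_nonneg[OF w] reflected_X_nonneg a in auto)
        also have "\<dots> \<le> a * d" using elim(1) k a by (intro mult_left_mono) auto
        finally have 1: "\<bar>exp (- a * lindley w (grid_input J xu xd m) k)
            - exp (- a * reflected w X (real k / real m))\<bar> \<le> a * d" .
        have "\<bar>exp (- a * lindley w (grid_input J xu xd m) k) - exp (- a * reflected w X (real k / real m))\<bar>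
            * \<bar>g (real k / real m)\<bar> \<le> (a * d) * 1"
          by (rule mult_mono[OF 1 g(2)]) (use a d in auto)
        then show ?thesis by (simp only: left_diff_distrib[symmetric] abs_mult mult_1_right)
      qed
      have "\<bar>(\<Sum>k<N * m. exp (- a * lindley w (grid_input J xu xd m) k) * g (real k / real m))
          - (\<Sum>k<N * m. ?f (real k / real m))\<bar> \<le> (\<Sum>k<N * m. a * d)"
        unfolding sum_subtractf[symmetric] by (rule order_trans[OF sum_abs sum_mono[OF cell_diff]])
      also have "\<dots> = real m * (real N * (a * d))" by simp
      finally have "\<bar>(\<Sum>k<N * m. exp (- a * lindley w (grid_input J xu xd m) k) * g (real k / real m))
          - (\<Sum>k<N * m. ?f (real k / real m))\<bar> \<le> real m * (real N * (a * d))" .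
      then have "\<bar>?S m - ?R m\<bar> \<le> real N * (a * d)"
        unfolding diff_divide_distrib[symmetric] abs_divide using elim(2)
            by (simp add: pos_divide_le_eq mult.commute)
      then show ?case using small e by (simp add: dist_real_def)
    qed
  qed
  from tendsto_add[OF this R] show ?thesis by simp
qed

text \<open>The exact balance equation of the recursion, solved for the martingale sum, converges
  term by term.\<close>

lemma grid_martingale_limit:
  assumes w: "0 \<le> w" and a: "0 \<le> a"
  shows "(\<lambda>m. \<Sum>k<N * m. exp (- a * lindley w (grid_input J xu xd m) k) * (exp (- a * grid_input J xu xd m k)
      - grid_rate J \<phi> \<eta> m k))
    \<longlonglongrightarrow> exp (- a * reflected w X (real N)) - exp (- a * w) + a * regulator w X (real N)
       - (\<phi> * (LBINT s:{0..real N}. exp (- a * reflected w X s) * (1 - J s))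
          - \<eta> * (LBINT s:{0..real N}. exp (- a * reflected w X s) * J s))"
proof -
  let ?E = "\<lambda>m k. exp (- a * lindley w (grid_input J xu xd m) k)"
  let ?I1 = "LBINT s:{0..real N}. exp (- a * reflected w X s) * (1 - J s)"
  let ?I2 = "LBINT s:{0..real N}. exp (- a * reflected w X s) * J s"
  have J1: "right_cont (\<lambda>s. 1 - J s)"
    using J_right_cont unfolding right_cont_def by (intro allI impI continuous_diff continuous_const) auto
  have l1: "(\<lambda>m. (\<Sum>k<N * m. ?E m k * (1 - J (real k / real m))) / real m) \<longlonglongrightarrow> ?I1"
    by (rule lindley_Riemann_limit[OF w a J1]) (use J_bounds in auto)
  have l2: "(\<lambda>m. (\<Sum>k<N * m. ?E m k * J (real k / real m)) / real m) \<longlonglongrightarrow> ?I2"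
    by (rule lindley_Riemann_limit[OF w a J_right_cont]) (use J_bounds in auto)
  have drift: "(\<lambda>m. \<Sum>k<N * m. ?E m k * (grid_rate J \<phi> \<eta> m k - 1)) \<longlonglongrightarrow> \<phi> * ?I1 + (- \<eta>) * ?I2"
  proof -
    let ?s = "\<lambda>m. real m * (exp (\<phi> / real m) - 1) * ((\<Sum>k<N * m. ?E m k * (1 - J (real k / real m))) / real m)
        + real m * (exp (- \<eta> / real m) - 1) * ((\<Sum>k<N * m. ?E m k * J (real k / real m)) / real m)"
    have "?s \<longlonglongrightarrow> \<phi> * ?I1 + (- \<eta>) * ?I2"
      by (intro tendsto_add tendsto_mult l1 l2 exp_increment_limit)
    moreover have "eventually (\<lambda>m. ?s m = (\<Sum>k<N * m. ?E m k * (grid_rate J \<phi> \<eta> m k - 1))) sequentially"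
      using eventually_gt_at_top[of 0]
    proof eventually_elim
      case (elim m)
      have k: "?E m k * (grid_rate J \<phi> \<eta> m k - 1)
          = (exp (\<phi> / real m) - 1) * (?E m k * (1 - J (real k / real m)))
          + (exp (- \<eta> / real m) - 1) * (?E m k * J (real k / real m))" for k
        using J_01[of "real k / real m"] by (auto simp: grid_rate_def)
      show ?case unfolding k sum.distrib sum_distrib_left[symmetric] using elim by simp
    qed
    ultimately show ?thesis by (rule Lim_transform_eventually)
  qed
  have "(\<lambda>m. exp (- a * lindley w (grid_input J xu xd m) (N * m)) - exp (- a * w)
        + (\<Sum>k<N * m. exp (a * lindley_reg w (grid_input J xu xd m) k) - 1)
        - (\<Sum>k<N * m. ?E m k * (grid_rate J \<phi> \<eta> m k - 1)))
      \<longlonglongrightarrow> exp (- a * reflected w X (real N)) - exp (- a * w) + a * regulator w X (real N)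
          - (\<phi> * ?I1 + (- \<eta>) * ?I2)"
    by (intro tendsto_diff tendsto_add tendsto_exp tendsto_mult tendsto_const lindley_regulator_limit(2)[OF w]
        lindley_reg_exp_limit[OF w a] drift)
  moreover have "(\<Sum>k<N * m. ?E m k * (exp (- a * grid_input J xu xd m k) - grid_rate J \<phi> \<eta> m k)) =
      exp (- a * lindley w (grid_input J xu xd m) (N * m)) - exp (- a * w)
        + (\<Sum>k<N * m. exp (a * lindley_reg w (grid_input J xu xd m) k) - 1)
        - (\<Sum>k<N * m. ?E m k * (grid_rate J \<phi> \<eta> m k - 1))" for m
  proof -
    have "(\<Sum>k<N * m. ?E m k * (exp (- a * grid_input J xu xd m k) - grid_rate J \<phi> \<eta> m k)) =
      (\<Sum>k<N * m. ?E m k * (exp (- a * grid_input J xu xd m k) - 1))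
          - (\<Sum>k<N * m. ?E m k * (grid_rate J \<phi> \<eta> m k - 1))"
      unfolding sum_subtractf[symmetric] by (rule sum.cong) (auto simp: algebra_simps)
    then show ?thesis using lindley_exp_identity[of a w "grid_input J xu xd m" "N * m"] by linarith
  qed
  ultimately show ?thesis by simp
qed

end

section \<open>From switching times to switched paths\<close>

locale switching_times =
  fixes S T :: "nat \<Rightarrow> ennreal"
  assumes T0: "T 0 = 0"
    and order: "\<And>n. n \<ge> 1 \<Longrightarrow> T (n - 1) \<le> S n \<and> S n \<le> T n \<and> T (n - 1) < T n \<and> T n < \<infinity>"
    and unbounded: "T \<longlonglongrightarrow> \<infinity>"
begin

definition switch :: "nat \<Rightarrow> ennreal" where
  "switch i = (if even i then T (i div 2) else S (Suc (i div 2)))"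

lemma switch_even: "switch (2 * n) = T n" and switch_odd: "switch (Suc (2 * n)) = S (Suc n)"
  by (simp_all add: switch_def)

lemma T_less: "T n < T (Suc n)" and T_le_S: "T n \<le> S (Suc n)" and S_le_T: "S (Suc n) \<le> T (Suc n)"
  using order[of "Suc n"] by auto

lemma T_strict_mono: "strict_mono T"
  using T_less by (simp add: strict_mono_Suc_iff)

lemma T_finite: "T n < \<infinity>"
  using order[of n] T0 by (cases n) auto

lemma S_finite: "S (Suc n) < \<infinity>"
  using order[of "Suc n"] by (auto intro: le_less_trans)

lemma switch_finite: "switch i < \<infinity>"
  using T_finite S_finite by (simp add: switch_def)

lemma switch_step: "switch i \<le> switch (Suc i)"
proof (cases "even i")
  case True
  then obtain n where "i = 2 * n" by (elim evenE)
  then show ?thesis using T_le_S by (simp add: switch_def)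
next
  case False
  then obtain n where "i = Suc (2 * n)" by (metis oddE Suc_eq_plus1)
  then show ?thesis using S_le_T by (simp add: switch_def)
qed

lemma num_cycles_eq:
  assumes "T n \<le> ennreal t" "ennreal t < T (Suc n)"
  shows "num_cycles T t = n"
proof -
  have "k \<le> n" if "T k \<le> ennreal t" for k
  proof (rule ccontr)
    assume "\<not> k \<le> n"
    then have "T (Suc n) \<le> T k" using T_strict_mono by (simp add: strict_mono_less_eq)
    then show False using that assms(2) by (meson leD order_trans)
  qed
  then show ?thesis unfolding num_cycles_def using assms(1) by (intro cSup_eq_maximum) auto
qed

definition switch_time :: "nat \<Rightarrow> real" where "switch_time i = enn2real (switch i)"

lemma ennreal_switch_time: "ennreal (switch_time i) = switch i"
  unfolding switch_time_def using switch_finite[of i] by simp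

lemma switch_time_nonneg: "0 \<le> switch_time i"
  by (simp add: switch_time_def)

lemma switch_time_le: "0 \<le> s \<Longrightarrow> switch_time i \<le> s \<longleftrightarrow> switch i \<le> ennreal s"
  and switch_time_gt: "0 \<le> s \<Longrightarrow> s < switch_time i \<longleftrightarrow> ennreal s < switch i"
  unfolding ennreal_switch_time[symmetric] by (simp_all add: ennreal_less_iff)

lemma switch_time_0: "switch_time 0 = 0"
  by (simp add: switch_time_def switch_def T0)

lemma switch_time_step: "switch_time i \<le> switch_time (Suc i)"
  using switch_step[of i] switch_time_le[OF switch_time_nonneg, of i "Suc i"] ennreal_switch_time by simp

lemma switch_time_unbounded: "\<exists>i. b < switch_time i"
proof -
  have "eventually (\<lambda>n. ennreal (max b 0) < T n) sequentially"
    by (rule order_tendstoD(1)[OF unbounded]) simp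
  then obtain n where "ennreal (max b 0) < T n" by (auto simp: eventually_sequentially)
  then have "max b 0 < switch_time (2 * n)" by (subst switch_time_gt) (simp_all add: switch_even)
  then show ?thesis by (intro exI[of _ "2 * n"]) simp
qed

lemma down_ind_cell:
  assumes "switch_time i \<le> s" "s < switch_time (Suc i)"
  shows "down_ind S T s = of_bool (even i)"
proof -
  have s: "0 \<le> s" using assms(1) switch_time_nonneg[of i] by linarith
  have a: "switch i \<le> ennreal s" "ennreal s < switch (Suc i)"
    using assms s by (simp_all add: switch_time_le switch_time_gt)
  show ?thesis
  proof (cases "even i")
    case True
    then obtain n where n: "i = 2 * n" by (elim evenE)
    have b: "T n \<le> ennreal s" "ennreal s < S (Suc n)" using a unfolding n switch_even switch_odd .
    have "num_cycles T s = n" by (rule num_cycles_eq[OF b(1) less_le_trans[OF b(2) S_le_T]])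
    then show ?thesis using b True by (simp add: down_ind_def)
  next
    case False
    then obtain n where n: "i = Suc (2 * n)" by (metis oddE Suc_eq_plus1)
    have e: "Suc i = 2 * Suc n" using n by simp
    have b: "S (Suc n) \<le> ennreal s" "ennreal s < T (Suc n)" using a unfolding e switch_even
        by (simp_all add: n switch_odd)
    have "num_cycles T s = n" by (rule num_cycles_eq[OF order_trans[OF T_le_S b(1)] b(2)])
    then show ?thesis using b False by (simp add: down_ind_def not_less)
  qed
qed

lemma time_cell: assumes "0 \<le> s" obtains i where "switch_time i \<le> s" "s < switch_time (Suc i)"
  by (rule unbounded_sequence_cell[of switch_time s]) (use assms switch_time_0 switch_time_unbounded in auto)

text \<open>The definition of \<open>down_ind\<close> passes through the random index \<open>num_cycles\<close>. This form
  uses only events that are observable at time \<open>s\<close> when the switching times are stopping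
  times.\<close>

lemma down_ind_adapted_form:
  assumes s: "0 \<le> s"
  shows "down_ind S T s = of_bool (\<exists>n. T n \<le> ennreal s \<and> \<not> S (Suc n) \<le> ennreal s)"
proof -
  obtain i where i: "switch_time i \<le> s" "s < switch_time (Suc i)" using time_cell[OF s] .
  have a: "switch i \<le> ennreal s" "ennreal s < switch (Suc i)"
    using i s by (simp_all add: switch_time_le switch_time_gt)
  show ?thesis
  proof (cases "even i")
    case True
    then obtain n where n: "i = 2 * n" by (elim evenE)
    have "T n \<le> ennreal s" "ennreal s < S (Suc n)" using a unfolding n switch_even switch_odd .
    then show ?thesis using down_ind_cell[OF i] True by (auto simp: not_le)
  next
    case False
    then obtain n where n: "i = Suc (2 * n)" by (metis oddE Suc_eq_plus1)
    have e: "Suc i = 2 * Suc n" using n by simp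
    have b: "S (Suc n) \<le> ennreal s" "ennreal s < T (Suc n)" using a unfolding e switch_even
        by (simp_all add: n switch_odd)
    have "S (Suc k) \<le> ennreal s" if "T k \<le> ennreal s" for k
    proof -
      have "T k < T (Suc n)" using that b(2) by (rule le_less_trans)
      then have "k \<le> n" using T_strict_mono by (simp add: strict_mono_less)
      show ?thesis
      proof (cases "k = n")
        case True then show ?thesis using b by simp
      next
        case False
        then have "T (Suc k) \<le> T n" using \<open>k \<le> n\<close> T_strict_mono by (simp add: strict_mono_less_eq)
        then show ?thesis using S_le_T[of k] T_le_S[of n] b(1) by (meson order_trans)
      qed
    qed
    then show ?thesis using down_ind_cell[OF i] False by auto
  qed
qed

lemma left_lim_down_ind:
  assumes "switch_time i < s" "s \<le> switch_time (Suc i)"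
  shows "left_lim (down_ind S T) s = of_bool (even i)"
proof -
  have "eventually (\<lambda>r. down_ind S T r = of_bool (even i)) (at_left s)"
    unfolding eventually_at_left_field using assms down_ind_cell[of i]
    by (intro exI[of _ "switch_time i"]) auto
  then have "(down_ind S T \<longlongrightarrow> of_bool (even i)) (at_left s)"
    by (rule tendsto_eventually)
  then show ?thesis unfolding left_lim_def by (intro tendsto_Lim) auto
qed

text \<open>With \<open>h\<close> the identity this is the integral of the down input, with \<open>h x = 1 - x\<close> that of
  the up input.\<close>

lemma step_integral_switched:
  fixes h :: "real \<Rightarrow> real"
  assumes t: "0 \<le> t" "t \<le> switch_time K"
  shows "step_integral (\<lambda>s. h (left_lim (down_ind S T) s)) g 0 t =
    (\<Sum>i<K. h (of_bool (even i)) * (g (min (switch_time (Suc i)) t) - g (min (switch_time i) t)))"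
proof (rule step_integral_eqI)
  let ?H = "\<lambda>s. h (left_lim (down_ind S T) s)"
  let ?q = "\<lambda>i. min (switch_time i) t"
  have H: "?H s = h (of_bool (even i))" if "s \<in> {?q i<..?q (Suc i)}" for i s
    using left_lim_down_ind[of i s] that by (auto simp: min_def split: if_splits)
  show "has_step_integral ?H g 0 t
    (\<Sum>i<K. h (of_bool (even i)) * (g (?q (Suc i)) - g (?q i)))"
    unfolding has_step_integral_def
  proof (intro exI[of _ K] exI[of _ ?q] conjI allI impI)
    show "?q 0 = 0" "?q K = t" using t switch_time_0 by auto
    fix i assume "i < K"
    show le: "?q i \<le> ?q (Suc i)" using switch_time_step[of i] by (auto simp: min_def)
    show "\<forall>s\<in>{?q i<..?q (Suc i)}. ?H s = ?H (?q (Suc i))"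
    proof
      fix s assume s: "s \<in> {?q i<..?q (Suc i)}"
      then have "?q (Suc i) \<in> {?q i<..?q (Suc i)}" by auto
      then show "?H s = ?H (?q (Suc i))" using H[OF s] H by metis
    qed
  next
    show "(\<Sum>i<K. h (of_bool (even i)) * (g (?q (Suc i)) - g (?q i))) =
        (\<Sum>i<K. ?H (?q (Suc i)) * (g (?q (Suc i)) - g (?q i)))"
    proof (rule sum.cong[OF refl])
      fix i
      have "?q i \<le> ?q (Suc i)" using switch_time_step[of i] by (auto simp: min_def)
      then consider "?q i = ?q (Suc i)" | "?q (Suc i) \<in> {?q i<..?q (Suc i)}" by fastforce
      then show "h (of_bool (even i)) * (g (?q (Suc i)) - g (?q i))
          = ?H (?q (Suc i)) * (g (?q (Suc i)) - g (?q i))"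
      proof cases
        case 2 then show ?thesis using H by metis
      qed simp
    qed
  qed
qed

lemma net_input_switched_path:
  assumes "right_cont xu" "right_cont xd" "\<And>b. drops_vanish_on xu b" "\<And>b. drops_vanish_on xd b"
  shows "switched_path switch_time (down_ind S T) xu xd (net_input S T xu xd)"
proof
  fix t K assume t: "0 \<le> t" "t \<le> switch_time K"
  show "net_input S T xu xd t = (\<Sum>i<K. (if even i then xd else xu) (min (switch_time (Suc i)) t)
      - (if even i then xd else xu) (min (switch_time i) t))"
    unfolding net_input_def step_integral_switched[OF t, of "\<lambda>x. 1 - x"] step_integral_switched[OF t, of
        "\<lambda>x. x"]
      sum.distrib[symmetric]
    by (rule sum.cong) auto
qed (use assms switch_time_0 switch_time_step switch_time_unbounded down_ind_cell in auto)

end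

section \<open>Independence and sums of martingale differences\<close>

lemma (in prob_space) indep_var_of_indep_set:
  fixes Y :: "'a \<Rightarrow> real"
  assumes sub: "subalgebra M G" and ind: "indep_set (sets G) (sets (vimage_algebra (space M) Y borel))"
    and A: "A \<in> borel_measurable G" and Y: "Y \<in> borel_measurable M" and g: "g \<in> borel_measurable borel"
  shows "indep_var borel A borel (\<lambda>\<omega>. g (Y \<omega>) :: real)"
  unfolding indep_var_eq
proof (intro conjI)
  show "random_variable borel A" using measurable_from_subalg[OF sub A] .
  show "random_variable borel (\<lambda>\<omega>. g (Y \<omega>))" using Y g by measurable
  have spG: "space G = space M" using sub by (simp add: subalgebra_def)
  have 1: "sigma_sets (space M) {A -` B \<inter> space M |B. B \<in> sets borel} \<subseteq> sets G"
    unfolding spG[symmetric] by (rule sets.sigma_sets_subset) (use A in \<open>auto simp: measurable_sets\<close>)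
  have 2: "sigma_sets (space M) {(\<lambda>\<omega>. g (Y \<omega>)) -` B \<inter> space M |B. B \<in> sets borel} \<subseteq> sets
      (vimage_algebra (space M) Y borel)"
  proof -
    have "{(\<lambda>\<omega>. g (Y \<omega>)) -` B \<inter> space M |B. B \<in> sets borel} \<subseteq> sets (vimage_algebra (space M) Y borel)"
    proof safe
      fix B :: "real set" assume "B \<in> sets borel"
      then have "g -` B \<in> sets borel" using measurable_sets[OF g] by simp
      then have "Y -` (g -` B) \<inter> space M \<in> sets (vimage_algebra (space M) Y borel)" by (rule in_vimage_algebra)
      then show "(\<lambda>\<omega>. g (Y \<omega>)) -` B \<inter> space M \<in> sets (vimage_algebra (space M) Y borel)"
        by (simp add: vimage_def)
    qed
    from sets.sigma_sets_subset[OF this] show ?thesis by simp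
  qed
  show "indep_set (sigma_sets (space M) {A -` B \<inter> space M |B. B \<in> sets borel})
     (sigma_sets (space M) {(\<lambda>\<omega>. g (Y \<omega>)) -` B \<inter> space M |B. B \<in> sets borel})"
    using ind unfolding indep_set_def
    by (rule indep_sets_mono_sets) (use 1 2 in \<open>auto split: bool.split\<close>)
qed

lemma (in prob_space) indep_var_nn_integral_mult:
  fixes A B :: "'a \<Rightarrow> real"
  assumes "indep_var borel A borel B" "\<And>\<omega>. 0 \<le> A \<omega>" "\<And>\<omega>. 0 \<le> B \<omega>"
  shows "(\<integral>\<^sup>+\<omega>. ennreal (A \<omega> * B \<omega>) \<partial>M) = (\<integral>\<^sup>+\<omega>. ennreal (A \<omega>) \<partial>M) * (\<integral>\<^sup>+\<omega>. ennreal (B \<omega>) \<partial>M)"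
proof -
  have ind: "indep_var borel (\<lambda>\<omega>. ennreal (A \<omega>)) borel (\<lambda>\<omega>. ennreal (B \<omega>))"
    using indep_var_compose[OF assms(1), of ennreal borel ennreal borel] by (simp add: comp_def)
  have *: "(\<lambda> _. borel) = case_bool borel borel"
    by (rule ext, metis (full_types) bool.simps(3) bool.simps(4))
  have "(\<integral>\<^sup>+\<omega>. (\<Prod>i\<in>UNIV. case_bool (\<lambda>\<omega>. ennreal (A \<omega>)) (\<lambda>\<omega>. ennreal (B \<omega>)) i \<omega>) \<partial>M) =
     (\<Prod>i\<in>UNIV. \<integral>\<^sup>+\<omega>. case_bool (\<lambda>\<omega>. ennreal (A \<omega>)) (\<lambda>\<omega>. ennreal (B \<omega>)) i \<omega> \<partial>M)"
    by (rule indep_vars_nn_integral) (use ind in \<open>auto simp: indep_var_def *\<close>)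
  then show ?thesis using assms(2,3) by (simp add: UNIV_bool ennreal_mult mult.commute)
qed

text \<open>Two sources of noise, of which at most one is active in each step, as selected by
  predictable weights. Cross terms vanish because each increment is centred and independent of
  the past, so the second moments of the steps add up.\<close>

lemma (in prob_space) martingale_sum_second_moment:
  fixes a b u v :: "nat \<Rightarrow> 'a \<Rightarrow> real"
  assumes sub: "\<And>k. subalgebra M (G k)" and mono: "\<And>k. sets (G k) \<subseteq> sets (G (Suc k))"
    and a: "\<And>k. a k \<in> borel_measurable (G k)" "\<And>k \<omega>. \<bar>a k \<omega>\<bar> \<le> 1"
    and b: "\<And>k. b k \<in> borel_measurable (G k)" "\<And>k \<omega>. \<bar>b k \<omega>\<bar> \<le> 1"
    and ab: "\<And>k \<omega>. a k \<omega> * b k \<omega> = 0"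
    and u: "\<And>k. u k \<in> borel_measurable (G (Suc k))"
        "\<And>k A. A \<in> borel_measurable (G k) \<Longrightarrow> indep_var borel A borel (u k)"
      "\<And>k. integrable M (\<lambda>\<omega>. (u k \<omega>)\<^sup>2)" "\<And>k. expectation (u k) = 0" "\<And>k. expectation (\<lambda>\<omega>. (u k \<omega>)\<^sup>2) \<le> cu"
    and v: "\<And>k. v k \<in> borel_measurable (G (Suc k))"
        "\<And>k A. A \<in> borel_measurable (G k) \<Longrightarrow> indep_var borel A borel (v k)"
      "\<And>k. integrable M (\<lambda>\<omega>. (v k \<omega>)\<^sup>2)" "\<And>k. expectation (v k) = 0" "\<And>k. expectation (\<lambda>\<omega>. (v k \<omega>)\<^sup>2) \<le> cv"
  shows "integrable M (\<lambda>\<omega>. (\<Sum>k<n. a k \<omega> * u k \<omega> + b k \<omega> * v k \<omega>)\<^sup>2) \<and>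
    expectation (\<lambda>\<omega>. (\<Sum>k<n. a k \<omega> * u k \<omega> + b k \<omega> * v k \<omega>)\<^sup>2) \<le> real n * (cu + cv)"
proof -
  let ?D = "\<lambda>n \<omega>. \<Sum>k<n. a k \<omega> * u k \<omega> + b k \<omega> * v k \<omega>"
  have up: "f \<in> borel_measurable (G (Suc k))" if "f \<in> borel_measurable (G k)" for f :: "'a \<Rightarrow> real" and k
    by (rule measurable_from_subalg[OF _ that]) (use sub[of k] sub[of
        "Suc k"] mono[of k] in \<open>auto simp: subalgebra_def\<close>)
  have D: "?D n \<in> borel_measurable (G n)" for n
  proof (induction n)
    case (Suc n)
    have "(\<lambda>\<omega>. ?D n \<omega> + (a n \<omega> * u n \<omega> + b n \<omega> * v n \<omega>)) \<in> borel_measurable (G (Suc n))"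
      using up[OF Suc] up[OF a(1)] up[OF b(1)] u(1) v(1) by measurable
    then show ?case by simp
  qed simp
  have M[measurable]: "?D n \<in> borel_measurable M" "a n \<in> borel_measurable M" "b n \<in> borel_measurable M"
     "u n \<in> borel_measurable M" "v n \<in> borel_measurable M" for n
    using measurable_from_subalg[OF sub D] measurable_from_subalg[OF sub a(1)]
        measurable_from_subalg[OF sub b(1)]
      measurable_from_subalg[OF sub u(1)] measurable_from_subalg[OF sub v(1)] by blast+
  have sq1: "x\<^sup>2 \<le> 1" if "\<bar>x\<bar> \<le> 1" for x :: real using that by (simp add: abs_square_le_1)
  have damp: "integrable M (\<lambda>\<omega>. (c \<omega>)\<^sup>2 * (y \<omega>)\<^sup>2)"
      "expectation (\<lambda>\<omega>. (c \<omega>)\<^sup>2 * (y \<omega>)\<^sup>2) \<le> expectation (\<lambda>\<omega>. (y \<omega>)\<^sup>2)"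
    if "c \<in> borel_measurable M" "\<And>\<omega>. \<bar>c \<omega>\<bar> \<le> 1" "y \<in> borel_measurable M" "integrable M (\<lambda>\<omega>. (y \<omega>)\<^sup>2)"
        for c y :: "'a \<Rightarrow> real"
  proof -
    have le: "(c \<omega>)\<^sup>2 * (y \<omega>)\<^sup>2 \<le> (y \<omega>)\<^sup>2" for \<omega>
      using mult_right_mono[OF sq1[OF that(2)], of "(y \<omega>)\<^sup>2"] by simp
    show 1: "integrable M (\<lambda>\<omega>. (c \<omega>)\<^sup>2 * (y \<omega>)\<^sup>2)"
      by (rule Bochner_Integration.integrable_bound[OF that(4)]) (use that(1,3) le in \<open>auto simp: abs_mult\<close>)
    show "expectation (\<lambda>\<omega>. (c \<omega>)\<^sup>2 * (y \<omega>)\<^sup>2) \<le> expectation (\<lambda>\<omega>. (y \<omega>)\<^sup>2)"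
      by (rule integral_mono[OF 1 that(4) le])
  qed
  have cross: "integrable M (\<lambda>\<omega>. (y \<omega> * c \<omega>) * z \<omega>)" "expectation (\<lambda>\<omega>. (y \<omega> * c \<omega>) * z \<omega>) = 0"
    if y: "y \<in> borel_measurable (G n)" "integrable M (\<lambda>\<omega>. (y \<omega>)\<^sup>2)" and c: "c \<in> borel_measurable (G n)"
        "\<And>\<omega>. \<bar>c \<omega>\<bar> \<le> 1"
      and z: "z \<in> borel_measurable M" "indep_var borel (\<lambda>\<omega>. y \<omega> * c \<omega>) borel z" "integrable M (\<lambda>\<omega>. (z \<omega>)\<^sup>2)"
          "expectation z = 0"
    for n and y c z :: "'a \<Rightarrow> real"
  proof -
    have ym: "y \<in> borel_measurable M" "c \<in> borel_measurable M"
      using measurable_from_subalg[OF sub y(1)] measurable_from_subalg[OF sub c(1)] by auto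
    have yi: "integrable M y" by (rule square_integrable_imp_integrable[OF ym(1) y(2)])
    have zi: "integrable M z" by (rule square_integrable_imp_integrable[OF z(1) z(3)])
    have yc: "integrable M (\<lambda>\<omega>. y \<omega> * c \<omega>)"
      by (rule Bochner_Integration.integrable_bound[OF yi]) (use ym c(2) in \<open>auto simp: abs_mult mult_left_le\<close>)
    show "integrable M (\<lambda>\<omega>. (y \<omega> * c \<omega>) * z \<omega>)" by (rule indep_var_integrable[OF z(2) yc zi])
    show "expectation (\<lambda>\<omega>. (y \<omega> * c \<omega>) * z \<omega>) = 0"
      using indep_var_lebesgue_integral[OF z(2) yc zi] z(4) by simp
  qed
  show ?thesis
  proof (induction n)
    case (Suc n)
    let ?y = "?D n"
    have yi: "integrable M (\<lambda>\<omega>. (?y \<omega>)\<^sup>2)" and ye: "expectation (\<lambda>\<omega>. (?y \<omega>)\<^sup>2) \<le> real n * (cu + cv)"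
      using Suc by auto
    have iu: "indep_var borel (\<lambda>\<omega>. ?y \<omega> * a n \<omega>) borel (u n)" and iv:
        "indep_var borel (\<lambda>\<omega>. ?y \<omega> * b n \<omega>) borel (v n)"
      using borel_measurable_times[OF D a(1)] borel_measurable_times[OF D b(1)] u(2) v(2) by blast+
    note cu = cross[OF D yi a(1,2) M(4) iu u(3,4)] and cv = cross[OF D yi b(1,2) M(5) iv v(3,4)]
    note du = damp[OF M(2) a(2) M(4) u(3), of n n] and dv = damp[OF M(3) b(2) M(5) v(3), of n n]
    have eq: "(?D (Suc n) \<omega>)\<^sup>2 = (?y \<omega>)\<^sup>2 + 2 * ((?y \<omega> * a n \<omega>) * u n \<omega>) + 2 * ((?y \<omega> * b n \<omega>) * v n \<omega>)
        + (a n \<omega>)\<^sup>2 * (u n \<omega>)\<^sup>2 + (b n \<omega>)\<^sup>2 * (v n \<omega>)\<^sup>2" for \<omega>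
    proof -
      have exp: "(y + (p + q))\<^sup>2 = y\<^sup>2 + 2 * (y * p) + 2 * (y * q) + p\<^sup>2 + q\<^sup>2 + 2 * (p * q)" for y p q :: real
        by (simp add: power2_eq_square algebra_simps)
      have "(a n \<omega> * u n \<omega>) * (b n \<omega> * v n \<omega>) = (a n \<omega> * b n \<omega>) * (u n \<omega> * v n \<omega>)" by (simp only: ac_simps)
      then have "(a n \<omega> * u n \<omega>) * (b n \<omega> * v n \<omega>) = 0" using ab[of n \<omega>] by simp
      then show ?thesis using exp[of "?y \<omega>" "a n \<omega> * u n \<omega>" "b n \<omega> * v n \<omega>"]
        by (simp add: power_mult_distrib mult.assoc)
    qed
    have int: "integrable M (\<lambda>\<omega>. (?D (Suc n) \<omega>)\<^sup>2)" unfolding eq using yi cu(1) cv(1) du(1) dv(1) by simp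
    have "expectation (\<lambda>\<omega>. (?D (Suc n) \<omega>)\<^sup>2) = expectation (\<lambda>\<omega>. (?y \<omega>)\<^sup>2)
        + 2 * expectation (\<lambda>\<omega>. (?y \<omega> * a n \<omega>) * u n \<omega>) + 2 * expectation (\<lambda>\<omega>. (?y \<omega> * b n \<omega>) * v n \<omega>)
        + expectation (\<lambda>\<omega>. (a n \<omega>)\<^sup>2 * (u n \<omega>)\<^sup>2) + expectation (\<lambda>\<omega>. (b n \<omega>)\<^sup>2 * (v n \<omega>)\<^sup>2)"
      unfolding eq using yi cu(1) cv(1) du(1) dv(1) by simp
    also have "\<dots> \<le> real n * (cu + cv) + cu + cv"
      unfolding cu(2) cv(2) using ye order_trans[OF du(2) u(5)] order_trans[OF dv(2) v(5)] by linarith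
    finally have "expectation (\<lambda>\<omega>. (?D (Suc n) \<omega>)\<^sup>2) \<le> real (Suc n) * (cu + cv)" by (simp add: algebra_simps)
    with int show ?case by blast
  qed simp
qed

section \<open>Laplace transforms of Levy increments\<close>

text \<open>Applied to the two coordinate projections this yields the up and the down input as Levy
  processes for the common filtration.\<close>

lemma levy_process_compose_linear:
  fixes X :: "real \<Rightarrow> 'a \<Rightarrow> 'b::euclidean_space" and h :: "'b \<Rightarrow> 'c::euclidean_space"
  assumes X: "levy_process M F X" and M: "prob_space M" and sub: "\<And>t. 0 \<le> t \<Longrightarrow> subalgebra M (F t)"
    and h: "bounded_linear h"
  shows "levy_process M F (\<lambda>t \<omega>. h (X t \<omega>))"
proof -
  interpret prob_space M by fact
  interpret h: bounded_linear h by fact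
  have hc: "continuous_on UNIV h" by (simp add: h.continuous_on)
  have hm[measurable]: "h \<in> borel_measurable borel" by (rule borel_measurable_continuous_onI[OF hc])
  have hic: "isCont h x" for x by (rule linear_continuous_at[OF h])
  have Xm: "X t \<in> borel_measurable M" if "0 \<le> t" for t
    using X that measurable_from_subalg[OF sub[OF that]] unfolding levy_process_def by blast
  show ?thesis unfolding levy_process_def
  proof (intro conjI allI impI)
    fix t :: real assume "t \<ge> 0"
    then have "X t \<in> borel_measurable (F t)" using X unfolding levy_process_def by blast
    then show "(\<lambda>\<omega>. h (X t \<omega>)) \<in> borel_measurable (F t)" by measurable
  next
    show "AE \<omega> in M. h (X 0 \<omega>) = 0" using X unfolding levy_process_def by (auto simp: h.zero)
  next
    have "AE \<omega> in M. cadlag (\<lambda>t. X t \<omega>)" using X unfolding levy_process_def by blast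
    then show "AE \<omega> in M. cadlag (\<lambda>t. h (X t \<omega>))"
    proof eventually_elim
      case (elim \<omega>)
      show ?case unfolding cadlag_def
      proof (intro conjI allI impI)
        fix t :: real assume "t \<ge> 0"
        then have "continuous (at_right t) (\<lambda>t. X t \<omega>)" using elim unfolding cadlag_def by blast
        then show "continuous (at_right t) (\<lambda>t. h (X t \<omega>))"
          unfolding continuous_within by (rule h.tendsto)
      next
        fix t :: real assume "t > 0"
        then obtain l where "((\<lambda>t. X t \<omega>) \<longlongrightarrow> l) (at_left t)" using elim unfolding cadlag_def by blast
        then show "\<exists>l. ((\<lambda>t. h (X t \<omega>)) \<longlongrightarrow> l) (at_left t)" by (intro exI[of _ "h l"] h.tendsto)
      qed
    qed
  next
    fix s t :: real assume st: "s \<ge> 0" "t \<ge> s"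
    let ?Z = "\<lambda>\<omega>. X t \<omega> - X s \<omega>"
    have Zm: "?Z \<in> borel_measurable M" using Xm st by simp
    have ind: "indep_set (sets (F s)) (sets (vimage_algebra (space M) ?Z borel))"
      and dis: "distr M borel ?Z = distr M borel (X (t - s))"
      using X st unfolding levy_process_def by blast+
    have hZ: "(\<lambda>\<omega>. h (X t \<omega>) - h (X s \<omega>)) = (\<lambda>\<omega>. h (?Z \<omega>))" by (simp add: h.diff)
    have "sets (vimage_algebra (space M) (\<lambda>\<omega>. h (?Z \<omega>)) borel) \<subseteq> sets (vimage_algebra (space M) ?Z borel)"
    proof -
      have "?Z \<in> measurable (vimage_algebra (space M) ?Z borel) borel" by (rule measurable_vimage_algebra1) simp
      then have "(\<lambda>\<omega>. h (?Z \<omega>)) \<in> measurable (vimage_algebra (space M) ?Z borel) borel" by measurable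
      then show ?thesis using sets_vimage_algebra_space measurable_iff_sets
          by (metis (no_types, lifting) space_vimage_algebra)
    qed
    then show "indep_set (sets (F s)) (sets (vimage_algebra (space M) (\<lambda>\<omega>. h (X t \<omega>) - h (X s \<omega>)) borel))"
      unfolding hZ using ind unfolding indep_set_def
      by (elim indep_sets_mono_sets) (auto split: bool.split)
    have "distr M borel (\<lambda>\<omega>. h (?Z \<omega>)) = distr (distr M borel ?Z) borel h"
      using Zm by (subst distr_distr) (auto simp: comp_def)
    also have "\<dots> = distr M borel (\<lambda>\<omega>. h (X (t - s) \<omega>))"
      unfolding dis using Xm[of "t - s"] st by (subst distr_distr) (auto simp: comp_def)
    finally show "distr M borel (\<lambda>\<omega>. h (X t \<omega>) - h (X s \<omega>)) = distr M borel (\<lambda>\<omega>. h (X (t - s) \<omega>))"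
      unfolding hZ .
  qed
qed

locale real_levy = prob_space M for M :: "'a measure" +
  fixes F :: "real \<Rightarrow> 'a measure" and Y :: "real \<Rightarrow> 'a \<Rightarrow> real"
  assumes sub: "0 \<le> t \<Longrightarrow> subalgebra M (F t)" and levy: "levy_process M F Y"
begin

lemma Y_adapted: "0 \<le> t \<Longrightarrow> Y t \<in> borel_measurable (F t)"
  using levy unfolding levy_process_def by blast

lemma Y_measurable: "0 \<le> t \<Longrightarrow> Y t \<in> borel_measurable M"
  using measurable_from_subalg[OF sub Y_adapted] .

lemma increment_indep_var:
  fixes g :: "real \<Rightarrow> real"
  assumes "0 \<le> s" "s \<le> t" "A \<in> borel_measurable (F s)" "g \<in> borel_measurable borel"
  shows "indep_var borel A borel (\<lambda>\<omega>. g (Y t \<omega> - Y s \<omega>))"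
proof (rule indep_var_of_indep_set[OF sub[OF assms(1)] _ assms(3) _ assms(4)])
  show "indep_set (sets (F s)) (sets (vimage_algebra (space M) (\<lambda>\<omega>. Y t \<omega> - Y s \<omega>) borel))"
    using levy assms(1,2) unfolding levy_process_def by blast
  show "random_variable borel (\<lambda>\<omega>. Y t \<omega> - Y s \<omega>)"
    using Y_measurable[of s] Y_measurable[of t] assms(1,2) by simp
qed

lemma increment_distr:
  "0 \<le> s \<Longrightarrow> s \<le> t \<Longrightarrow> distr M borel (\<lambda>\<omega>. Y t \<omega> - Y s \<omega>) = distr M borel (Y (t - s))"
  using levy unfolding levy_process_def by blast

lemma increment_integral:
  fixes g :: "real \<Rightarrow> real"
  assumes "0 \<le> s" "s \<le> t" "g \<in> borel_measurable borel"
  shows "expectation (\<lambda>\<omega>. g (Y t \<omega> - Y s \<omega>)) = expectation (\<lambda>\<omega>. g (Y (t - s) \<omega>))"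
    and "integrable M (\<lambda>\<omega>. g (Y t \<omega> - Y s \<omega>)) \<longleftrightarrow> integrable M (\<lambda>\<omega>. g (Y (t - s) \<omega>))"
proof -
  have m: "(\<lambda>\<omega>. Y t \<omega> - Y s \<omega>) \<in> borel_measurable M" "Y (t - s) \<in> borel_measurable M"
    using Y_measurable assms(1,2) by auto
  show "expectation (\<lambda>\<omega>. g (Y t \<omega> - Y s \<omega>)) = expectation (\<lambda>\<omega>. g (Y (t - s) \<omega>))"
    using integral_distr[OF m(1) assms(3)] integral_distr[OF m(2) assms(3)] increment_distr[OF assms(1,2)]
        by simp
  show "integrable M (\<lambda>\<omega>. g (Y t \<omega> - Y s \<omega>)) \<longleftrightarrow> integrable M (\<lambda>\<omega>. g (Y (t - s) \<omega>))"
    using integrable_distr_eq[OF m(1) assms(3)] integrable_distr_eq[OF m(2) assms(3)]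
        increment_distr[OF assms(1,2)] by simp
qed

lemma Laplace_grid:
  "(\<integral>\<^sup>+\<omega>. ennreal (exp (- a * Y (real n * h) \<omega>)) \<partial>M) = (\<integral>\<^sup>+\<omega>. ennreal (exp (- a * Y h \<omega>)) \<partial>M) ^ n" if h: "0 \<le> h"
proof (induction n)
  case 0
  have "AE \<omega> in M. Y 0 \<omega> = 0" using levy unfolding levy_process_def by blast
  then have "(\<integral>\<^sup>+\<omega>. ennreal (exp (- a * Y 0 \<omega>)) \<partial>M) = (\<integral>\<^sup>+\<omega>. 1 \<partial>M)"
    by (intro nn_integral_cong_AE) (auto elim: eventually_mono)
  then show ?case by (simp add: emeasure_space_1)
next
  case (Suc n)
  let ?s = "real n * h" and ?t = "real (Suc n) * h"
  have st: "0 \<le> ?s" "?s \<le> ?t" "?t - ?s = h" using h by (auto simp: algebra_simps)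
  have A: "(\<lambda>\<omega>. exp (- a * Y ?s \<omega>)) \<in> borel_measurable (F ?s)" using Y_adapted[OF st(1)] by measurable
  have g: "(\<lambda>x::real. exp (- a * x)) \<in> borel_measurable borel" by measurable
  have e: "exp (- a * Y ?t \<omega>) = exp (- a * Y ?s \<omega>) * exp (- a * (Y ?t \<omega> - Y ?s \<omega>))" for \<omega>
    by (simp add: algebra_simps flip: exp_add)
  have m: "(\<lambda>\<omega>. Y ?t \<omega> - Y ?s \<omega>) \<in> borel_measurable M" "Y h \<in> borel_measurable M"
    using Y_measurable[OF st(1)] Y_measurable[of ?t] Y_measurable[OF h] st by auto
  have "(\<integral>\<^sup>+\<omega>. ennreal (exp (- a * (Y ?t \<omega> - Y ?s \<omega>))) \<partial>M)
      = (\<integral>\<^sup>+x. ennreal (exp (- a * x)) \<partial>distr M borel (\<lambda>\<omega>. Y ?t \<omega> - Y ?s \<omega>))"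
    using m by (subst nn_integral_distr) auto
  also have "\<dots> = (\<integral>\<^sup>+\<omega>. ennreal (exp (- a * Y h \<omega>)) \<partial>M)"
    unfolding increment_distr[OF st(1,2)] st(3) using m by (subst nn_integral_distr) auto
  finally have d: "(\<integral>\<^sup>+\<omega>. ennreal (exp (- a * (Y ?t \<omega> - Y ?s \<omega>))) \<partial>M)
      = (\<integral>\<^sup>+\<omega>. ennreal (exp (- a * Y h \<omega>)) \<partial>M)" .
  show ?case
    unfolding e indep_var_nn_integral_mult[OF increment_indep_var[OF st(1,2) A g] exp_ge_zero exp_ge_zero] d Suc
    by (simp add: mult.commute)
qed

text \<open>By stationarity and independence the transform at time \<open>1\<close> is the \<open>m\<close>-th power of the
  transform at time \<open>1 / m\<close>. The argument runs in the extended nonnegative reals, so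
  integrability is a conclusion.\<close>

lemma Laplace_root:
  assumes "integrable M (\<lambda>\<omega>. exp (- a * Y 1 \<omega>))" "expectation (\<lambda>\<omega>. exp (- a * Y 1 \<omega>)) = exp c" and m: "0 < m"
  shows "integrable M (\<lambda>\<omega>. exp (- a * Y (1 / real m) \<omega>))"
    and "expectation (\<lambda>\<omega>. exp (- a * Y (1 / real m) \<omega>)) = exp (c / real m)"
proof -
  let ?f = "\<integral>\<^sup>+\<omega>. ennreal (exp (- a * Y (1 / real m) \<omega>)) \<partial>M"
  have "?f ^ m = (\<integral>\<^sup>+\<omega>. ennreal (exp (- a * Y (real m * (1 / real m)) \<omega>)) \<partial>M)"
    by (rule Laplace_grid[symmetric]) simp
  also have "\<dots> = ennreal (exp c)"
    using m nn_integral_eq_integral[OF assms(1)] assms(2) by simp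
  finally have pow: "?f ^ m = ennreal (exp c)" .
  have "?f \<noteq> \<infinity>"
  proof
    assume "?f = \<infinity>"
    then have "?f ^ m = \<infinity>" using m by simp
    then show False using pow by simp
  qed
  then obtain x where x: "?f = ennreal x" "0 \<le> x" by (cases ?f) auto
  have "ennreal (x ^ m) = ennreal (exp c)" using pow x by (simp add: ennreal_power)
  then have "x ^ m = exp c" using x(2) by (subst (asm) ennreal_inj) auto
  also have "exp c = exp (c / real m) ^ m" using m by (simp flip: exp_of_nat_mult)
  finally have xe: "x = exp (c / real m)" using x(2) m by (intro power_eq_imp_eq_base[of x m]) auto
  have Ym: "(\<lambda>\<omega>. exp (- a * Y (1 / real m) \<omega>)) \<in> borel_measurable M" using Y_measurable[of "1 / real m"]
      by measurable
  show int: "integrable M (\<lambda>\<omega>. exp (- a * Y (1 / real m) \<omega>))"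
    by (rule integrableI_nonneg[OF Ym]) (use x in auto)
  have "ennreal (expectation (\<lambda>\<omega>. exp (- a * Y (1 / real m) \<omega>))) = ennreal (exp (c / real m))"
    using nn_integral_eq_integral[OF int] x xe by simp
  then show "expectation (\<lambda>\<omega>. exp (- a * Y (1 / real m) \<omega>)) = exp (c / real m)"
    by (subst (asm) ennreal_inj) auto
qed

text \<open>The second moment is \<open>exp (c2 / m) - exp (2 * c1 / m)\<close>, which is of order \<open>1 / m\<close>: a
  unit of time, made of \<open>m\<close> steps, contributes a bounded amount.\<close>

lemma compensated_exp_increment:
  assumes c1: "integrable M (\<lambda>\<omega>. exp (- a * Y 1 \<omega>))" "expectation (\<lambda>\<omega>. exp (- a * Y 1 \<omega>)) = exp c1"
    and c2: "integrable M (\<lambda>\<omega>. exp (- (2 * a) * Y 1 \<omega>))" "expectation (\<lambda>\<omega>. exp (- (2 * a) * Y 1 \<omega>)) = exp c2"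
    and m: "0 < m" and st: "0 \<le> s" "t = s + 1 / real m"
  defines "U \<equiv> \<lambda>\<omega>. exp (- a * (Y t \<omega> - Y s \<omega>)) - exp (c1 / real m)"
  shows "integrable M (\<lambda>\<omega>. (U \<omega>)\<^sup>2)" and "expectation U = 0"
    and "expectation (\<lambda>\<omega>. (U \<omega>)\<^sup>2) \<le> \<bar>c2 - 2 * c1\<bar> * exp \<bar>c2\<bar> / real m"
proof -
  have st': "0 \<le> s" "s \<le> t" "t - s = 1 / real m" using st by auto
  have g: "(\<lambda>x::real. exp (- b * x)) \<in> borel_measurable borel" for b by measurable
  note L1 = Laplace_root[OF c1 m] and L2 = Laplace_root[OF c2 m]
  have i1: "integrable M (\<lambda>\<omega>. exp (- a * (Y t \<omega> - Y s \<omega>)))" and e1: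
      "expectation (\<lambda>\<omega>. exp (- a * (Y t \<omega> - Y s \<omega>))) = exp (c1 / real m)"
    using increment_integral[OF st'(1,2) g[of a]] L1 st'(3) by auto
  have i2: "integrable M (\<lambda>\<omega>. exp (- (2 * a) * (Y t \<omega> - Y s \<omega>)))" and e2:
      "expectation (\<lambda>\<omega>. exp (- (2 * a) * (Y t \<omega> - Y s \<omega>))) = exp (c2 / real m)"
    using increment_integral[OF st'(1,2) g[of "2 * a"]] L2 st'(3) by auto
  show "expectation U = 0" unfolding U_def using i1 e1 prob_space by simp
  have sq: "(U \<omega>)\<^sup>2 = exp (- (2 * a) * (Y t \<omega> - Y s \<omega>)) - 2 * exp (c1 / real m)
      * exp (- a * (Y t \<omega> - Y s \<omega>)) + (exp (c1 / real m))\<^sup>2" for \<omega>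
  proof -
    have "exp (- (2 * a) * (Y t \<omega> - Y s \<omega>)) = (exp (- a * (Y t \<omega> - Y s \<omega>)))\<^sup>2"
      by (simp add: power2_eq_square flip: exp_add)
    then show ?thesis unfolding U_def by (simp only: power2_diff) (simp add: mult.commute mult.left_commute)
  qed
  show "integrable M (\<lambda>\<omega>. (U \<omega>)\<^sup>2)" unfolding sq using i1 i2 by simp
  have "expectation (\<lambda>\<omega>. (U \<omega>)\<^sup>2) = exp (c2 / real m) - 2 * exp (c1 / real m) * exp (c1 / real m)
      + (exp (c1 / real m))\<^sup>2"
    unfolding sq using i1 i2 e1 e2 prob_space by simp
  also have "\<dots> = exp (c2 / real m) * (1 - exp (- ((c2 - 2 * c1) / real m)))"
    by (simp add: power2_eq_square algebra_simps diff_divide_distrib flip: exp_add)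
  also have "\<dots> \<le> exp \<bar>c2\<bar> * (\<bar>c2 - 2 * c1\<bar> / real m)"
  proof (rule order_trans[OF mult_left_mono mult_right_mono])
    have "1 - exp (- ((c2 - 2 * c1) / real m)) \<le> (c2 - 2 * c1) / real m"
      using exp_ge_add_one_self[of "- ((c2 - 2 * c1) / real m)"] by simp
    also have "\<dots> \<le> \<bar>c2 - 2 * c1\<bar> / real m" by (rule divide_right_mono) auto
    finally show "1 - exp (- ((c2 - 2 * c1) / real m)) \<le> \<bar>c2 - 2 * c1\<bar> / real m" .
    have "c2 / real m \<le> \<bar>c2\<bar> / real m" by (rule divide_right_mono) auto
    also have "\<dots> \<le> \<bar>c2\<bar> / 1" by (rule divide_left_mono) (use m in auto)
    finally show "exp (c2 / real m) \<le> exp \<bar>c2\<bar>" by simp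
  qed auto
  finally show "expectation (\<lambda>\<omega>. (U \<omega>)\<^sup>2) \<le> \<bar>c2 - 2 * c1\<bar> * exp \<bar>c2\<bar> / real m" by (simp add: mult.commute)
qed

end

section \<open>The balance equation along square times\<close>

text \<open>Fatou's lemma bounds the second moment of \<open>Z N\<close> by \<open>N * C\<close>. So the second moment of
  \<open>Z (n\<^sup>2) / n\<^sup>2\<close> is at most \<open>C / n\<^sup>2\<close>; the series of these squares has a finite expectation,
  hence converges almost surely. The lower limit \<open>V\<close> serves as a measurable version of the
  square of \<open>Z\<close>.\<close>

lemma (in prob_space) limit_over_squares_vanishes:
  fixes D :: "nat \<Rightarrow> nat \<Rightarrow> 'a \<Rightarrow> real"
  assumes D: "\<And>N m. D N m \<in> borel_measurable M"
    and int: "\<And>N m. 0 < m \<Longrightarrow> integrable M (\<lambda>\<omega>. (D N m \<omega>)\<^sup>2)"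
    and bound: "\<And>N m. 0 < m \<Longrightarrow> expectation (\<lambda>\<omega>. (D N m \<omega>)\<^sup>2) \<le> real N * C"
    and C: "0 \<le> C"
    and lim: "AE \<omega> in M. \<forall>N. (\<lambda>m. D N m \<omega>) \<longlonglongrightarrow> Z N \<omega>"
  shows "AE \<omega> in M. (\<lambda>n. Z (n\<^sup>2) \<omega> / (real n)\<^sup>2) \<longlonglongrightarrow> 0"
proof -
  define V where "V N \<omega> = liminf (\<lambda>m. ennreal ((D N m \<omega>)\<^sup>2))" for N \<omega>
  define c :: "nat \<Rightarrow> real" where "c n = inverse ((real n)\<^sup>2)" for n
  have Vm[measurable]: "V N \<in> borel_measurable M" for N
    unfolding V_def[abs_def] using D by measurable
  have V: "(\<integral>\<^sup>+\<omega>. V N \<omega> \<partial>M) \<le> ennreal (real N * C)" for N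
  proof -
    have "(\<integral>\<^sup>+\<omega>. V N \<omega> \<partial>M) \<le> liminf (\<lambda>m. \<integral>\<^sup>+\<omega>. ennreal ((D N m \<omega>)\<^sup>2) \<partial>M)"
      unfolding V_def by (rule nn_integral_liminf) (use D in measurable)
    also have "\<dots> \<le> limsup (\<lambda>m. \<integral>\<^sup>+\<omega>. ennreal ((D N m \<omega>)\<^sup>2) \<partial>M)"
      by (rule Liminf_le_Limsup) simp
    also have "\<dots> \<le> ennreal (real N * C)"
    proof (rule Limsup_bounded)
      show "eventually (\<lambda>m. (\<integral>\<^sup>+\<omega>. ennreal ((D N m \<omega>)\<^sup>2) \<partial>M) \<le> ennreal (real N * C)) sequentially"
        using eventually_gt_at_top[of 0]
      proof eventually_elim
        case (elim m)
        show ?case using nn_integral_eq_integral[OF int[OF elim]] bound[OF elim] by (simp add: ennreal_leI)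
      qed
    qed
    finally show ?thesis .
  qed
  have summ: "summable (\<lambda>n. c n * C)"
    unfolding c_def using inverse_power_summable[of 2, where 'a=real] by (intro summable_mult2) simp
  have c0: "0 \<le> c n" for n by (simp add: c_def)
  have "(\<integral>\<^sup>+\<omega>. (\<Sum>n. ennreal (c n * c n) * V (n\<^sup>2) \<omega>) \<partial>M) = (\<Sum>n. ennreal (c n * c n) * (\<integral>\<^sup>+\<omega>. V (n\<^sup>2) \<omega> \<partial>M))"
    by (subst nn_integral_suminf) (auto simp: nn_integral_cmult)
  also have "\<dots> \<le> (\<Sum>n. ennreal (c n * C))"
  proof (rule suminf_le)
    fix n
    have "ennreal (c n * c n) * (\<integral>\<^sup>+\<omega>. V (n\<^sup>2) \<omega> \<partial>M) \<le> ennreal (c n * c n) * ennreal (real (n\<^sup>2) * C)"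
      by (rule mult_left_mono[OF V]) simp
    also have "\<dots> = ennreal ((c n * c n) * (real (n\<^sup>2) * C))"
      using c0 C by (intro ennreal_mult[symmetric]) auto
    also have "(c n * c n) * (real (n\<^sup>2) * C) = c n * C"
      by (cases "n = 0") (auto simp: c_def field_simps)
    finally show "ennreal (c n * c n) * (\<integral>\<^sup>+\<omega>. V (n\<^sup>2) \<omega> \<partial>M) \<le> ennreal (c n * C)" .
  qed auto
  also have "\<dots> = ennreal (\<Sum>n. c n * C)" using summ c0 C by (intro suminf_ennreal2) auto
  also have "\<dots> < \<infinity>" by simp
  finally have "(\<integral>\<^sup>+\<omega>. (\<Sum>n. ennreal (c n * c n) * V (n\<^sup>2) \<omega>) \<partial>M) \<noteq> \<infinity>" by simp
  then have "AE \<omega> in M. (\<Sum>n. ennreal (c n * c n) * V (n\<^sup>2) \<omega>) \<noteq> \<infinity>"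
    by (intro nn_integral_PInf_AE) auto
  then show ?thesis using lim
  proof eventually_elim
    case (elim \<omega>)
    have VZ: "V N \<omega> = ennreal ((Z N \<omega>)\<^sup>2)" for N
    proof -
      have "(\<lambda>m. ennreal ((D N m \<omega>)\<^sup>2)) \<longlonglongrightarrow> ennreal ((Z N \<omega>)\<^sup>2)"
        by (intro tendsto_ennrealI tendsto_power) (use elim(2) in blast)
      then show ?thesis unfolding V_def by (intro lim_imp_Liminf) auto
    qed
    have t: "ennreal (c n * c n) * V (n\<^sup>2) \<omega> = ennreal ((c n * Z (n\<^sup>2) \<omega>)\<^sup>2)" for n
      unfolding VZ by (subst ennreal_mult[symmetric]) (auto simp: power2_eq_square c0 algebra_simps)
    have "summable (\<lambda>n. (c n * Z (n\<^sup>2) \<omega>)\<^sup>2)"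
      by (rule summable_suminf_not_top) (use elim(1) in \<open>simp_all add: t\<close>)
    then have "(\<lambda>n. (c n * Z (n\<^sup>2) \<omega>)\<^sup>2) \<longlonglongrightarrow> 0" by (rule summable_LIMSEQ_zero)
    then have "(\<lambda>n. sqrt ((c n * Z (n\<^sup>2) \<omega>)\<^sup>2)) \<longlonglongrightarrow> sqrt 0" by (rule tendsto_real_sqrt)
    then have "(\<lambda>n. c n * Z (n\<^sup>2) \<omega>) \<longlonglongrightarrow> 0" by (simp add: tendsto_rabs_zero_iff)
    then show ?case by (simp add: c_def field_simps)
  qed
qed

locale updown_storage = prob_space M for M :: "'a measure" +
  fixes F :: "real \<Rightarrow> 'a measure" and Xu Xd :: "real \<Rightarrow> 'a \<Rightarrow> real"
    and S T :: "nat \<Rightarrow> 'a \<Rightarrow> ennreal" and W0 :: "'a \<Rightarrow> real" and \<phi> \<eta> :: "real \<Rightarrow> real"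
  assumes sub: "0 \<le> t \<Longrightarrow> subalgebra M (F t)"
    and F_mono: "0 \<le> s \<Longrightarrow> s \<le> t \<Longrightarrow> sets (F s) \<subseteq> sets (F t)"
    and levy_u: "levy_process M F Xu" and levy_d: "levy_process M F Xd"
    and up_jumps: "no_negative_jumps M Xu" and down_mono: "nondecreasing_paths M Xd"
    and Laplace_u: "0 \<le> \<alpha> \<Longrightarrow> integrable M (\<lambda>\<omega>. exp (- \<alpha> * Xu 1 \<omega>))"
      "0 \<le> \<alpha> \<Longrightarrow> expectation (\<lambda>\<omega>. exp (- \<alpha> * Xu 1 \<omega>)) = exp (\<phi> \<alpha>)"
    and Laplace_d: "0 \<le> \<alpha> \<Longrightarrow> integrable M (\<lambda>\<omega>. exp (- \<alpha> * Xd 1 \<omega>))"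
      "0 \<le> \<alpha> \<Longrightarrow> expectation (\<lambda>\<omega>. exp (- \<alpha> * Xd 1 \<omega>)) = exp (- \<eta> \<alpha>)"
    and stop_T: "ext_stopping_time F (T n)" and stop_S: "ext_stopping_time F (S (Suc n))"
    and switching: "AE \<omega> in M. switching_times (\<lambda>n. S n \<omega>) (\<lambda>n. T n \<omega>)"
    and W0_measurable: "W0 \<in> borel_measurable (F 0)" and W0_nonneg: "AE \<omega> in M. 0 \<le> W0 \<omega>"
begin

sublocale up: real_levy M F Xu by unfold_locales (use sub levy_u in auto)
sublocale down: real_levy M F Xd by unfold_locales (use sub levy_d in auto)

definition J :: "real \<Rightarrow> 'a \<Rightarrow> real" where
  "J t \<omega> = down_ind (\<lambda>n. S n \<omega>) (\<lambda>n. T n \<omega>) t"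

definition X :: "real \<Rightarrow> 'a \<Rightarrow> real" where
  "X t \<omega> = net_input (\<lambda>n. S n \<omega>) (\<lambda>n. T n \<omega>) (\<lambda>s. Xu s \<omega>) (\<lambda>s. Xd s \<omega>) t"

definition W :: "real \<Rightarrow> 'a \<Rightarrow> real" where
  "W t \<omega> = reflected (W0 \<omega>) (\<lambda>t. X t \<omega>) t"

definition L :: "real \<Rightarrow> 'a \<Rightarrow> real" where
  "L t \<omega> = regulator (W0 \<omega>) (\<lambda>t. X t \<omega>) t"

definition change_times :: "'a \<Rightarrow> nat \<Rightarrow> real" where
  "change_times \<omega> = switching_times.switch_time (\<lambda>n. S n \<omega>) (\<lambda>n. T n \<omega>)"

abbreviation down_work :: "real \<Rightarrow> real \<Rightarrow> 'a \<Rightarrow> real" where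
  "down_work \<alpha> t \<omega> \<equiv> LBINT s:{0..t}. exp (- \<alpha> * W s \<omega>) * J s \<omega>"

abbreviation down_total :: "real \<Rightarrow> 'a \<Rightarrow> real" where
  "down_total t \<omega> \<equiv> LBINT s:{0..t}. J s \<omega>"

text \<open>The paths to which the deterministic results apply.\<close>

abbreviation good_path :: "'a \<Rightarrow> bool" where
  "good_path \<omega> \<equiv> switched_path (change_times \<omega>) (\<lambda>t. J t \<omega>) (\<lambda>t. Xu t \<omega>) (\<lambda>t. Xd t \<omega>) (\<lambda>t. X t \<omega>)"

lemma AE_switched_path:
  "AE \<omega> in M. 0 \<le> W0 \<omega> \<and> switching_times (\<lambda>n. S n \<omega>) (\<lambda>n. T n \<omega>) \<and>
     good_path \<omega>"
proof -
  have "AE \<omega> in M. cadlag (\<lambda>t. Xu t \<omega>)" "AE \<omega> in M. cadlag (\<lambda>t. Xd t \<omega>)"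
    using levy_u levy_d unfolding levy_process_def by blast+
  with W0_nonneg switching up_jumps[unfolded no_negative_jumps_def] down_mono[unfolded nondecreasing_paths_def]
  show ?thesis
  proof eventually_elim
    case (elim \<omega>)
    interpret switching_times "\<lambda>n. S n \<omega>" "\<lambda>n. T n \<omega>" by fact
    have rc: "right_cont (\<lambda>t. Xu t \<omega>)" "right_cont (\<lambda>t. Xd t \<omega>)"
      using elim(5,6) unfolding cadlag_def right_cont_def by blast+
    have dv: "drops_vanish_on (\<lambda>t. Xu t \<omega>) b" "drops_vanish_on (\<lambda>t. Xd t \<omega>) b" for b
      using cadlag_drops_vanish_on[OF elim(5)] elim(3) mono_on_drops_vanish_on[OF elim(4)] by blast+
    show ?case using net_input_switched_path[OF rc dv] elim(1,2) unfolding J_def X_def change_times_def by blast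
  qed
qed

definition down_at :: "real \<Rightarrow> 'a \<Rightarrow> real" where
  "down_at t \<omega> = of_bool (\<exists>n. T n \<omega> \<le> ennreal t \<and> \<not> S (Suc n) \<omega> \<le> ennreal t)"

lemma down_at_measurable:
  assumes "0 \<le> t" shows "down_at t \<in> borel_measurable (F t)"
proof -
  have [measurable]: "Measurable.pred (F t) (\<lambda>\<omega>. T n \<omega> \<le> ennreal t)"
      "Measurable.pred (F t) (\<lambda>\<omega>. S (Suc n) \<omega> \<le> ennreal t)" for n
    using stop_T[of n] stop_S[of n] assms unfolding ext_stopping_time_def by blast+
  show ?thesis unfolding down_at_def[abs_def] by measurable
qed

definition grid_in :: "nat \<Rightarrow> nat \<Rightarrow> 'a \<Rightarrow> real" where
  "grid_in m l \<omega> = grid_input (\<lambda>t. down_at t \<omega>) (\<lambda>t. Xu t \<omega>) (\<lambda>t. Xd t \<omega>) m l"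

definition grid_W :: "nat \<Rightarrow> nat \<Rightarrow> 'a \<Rightarrow> real" where
  "grid_W m k \<omega> = lindley (max 0 (W0 \<omega>)) (\<lambda>l. grid_in m l \<omega>) k"

lemma measurable_later:
  fixes f :: "'a \<Rightarrow> real"
  assumes "f \<in> borel_measurable (F s)" "0 \<le> s" "s \<le> t"
  shows "f \<in> borel_measurable (F t)"
  by (rule measurable_from_subalg[OF _ assms(1)])
     (use sub[of s] sub[of t] F_mono[of s t] assms(2,3) in \<open>auto simp: subalgebra_def\<close>)

lemma grid_le: "real k / real m \<le> real (Suc k) / real m"
  by (simp add: divide_right_mono)

lemma grid_in_measurable: "grid_in m k \<in> borel_measurable (F (real (Suc k) / real m))"
proof -
  let ?s = "real k / real m" and ?t = "real (Suc k) / real m"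
  have t: "0 \<le> ?s" "0 \<le> ?t" "?s \<le> ?t" by (simp, simp, rule grid_le)
  note [measurable] = measurable_later[OF down_at_measurable[OF t(1)] t(1,3)]
    measurable_later[OF up.Y_adapted[OF t(1)] t(1,3)] measurable_later[OF down.Y_adapted[OF t(1)] t(1,3)]
    up.Y_adapted[OF t(2)] down.Y_adapted[OF t(2)]
  show ?thesis unfolding grid_in_def[abs_def] grid_input_def by measurable
qed

lemma grid_W_measurable: "grid_W m k \<in> borel_measurable (F (real k / real m))"
proof (induction k)
  case 0
  show ?case unfolding grid_W_def[abs_def] using W0_measurable by simp
next
  case (Suc k)
  have "(\<lambda>\<omega>. max 0 (grid_W m k \<omega> + grid_in m k \<omega>)) \<in> borel_measurable (F (real (Suc k) / real m))"
    using measurable_later[OF Suc _ grid_le] grid_in_measurable by measurable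
  then show ?case unfolding grid_W_def[abs_def] by simp
qed

lemma grid_W_nonneg: "0 \<le> grid_W m k \<omega>"
  unfolding grid_W_def by (rule lindley_nonneg) simp

definition grid_martingale :: "real \<Rightarrow> nat \<Rightarrow> nat \<Rightarrow> 'a \<Rightarrow> real" where
  "grid_martingale \<alpha> m n \<omega> = (\<Sum>k<n. exp (- \<alpha> * grid_W m k \<omega>) *
     (exp (- \<alpha> * grid_in m k \<omega>) - grid_rate (\<lambda>t. down_at t \<omega>) (\<phi> \<alpha>) (\<eta> \<alpha>) m k))"

text \<open>The contributions of the down and of the up input to the second moment per unit of time,
  as they come out of \<open>compensated_exp_increment\<close>.\<close>

definition second_moment_rate :: "real \<Rightarrow> real" where
  "second_moment_rate \<alpha> = \<bar>- \<eta> (2 * \<alpha>) - 2 * (- \<eta> \<alpha>)\<bar> * exp \<bar>- \<eta> (2 * \<alpha>)\<bar>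
     + \<bar>\<phi> (2 * \<alpha>) - 2 * \<phi> \<alpha>\<bar> * exp \<bar>\<phi> (2 * \<alpha>)\<bar>"

text \<open>The weights \<open>a\<close> and \<open>b\<close> are the discounted indicators of the two modes at the left end
  of a cell; the increments \<open>u\<close> and \<open>v\<close> are the compensated exponentials of the two inputs
  over that cell.\<close>

lemma grid_martingale_second_moment:
  assumes \<alpha>: "0 \<le> \<alpha>" and m: "0 < m"
  shows "integrable M (\<lambda>\<omega>. (grid_martingale \<alpha> m (N * m) \<omega>)\<^sup>2)"
    and "expectation (\<lambda>\<omega>. (grid_martingale \<alpha> m (N * m) \<omega>)\<^sup>2) \<le> real N * second_moment_rate \<alpha>"
proof -
  let ?t = "\<lambda>k. real k / real m"
  let ?E = "\<lambda>k \<omega>. exp (- \<alpha> * grid_W m k \<omega>)"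
  define a where "a k \<omega> = ?E k \<omega> * down_at (?t k) \<omega>" for k \<omega>
  define b where "b k \<omega> = ?E k \<omega> * (1 - down_at (?t k) \<omega>)" for k \<omega>
  define u where "u k \<omega> = exp (- \<alpha> * (Xd (?t (Suc k)) \<omega> - Xd (?t k) \<omega>)) - exp (- \<eta> \<alpha> / real m)" for k \<omega>
  define v where "v k \<omega> = exp (- \<alpha> * (Xu (?t (Suc k)) \<omega> - Xu (?t k) \<omega>)) - exp (\<phi> \<alpha> / real m)" for k \<omega>
  have t: "0 \<le> ?t k" "?t (Suc k) = ?t k + 1 / real m" "?t k \<le> ?t (Suc k)" for k
    by (simp_all add: add_divide_distrib divide_right_mono)
  have \<alpha>2: "0 \<le> 2 * \<alpha>" using \<alpha> by simp
  have E: "0 < ?E k \<omega>" "?E k \<omega> \<le> 1" for k \<omega>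
    using \<alpha> grid_W_nonneg[of m k \<omega>] by auto
  have D01: "down_at s \<omega> = 0 \<or> down_at s \<omega> = 1" for s \<omega>
    unfolding down_at_def of_bool_def by presburger
  have am: "a k \<in> borel_measurable (F (?t k))" "b k \<in> borel_measurable (F (?t k))" for k
    unfolding a_def[abs_def] b_def[abs_def] using grid_W_measurable down_at_measurable[OF t(1)] by measurable
  have a1: "\<bar>a k \<omega>\<bar> \<le> 1" "\<bar>b k \<omega>\<bar> \<le> 1" "a k \<omega> * b k \<omega> = 0" for k \<omega>
    using D01[of "?t k" \<omega>] E[of k \<omega>] unfolding a_def b_def by auto
  have um: "u k \<in> borel_measurable (F (?t (Suc k)))" "v k \<in> borel_measurable (F (?t (Suc k)))" for k
    unfolding u_def[abs_def] v_def[abs_def]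
    using measurable_later[OF down.Y_adapted[OF t(1)] t(1,3)] measurable_later[OF up.Y_adapted[OF t(1)] t(1,3)]
      down.Y_adapted[OF t(1)] up.Y_adapted[OF t(1)] by measurable
  have uind: "indep_var borel A borel (u k)" "indep_var borel A borel (v k)" if
      "A \<in> borel_measurable (F (?t k))" for A :: "'a \<Rightarrow> real" and k
  proof -
    have g: "(\<lambda>x::real. exp (- \<alpha> * x) - c) \<in> borel_measurable borel" for c by measurable
    show "indep_var borel A borel (u k)" "indep_var borel A borel (v k)"
      using down.increment_indep_var[OF t(1,3) that g] up.increment_indep_var[OF t(1,3) that g]
      unfolding u_def[abs_def] v_def[abs_def] by blast+
  qed
  note U = down.compensated_exp_increment[OF Laplace_d[OF \<alpha>] Laplace_d[OF \<alpha>2] m t(1,2), folded u_def]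
  note V = up.compensated_exp_increment[OF Laplace_u[OF \<alpha>] Laplace_u[OF \<alpha>2] m t(1,2), folded v_def]
  have D: "grid_martingale \<alpha> m n \<omega> = (\<Sum>k<n. a k \<omega> * u k \<omega> + b k \<omega> * v k \<omega>)" for n \<omega>
    unfolding grid_martingale_def
  proof (rule sum.cong[OF refl])
    fix k
    show "?E k \<omega> * (exp (- \<alpha> * grid_in m k \<omega>) - grid_rate (\<lambda>t. down_at t \<omega>) (\<phi> \<alpha>) (\<eta> \<alpha>) m k)
        = a k \<omega> * u k \<omega> + b k \<omega> * v k \<omega>"
      using D01[of "?t k" \<omega>] unfolding a_def b_def u_def v_def grid_in_def grid_input_def grid_rate_def by auto
  qed
  have sm: "sets (F (?t k)) \<subseteq> sets (F (?t (Suc k)))" for k by (rule F_mono[OF t(1,3)])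
  note R = martingale_sum_second_moment[of
      "\<lambda>k. F (?t k)" a b u _ v, OF sub[OF t(1)] sm am(1) a1(1) am(2) a1(2) a1(3) um(1) uind(1) U um(2)
      uind(2) V, of "N * m", folded D]
  show "integrable M (\<lambda>\<omega>. (grid_martingale \<alpha> m (N * m) \<omega>)\<^sup>2)" using R by blast
  have "expectation (\<lambda>\<omega>. (grid_martingale \<alpha> m (N * m) \<omega>)\<^sup>2)
      \<le> real (N * m) * (\<bar>- \<eta> (2 * \<alpha>) - 2 * (- \<eta> \<alpha>)\<bar> * exp \<bar>- \<eta> (2 * \<alpha>)\<bar> / real m
     + \<bar>\<phi> (2 * \<alpha>) - 2 * \<phi> \<alpha>\<bar> * exp \<bar>\<phi> (2 * \<alpha>)\<bar> / real m)" using R by blast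
  also have "\<dots> = real N * second_moment_rate \<alpha>"
    using m unfolding second_moment_rate_def add_divide_distrib[symmetric] by simp
  finally show "expectation (\<lambda>\<omega>. (grid_martingale \<alpha> m (N * m) \<omega>)\<^sup>2) \<le> real N * second_moment_rate \<alpha>" .
qed

text \<open>The limit of the grid martingales as the mesh shrinks is the Kella-Whitt process, so its
  values at square times are negligible against time.\<close>

lemma Kella_Whitt_ergodic:
  assumes \<alpha>: "0 \<le> \<alpha>"
  shows "AE \<omega> in M. (\<lambda>n. (exp (- \<alpha> * W (real (n\<^sup>2)) \<omega>) - exp (- \<alpha> * W0 \<omega>) + \<alpha> * L (real (n\<^sup>2)) \<omega>
     - (\<phi> \<alpha> * (LBINT s:{0..real (n\<^sup>2)}. exp (- \<alpha> * W s \<omega>) * (1 - J s \<omega>))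
        - \<eta> \<alpha> * down_work \<alpha> (real (n\<^sup>2)) \<omega>)) / (real n)\<^sup>2) \<longlonglongrightarrow> 0"
proof (rule limit_over_squares_vanishes[where D="\<lambda>N m. grid_martingale \<alpha> m (N * m)"])
  have sub': "f \<in> borel_measurable M" if "f \<in> borel_measurable (F t)" "0 \<le> t" for f :: "'a \<Rightarrow> real" and t
    using measurable_from_subalg[OF sub[OF that(2)] that(1)] .
  have [measurable]: "grid_W m k \<in> borel_measurable M" "grid_in m k \<in> borel_measurable M"
      "down_at (real k / real m) \<in> borel_measurable M" for m k
    using sub'[OF grid_W_measurable] sub'[OF grid_in_measurable] sub'[OF down_at_measurable] by auto
  show "grid_martingale \<alpha> m (N * m) \<in> borel_measurable M" for N m
    unfolding grid_martingale_def[abs_def] grid_rate_def by measurable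
  show "0 \<le> second_moment_rate \<alpha>" by (simp add: second_moment_rate_def)
  show "AE \<omega> in M. \<forall>N. (\<lambda>m. grid_martingale \<alpha> m (N * m) \<omega>) \<longlonglongrightarrow>
     exp (- \<alpha> * W (real N) \<omega>) - exp (- \<alpha> * W0 \<omega>) + \<alpha> * L (real N) \<omega>
     - (\<phi> \<alpha> * (LBINT s:{0..real N}. exp (- \<alpha> * W s \<omega>) * (1 - J s \<omega>))
        - \<eta> \<alpha> * down_work \<alpha> (real N) \<omega>)"
    using AE_switched_path
  proof eventually_elim
    case (elim \<omega>)
    then have w: "0 \<le> W0 \<omega>" and st: "switching_times (\<lambda>n. S n \<omega>) (\<lambda>n. T n \<omega>)" by blast+
    from elim interpret switched_path "change_times \<omega>" "\<lambda>t. J t \<omega>" "\<lambda>t. Xu t \<omega>" "\<lambda>t. Xd t \<omega>" "\<lambda>t. X t \<omega>"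
        by blast
    have JD: "down_at t \<omega> = J t \<omega>" if "0 \<le> t" for t
      using switching_times.down_ind_adapted_form[OF st that] unfolding J_def down_at_def by simp
    have gi: "grid_in m l \<omega> = grid_input (\<lambda>t. J t \<omega>) (\<lambda>t. Xu t \<omega>) (\<lambda>t. Xd t \<omega>) m l" for m l
      unfolding grid_in_def grid_input_def by (simp add: JD)
    have gr: "grid_rate (\<lambda>t. down_at t \<omega>) x y m l = grid_rate (\<lambda>t. J t \<omega>) x y m l" for x y m l
      unfolding grid_rate_def by (simp add: JD)
    have gW: "grid_W m k \<omega> = lindley (W0 \<omega>) (grid_input (\<lambda>t. J t \<omega>) (\<lambda>t. Xu t \<omega>) (\<lambda>t. Xd t \<omega>) m) k" for m k
      unfolding grid_W_def gi using w by simp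
    show ?case
      unfolding grid_martingale_def gi gr gW W_def L_def
      using grid_martingale_limit[OF w \<alpha>] by blast
  qed
qed (use grid_martingale_second_moment[OF \<alpha>] in auto)

end

section \<open>Path averages and the rate of the regulator\<close>

text \<open>Between consecutive squares \<open>f\<close> is enclosed by monotonicity, and the ratio of
  consecutive squares tends to one.\<close>

lemma tendsto_interpolate_squares:
  fixes f :: "real \<Rightarrow> real"
  assumes mono: "\<And>s t. 0 \<le> s \<Longrightarrow> s \<le> t \<Longrightarrow> f s \<le> f t" and nonneg: "\<And>t. 0 \<le> t \<Longrightarrow> 0 \<le> f t"
    and lim: "(\<lambda>n. f (real (n\<^sup>2)) / (real n)\<^sup>2) \<longlonglongrightarrow> g"
  shows "((\<lambda>t. f t / t) \<longlongrightarrow> g) at_top"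
proof -
  define N where "N t = nat \<lfloor>sqrt t\<rfloor>" for t :: real
  have N: "filterlim N sequentially at_top"
    unfolding N_def
    by (intro filterlim_compose[OF filterlim_nat_sequentially]
        filterlim_compose[OF filterlim_floor_sequentially] sqrt_at_top)
  have r1: "(\<lambda>n. (real n / real (Suc n))\<^sup>2) \<longlonglongrightarrow> 1\<^sup>2" by (intro tendsto_power LIMSEQ_n_over_Suc_n)
  have r2: "(\<lambda>n. (real (Suc n) / real n)\<^sup>2) \<longlonglongrightarrow> 1\<^sup>2" by (intro tendsto_power LIMSEQ_Suc_n_over_n)
  have lo: "(\<lambda>n. f (real (n\<^sup>2)) / (real n)\<^sup>2 * (real n / real (Suc n))\<^sup>2) \<longlonglongrightarrow> g * 1\<^sup>2"
    by (intro tendsto_mult lim r1)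
  have hi: "(\<lambda>n. f (real ((Suc n)\<^sup>2)) / (real (Suc n))\<^sup>2 * (real (Suc n) / real n)\<^sup>2) \<longlonglongrightarrow> g * 1\<^sup>2"
    by (intro tendsto_mult LIMSEQ_Suc[OF lim] r2)
  have bounds: "f (real ((N t)\<^sup>2)) / (real (N t))\<^sup>2 * (real (N t) / real (Suc (N t)))\<^sup>2 \<le> f t / t \<and>
      f t / t \<le> f (real ((Suc (N t))\<^sup>2)) / (real (Suc (N t)))\<^sup>2 * (real (Suc (N t)) / real (N t))\<^sup>2" if t:
          "1 \<le> t" for t
  proof -
    have s: "1 \<le> sqrt t" using t by simp
    have n: "real (N t) \<le> sqrt t" "sqrt t < real (Suc (N t))" "1 \<le> N t"
      unfolding N_def using s by (linarith+)
    have "(real (N t))\<^sup>2 \<le> (sqrt t)\<^sup>2" by (rule power_mono[OF n(1)]) simp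
    moreover have "(sqrt t)\<^sup>2 \<le> (real (Suc (N t)))\<^sup>2" by (rule power_mono) (use n(2) s in auto)
    ultimately have b: "(real (N t))\<^sup>2 \<le> t" "t \<le> (real (Suc (N t)))\<^sup>2" using t by auto
    have p: "0 < (real (N t))\<^sup>2" "0 < (real (Suc (N t)))\<^sup>2" using n(3) by auto
    have "f (real ((N t)\<^sup>2)) / (real (N t))\<^sup>2 * (real (N t) / real (Suc (N t)))\<^sup>2
        = f (real ((N t)\<^sup>2)) / (real (Suc (N t)))\<^sup>2"
      using p by (simp add: power_divide)
    also have "\<dots> \<le> f t / t" by (rule frac_le) (use b p t mono[of "real ((N t)\<^sup>2)" t] nonneg in auto)
    finally have 1: "f (real ((N t)\<^sup>2)) / (real (N t))\<^sup>2 * (real (N t) / real (Suc (N t)))\<^sup>2 \<le> f t / t" .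
    have "f t / t \<le> f (real ((Suc (N t))\<^sup>2)) / (real (N t))\<^sup>2"
      by (rule frac_le) (use b p t mono[of t "real ((Suc (N t))\<^sup>2)"] nonneg in auto)
    also have "\<dots> = f (real ((Suc (N t))\<^sup>2)) / (real (Suc (N t)))\<^sup>2 * (real (Suc (N t)) / real (N t))\<^sup>2"
      using p by (simp add: power_divide)
    finally show ?thesis using 1 by blast
  qed
  show ?thesis
  proof (rule tendsto_sandwich)
    show "((\<lambda>t. f (real ((N t)\<^sup>2)) / (real (N t))\<^sup>2 * (real (N t) / real (Suc (N t)))\<^sup>2) \<longlongrightarrow> g) at_top"
      using filterlim_compose[OF lo N] by simp
    show "((\<lambda>t. f (real ((Suc (N t))\<^sup>2)) / (real (Suc (N t)))\<^sup>2 * (real (Suc (N t)) / real (N t))\<^sup>2)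
        \<longlongrightarrow> g) at_top"
      using filterlim_compose[OF hi N] by simp
  qed (use bounds in \<open>auto intro: eventually_mono[OF eventually_ge_at_top[of 1]]\<close>)
qed

text \<open>For fixed \<open>\<alpha>\<close> the balance expresses \<open>l n\<close> through \<open>B \<alpha> n\<close> and \<open>I \<alpha> n\<close>. The latter is
  only known to lie between \<open>a n - (1 - B \<alpha> n)\<close> and \<open>a n\<close>, which leaves a gap of
  \<open>(\<phi> \<alpha> + \<eta> \<alpha>) / \<alpha> * (1 - E \<alpha>)\<close> in the limit. The first factor stays bounded as \<open>\<alpha>\<close> decreases
  to zero and the second one vanishes.\<close>

lemma regulator_rate_squeeze:
  fixes l :: "nat \<Rightarrow> real" and B I :: "real \<Rightarrow> nat \<Rightarrow> real" and a :: "nat \<Rightarrow> real"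
  assumes balance: "\<And>\<alpha>. \<alpha> \<in> A \<Longrightarrow> (\<lambda>n. \<alpha> * l n - (\<phi> \<alpha> * (B \<alpha> n - I \<alpha> n) - \<eta> \<alpha> * I \<alpha> n)) \<longlonglongrightarrow> 0"
    and B: "\<And>\<alpha>. \<alpha> \<in> A \<Longrightarrow> B \<alpha> \<longlonglongrightarrow> E \<alpha>" and a: "a \<longlonglongrightarrow> p"
    and I: "\<And>\<alpha> n. \<alpha> \<in> A \<Longrightarrow> I \<alpha> n \<le> a n" "\<And>\<alpha>. \<alpha> \<in> A \<Longrightarrow> eventually (\<lambda>n. a n - (1 - B \<alpha> n) \<le> I \<alpha> n) sequentially"
    and A: "\<And>\<alpha>. \<alpha> \<in> A \<Longrightarrow> 0 < \<alpha> \<and> 0 \<le> \<phi> \<alpha> + \<eta> \<alpha>" and seq: "\<And>j. x j \<in> A" "filterlim x (at_right 0) sequentially"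
    and \<phi>: "((\<lambda>\<alpha>. \<phi> \<alpha> / \<alpha>) \<longlongrightarrow> \<phi>') (at_right 0)" and \<eta>: "((\<lambda>\<alpha>. \<eta> \<alpha> / \<alpha>) \<longlongrightarrow> \<eta>') (at_right 0)"
    and E: "(E \<longlongrightarrow> 1) (at_right 0)"
  shows "l \<longlonglongrightarrow> \<phi>' - (\<phi>' + \<eta>') * p"
proof (rule LIMSEQ_I)
  fix e :: real assume e: "0 < e"
  let ?l = "\<phi>' - (\<phi>' + \<eta>') * p"
  let ?v = "\<lambda>\<alpha>. (\<phi> \<alpha> / \<alpha>) * E \<alpha> - (\<phi> \<alpha> / \<alpha> + \<eta> \<alpha> / \<alpha>) * p"
  let ?u = "\<lambda>\<alpha>. (\<phi> \<alpha> / \<alpha>) * E \<alpha> - (\<phi> \<alpha> / \<alpha> + \<eta> \<alpha> / \<alpha>) * (p - (1 - E \<alpha>))"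
  have "(?v \<longlongrightarrow> \<phi>' * 1 - (\<phi>' + \<eta>') * p) (at_right 0)" by (intro tendsto_intros \<phi> \<eta> E)
  then have v: "((\<lambda>j. ?v (x j)) \<longlonglongrightarrow> ?l)" using filterlim_compose[OF _ seq(2)] by simp
  have "(?u \<longlongrightarrow> \<phi>' * 1 - (\<phi>' + \<eta>') * (p - (1 - 1))) (at_right 0)" by (intro tendsto_intros \<phi> \<eta> E)
  then have u: "((\<lambda>j. ?u (x j)) \<longlonglongrightarrow> ?l)" using filterlim_compose[OF _ seq(2)] by simp
  have e2: "0 < e / 2" using e by simp
  have "eventually (\<lambda>j. ?l - e / 2 < ?v (x j) \<and> ?u (x j) < ?l + e / 2) sequentially"
    using order_tendstoD(1)[OF v, of "?l - e / 2"] order_tendstoD(2)[OF u, of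
        "?l + e / 2"] e2 eventually_conj by simp
  then obtain j where "?l - e / 2 < ?v (x j) \<and> ?u (x j) < ?l + e / 2" by (auto simp: eventually_sequentially)
  then obtain \<alpha> where \<alpha>: "\<alpha> \<in> A" "?l - e / 2 < ?v \<alpha>" "?u \<alpha> < ?l + e / 2" using seq(1) by blast
  have pos: "0 < \<alpha>" "0 \<le> \<phi> \<alpha> / \<alpha> + \<eta> \<alpha> / \<alpha>" using A[OF \<alpha>(1)] by (simp_all add: add_divide_distrib[symmetric])
  let ?f = "\<lambda>n. l n - ((\<phi> \<alpha> / \<alpha>) * B \<alpha> n - (\<phi> \<alpha> / \<alpha> + \<eta> \<alpha> / \<alpha>) * I \<alpha> n)"
  have "(\<lambda>n. (\<alpha> * l n - (\<phi> \<alpha> * (B \<alpha> n - I \<alpha> n) - \<eta> \<alpha> * I \<alpha> n)) / \<alpha>) \<longlonglongrightarrow> 0 / \<alpha>"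
    by (intro tendsto_divide tendsto_const balance \<alpha>) (use pos in simp)
  moreover have "(\<alpha> * l n - (\<phi> \<alpha> * (B \<alpha> n - I \<alpha> n) - \<eta> \<alpha> * I \<alpha> n)) / \<alpha> = ?f n" for n
    using pos(1) by (simp add: field_simps)
  ultimately have f: "?f \<longlonglongrightarrow> 0" by simp
  have vn: "(\<lambda>n. ?f n + ((\<phi> \<alpha> / \<alpha>) * B \<alpha> n - (\<phi> \<alpha> / \<alpha> + \<eta> \<alpha> / \<alpha>) * a n)) \<longlonglongrightarrow> 0 + ?v \<alpha>"
    by (intro tendsto_intros f a B \<alpha>)
  have un: "(\<lambda>n. ?f n + ((\<phi> \<alpha> / \<alpha>) * B \<alpha> n - (\<phi> \<alpha> / \<alpha> + \<eta> \<alpha> / \<alpha>) * (a n - (1 - B \<alpha> n)))) \<longlonglongrightarrow> 0 + ?u \<alpha>"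
    by (intro tendsto_intros f a B \<alpha>)
  have "eventually (\<lambda>n. ?l - e < ?f n + ((\<phi> \<alpha> / \<alpha>) * B \<alpha> n - (\<phi> \<alpha> / \<alpha> + \<eta> \<alpha> / \<alpha>) * a n)) sequentially"
    by (rule order_tendstoD(1)[OF vn]) (use \<alpha> e in simp)
  moreover have "eventually (\<lambda>n. ?f n + ((\<phi> \<alpha> / \<alpha>) * B \<alpha> n - (\<phi> \<alpha> / \<alpha> + \<eta> \<alpha> / \<alpha>) * (a n - (1 - B \<alpha> n)))
      < ?l + e) sequentially"
    by (rule order_tendstoD(2)[OF un]) (use \<alpha> e in simp)
  ultimately have "eventually (\<lambda>n. norm (l n - ?l) < e) sequentially"
    using I(2)[OF \<alpha>(1)]
  proof eventually_elim
    case (elim n)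
    let ?k = "\<phi> \<alpha> / \<alpha> + \<eta> \<alpha> / \<alpha>"
    have "?k * I \<alpha> n \<le> ?k * a n" by (rule mult_left_mono[OF I(1)[OF \<alpha>(1)] pos(2)])
    moreover have "?k * (a n - (1 - B \<alpha> n)) \<le> ?k * I \<alpha> n" by (rule mult_left_mono[OF elim(3) pos(2)])
    ultimately have "?l - e < l n" "l n < ?l + e" using elim(1,2) by linarith+
    then show ?case by (simp add: abs_less_iff)
  qed
  then show "\<exists>n0. \<forall>n\<ge>n0. norm (l n - ?l) < e" by (simp add: eventually_sequentially)
qed

lemma down_transform_limit:
  fixes l B I :: "nat \<Rightarrow> real"
  assumes balance: "(\<lambda>n. \<alpha> * l n - (\<phi> * (B n - I n) - \<eta> * I n)) \<longlonglongrightarrow> 0"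
    and B: "B \<longlonglongrightarrow> E" and l: "l \<longlonglongrightarrow> r" and pos: "0 < \<phi> + \<eta>"
  shows "I \<longlonglongrightarrow> (\<phi> * E - \<alpha> * r) / (\<phi> + \<eta>)"
proof -
  have "(\<lambda>n. ((\<alpha> * l n - (\<phi> * (B n - I n) - \<eta> * I n)) + (\<phi> * B n - \<alpha> * l n)) / (\<phi> + \<eta>))
      \<longlonglongrightarrow> (0 + (\<phi> * E - \<alpha> * r)) / (\<phi> + \<eta>)"
    by (intro tendsto_intros balance B l) (use pos in simp)
  moreover have "((\<alpha> * l n - (\<phi> * (B n - I n) - \<eta> * I n)) + (\<phi> * B n - \<alpha> * l n)) / (\<phi> + \<eta>) = I n" for n
  proof -
    have "(\<alpha> * l n - (\<phi> * (B n - I n) - \<eta> * I n)) + (\<phi> * B n - \<alpha> * l n) = (\<phi> + \<eta>) * I n"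
        by (simp add: algebra_simps)
    then show ?thesis using pos by simp
  qed
  ultimately show ?thesis by simp
qed

context switched_path
begin

abbreviation down_integral :: "real \<Rightarrow> real \<Rightarrow> real \<Rightarrow> real" where
  "down_integral w a t \<equiv> LBINT s:{0..t}. exp (- a * reflected w X s) * J s"

lemma exp_J_bounds:
  assumes "0 \<le> s" "0 \<le> a"
  shows "0 \<le> exp (- a * reflected w X s) * J s" "exp (- a * reflected w X s) * J s \<le> 1"
  using exp_reflected_bounds[OF assms, of w] J_01[OF assms(1)] by auto

lemma integrable_exp_J: "0 \<le> a \<Longrightarrow> set_integrable lborel {0..t} (\<lambda>s. exp (- a * reflected w X s) * J s)"
  by (rule right_cont_set_integrable[OF right_cont_exp_mult[OF J_right_cont], where B=1])
     (use exp_J_bounds in \<open>auto simp: abs_le_iff intro: order_trans[of _ 0]\<close>)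

lemma integrable_exp: "0 \<le> a \<Longrightarrow> set_integrable lborel {0..t} (\<lambda>s. exp (- a * reflected w X s))"
proof -
  assume a: "0 \<le> a"
  have "right_cont (\<lambda>s::real. 1::real)" by (simp add: right_cont_def)
  from right_cont_exp_mult[OF this] have rc: "right_cont (\<lambda>s. exp (- a * reflected w X s))" by simp
  show ?thesis by (rule right_cont_set_integrable[OF rc,
      where B=1]) (use exp_reflected_bounds(2)[OF _ a] in auto)
qed

lemma integrable_J: "set_integrable lborel {0..t} J"
  by (rule right_cont_set_integrable[OF J_right_cont, where B=1]) (use J_bounds in auto)

lemma integral_up: "0 \<le> a \<Longrightarrow> (LBINT s:{0..t}. exp (- a * reflected w X s) * (1 - J s)) =
    (LBINT s:{0..t}. exp (- a * reflected w X s)) - down_integral w a t"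
  unfolding right_diff_distrib mult_1_right
  by (rule set_integral_diff(2)[OF integrable_exp integrable_exp_J])

lemma down_integral_mono_time:
  assumes "0 \<le> a" "s \<le> t"
  shows "down_integral w a s \<le> down_integral w a t"
proof -
  have "{0..s} \<subseteq> {0..t}" using assms by auto
  then show ?thesis unfolding set_lebesgue_integral_def
    using integrable_exp_J[OF assms(1)] J_bounds unfolding set_integrable_def
    by (intro integral_mono) (auto simp: indicator_def)
qed

lemma down_integral_nonneg: "0 \<le> a \<Longrightarrow> 0 \<le> down_integral w a t"
  unfolding set_lebesgue_integral_def
  by (rule integral_nonneg_AE) (use exp_J_bounds in \<open>auto simp: indicator_def\<close>)

lemma down_integral_antimono:
  assumes "0 \<le> a" "a \<le> b"
  shows "down_integral w b t \<le> down_integral w a t"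
proof (rule set_integral_mono[OF integrable_exp_J integrable_exp_J])
  fix s assume "s \<in> {0..t}"
  then show "exp (- b * reflected w X s) * J s \<le> exp (- a * reflected w X s) * J s"
    using assms reflected_X_nonneg[of s w] J_bounds[of s]
        by (intro mult_right_mono) (auto intro: mult_right_mono)
qed (use assms in auto)

lemma down_integral_le_down_time: "0 \<le> a \<Longrightarrow> down_integral w a t \<le> (LBINT s:{0..t}. J s)"
  using down_integral_antimono[of 0 a t w] by simp

text \<open>Pointwise, \<open>J - exp (- a * W) * J \<le> 1 - exp (- a * W)\<close> since \<open>J\<close> is zero or one.\<close>

lemma down_time_le:
  assumes "0 \<le> a" "0 \<le> t"
  shows "(LBINT s:{0..t}. J s) - (t - (LBINT s:{0..t}. exp (- a * reflected w X s))) \<le> down_integral w a t"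
proof -
  have one: "set_integrable lborel {0..t} (\<lambda>s. 1::real)" "(LBINT s:{0..t}. 1) = t"
    using assms(2) by (simp_all add: set_integrable_def set_lebesgue_integral_def)
  have "(LBINT s:{0..t}. J s - exp (- a * reflected w X s) * J s)
      \<le> (LBINT s:{0..t}. 1 - exp (- a * reflected w X s))"
  proof (rule set_integral_mono[OF set_integral_diff(1) set_integral_diff(1)])
    fix s assume "s \<in> {0..t}"
    then show "J s - exp (- a * reflected w X s) * J s \<le> 1 - exp (- a * reflected w X s)"
      using J_01[of s] exp_reflected_bounds[OF _ assms(1), of s w] by auto
  qed (use integrable_J integrable_exp_J integrable_exp one assms in auto)
  then show ?thesis
    using integrable_J integrable_exp_J[OF assms(1)] integrable_exp[OF assms(1)] one by simp
qed

end

section \<open>Limits of Laplace transforms\<close>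

text \<open>Markov's inequality for \<open>1 - exp (- \<alpha> * x)\<close> bounds the mass beyond \<open>1 / \<alpha>\<close> by a multiple
  of one minus the transform at \<open>\<alpha>\<close>. As \<open>g\<close> tends to one along \<open>z\<close>, the measures are tight,
  and a weakly convergent subsequence identifies the limit. Taking \<open>max 0 x\<close> turns the
  exponentials into bounded continuous functions.\<close>

lemma Laplace_limit_is_transform:
  fixes \<mu> :: "nat \<Rightarrow> real measure" and g :: "real \<Rightarrow> real"
  assumes \<mu>: "\<And>n. real_distribution (\<mu> n)" "\<And>n. AE x in \<mu> n. 0 \<le> x"
    and A: "\<And>\<alpha>. \<alpha> \<in> A \<Longrightarrow> 0 < \<alpha>"
    and lim: "\<And>\<alpha>. \<alpha> \<in> A \<Longrightarrow> (\<lambda>n. \<integral>x. exp (- \<alpha> * x) \<partial>\<mu> n) \<longlonglongrightarrow> g \<alpha>"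
    and seq: "\<And>j::nat. z j \<in> A" "(\<lambda>j. g (z j)) \<longlonglongrightarrow> 1"
  shows "\<exists>Q. real_distribution Q \<and> (\<forall>\<alpha>\<in>A. (\<integral>x. exp (- \<alpha> * max 0 x) \<partial>Q) = g \<alpha>)"
proof -
  interpret \<mu>: real_distribution "\<mu> n" for n by (rule \<mu>(1))
  have int: "integrable (\<mu> n) (\<lambda>x. exp (- \<alpha> * x))" if "0 < \<alpha>" for \<alpha> n
    by (rule \<mu>.integrable_const_bound[where B=1]) (use \<mu>(2)[of n] that in \<open>auto elim!: eventually_mono\<close>)
  have neg: "measure (\<mu> n) {..-1} = 0" for n
  proof -
    have "AE x in \<mu> n. x \<notin> {..-1}" using \<mu>(2)[of n] by eventually_elim auto
    then show ?thesis by (subst \<mu>.prob_eq_0) auto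
  qed
  have up: "\<exists>K>0. \<forall>n. 1 - \<epsilon> < measure (\<mu> n) {..K}" if \<epsilon>: "0 < \<epsilon>" for \<epsilon>
  proof -
    (* 1 - exp (- a * x) is at least \<delta> beyond x = 1 / a *)
    define \<delta> where "\<delta> = 1 - exp (- 1 :: real)"
    have \<delta>: "0 < \<delta>" by (simp add: \<delta>_def)
    have "eventually (\<lambda>j. 1 - \<delta> * \<epsilon> < g (z j)) sequentially"
      by (rule order_tendstoD(1)[OF seq(2)]) (use \<delta> \<epsilon> in simp)
    then obtain j where j: "1 - \<delta> * \<epsilon> < g (z j)" by (auto simp: eventually_sequentially)
    let ?a = "z j"
    have a: "0 < ?a" using A seq(1) by simp
    have tail: "(\<integral>x. exp (- ?a * x) \<partial>\<mu> n) \<le> 1 - \<delta> * (1 - measure (\<mu> n) {..1 / ?a})" for n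
    proof -
      have "(\<integral>x. exp (- ?a * x) \<partial>\<mu> n) \<le> (\<integral>x. (1 - \<delta>) + \<delta> * indicator {..1 / ?a} x \<partial>\<mu> n)"
      proof (rule integral_mono_AE[OF int[OF a]])
        show "AE x in \<mu> n. exp (- ?a * x) \<le> (1 - \<delta>) + \<delta> * indicator {..1 / ?a} x"
          using \<mu>(2)[of n]
        proof eventually_elim
          case (elim x)
          show ?case
          proof (cases "x \<le> 1 / ?a")
            case True then show ?thesis using elim a by simp
          next
            case False
            then have "1 < ?a * x" using a by (simp add: field_simps)
            then show ?thesis using False by (simp add: \<delta>_def)
          qed
        qed
      qed (auto simp: integrable_real_indicator \<mu>.emeasure_eq_measure)
      also have "\<dots> = (1 - \<delta>) + \<delta> * measure (\<mu> n) {..1 / ?a}"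
        using \<mu>.prob_space[of n] by (subst Bochner_Integration.integral_add) (auto simp: \<mu>.emeasure_eq_measure)
      finally show ?thesis by (simp add: algebra_simps)
    qed
    have "eventually (\<lambda>n. 1 - \<delta> * \<epsilon> < (\<integral>x. exp (- ?a * x) \<partial>\<mu> n)) sequentially"
      by (rule order_tendstoD(1)[OF lim[OF seq(1)] j])
    then obtain n0 where n0: "\<And>n. n \<ge> n0 \<Longrightarrow> 1 - \<delta> * \<epsilon> < (\<integral>x. exp (- ?a * x) \<partial>\<mu> n)"
      by (auto simp: eventually_sequentially)
    have late: "1 - \<epsilon> < measure (\<mu> n) {..1 / ?a}" if "n \<ge> n0" for n
    proof -
      have "\<delta> * (1 - measure (\<mu> n) {..1 / ?a}) < \<delta> * \<epsilon>" using n0[OF that] tail[of n] by linarith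
      then show ?thesis using \<delta> by simp
    qed
    have "\<exists>K. 1 - \<epsilon> < measure (\<mu> n) {..K}" for n
    proof -
      have "eventually (\<lambda>K. 1 - \<epsilon> < cdf (\<mu> n) K) at_top"
        by (rule order_tendstoD(1)[OF \<mu>.cdf_lim_at_top_prob]) (use \<epsilon> in simp)
      then show ?thesis unfolding cdf_def by (auto simp: eventually_at_top_linorder)
    qed
    then obtain K where K: "\<And>n. 1 - \<epsilon> < measure (\<mu> n) {..K n}" by metis
    (* the finitely many measures before n0 are tight one by one *)
    define K' where "K' = Max (insert (1 / ?a) (K ` {..n0}))"
    have K'1: "1 / ?a \<le> K'" unfolding K'_def by (rule Max_ge) auto
    have K'2: "K n \<le> K'" if "n \<le> n0" for n unfolding K'_def by (rule Max_ge) (use that in auto)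
    have "1 - \<epsilon> < measure (\<mu> n) {..K'}" for n
    proof -
      have mono: "measure (\<mu> n) {..c} \<le> measure (\<mu> n) {..K'}" if "c \<le> K'" for c
        by (rule \<mu>.finite_measure_mono) (use that in auto)
      show ?thesis
      proof (cases "n \<ge> n0")
        case True then show ?thesis using late[OF True] mono[OF K'1] by simp
      next
        case False then show ?thesis using K[of n] mono[OF K'2[of n]] by simp
      qed
    qed
    moreover have "0 < K'" using K'1 a by (meson divide_pos_pos less_le_trans zero_less_one)
    ultimately show ?thesis by blast
  qed
  have "tight \<mu>" unfolding tight_def
  proof (intro conjI allI impI \<mu>(1))
    fix \<epsilon> :: real assume "0 < \<epsilon>"
    then obtain K where K: "0 < K" "\<And>n. 1 - \<epsilon> < measure (\<mu> n) {..K}" using up by blast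
    have "measure (\<mu> n) {..K} = measure (\<mu> n) {- 1<..K}" for n
    proof -
      have "measure (\<mu> n) ({..-1} \<union> {- 1<..K}) = measure (\<mu> n) {..-1} + measure (\<mu> n) {- 1<..K}"
        by (rule \<mu>.finite_measure_Union) auto
      moreover have "{..-1} \<union> {- 1<..K} = {..K}" using K(1) by auto
      ultimately show ?thesis using neg by simp
    qed
    then show "\<exists>a b. a < b \<and> (\<forall>n. 1 - \<epsilon> < measure (\<mu> n) {a<..b})"
      using K by (intro exI[of _ "-1"] exI[of _ K]) auto
  qed
  from tight_imp_convergent_subsubsequence[OF this strict_mono_id]
  obtain r Q where r: "strict_mono (r :: nat \<Rightarrow> nat)" and Q: "real_distribution Q" and conv:
      "weak_conv_m (\<mu> \<circ> id \<circ> r) Q"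
    by blast
  interpret Q: real_distribution Q by fact
  have "(\<integral>x. exp (- \<alpha> * max 0 x) \<partial>Q) = g \<alpha>" if \<alpha>: "\<alpha> \<in> A" for \<alpha>
  proof (rule LIMSEQ_unique)
    have a: "0 < \<alpha>" using A \<alpha> by simp
    have "(\<lambda>n. \<integral>x. exp (- \<alpha> * max 0 x) \<partial>(\<mu> \<circ> id \<circ> r) n) \<longlonglongrightarrow> (\<integral>x. exp (- \<alpha> * max 0 x) \<partial>Q)"
      by (rule weak_conv_imp_integral_bdd_continuous_conv[OF _ Q conv, where B=1])
         (use \<mu>(1) a in \<open>auto intro!: continuous_intros mult_nonneg_nonneg simp: comp_def\<close>)
    moreover have "(\<integral>x. exp (- \<alpha> * max 0 x) \<partial>(\<mu> \<circ> id \<circ> r) n) = (\<integral>x. exp (- \<alpha> * x) \<partial>\<mu> (r n))" for n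
      unfolding comp_def id_def
    proof (rule integral_cong_AE)
      show "AE x in \<mu> (r n). exp (- \<alpha> * max 0 x) = exp (- \<alpha> * x)"
        using \<mu>(2)[of "r n"] by eventually_elim simp
    qed auto
    ultimately show "(\<lambda>n. \<integral>x. exp (- \<alpha> * x) \<partial>\<mu> (r n)) \<longlonglongrightarrow> (\<integral>x. exp (- \<alpha> * max 0 x) \<partial>Q)" by simp
    show "(\<lambda>n. \<integral>x. exp (- \<alpha> * x) \<partial>\<mu> (r n)) \<longlonglongrightarrow> g \<alpha>"
      using LIMSEQ_subseq_LIMSEQ[OF lim[OF \<alpha>] r] by (simp add: comp_def)
  qed
  then show ?thesis using Q by blast
qed

lemma integral_tendsto_dominated:
  fixes f :: "real \<Rightarrow> 'a \<Rightarrow> real"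
  assumes f: "\<And>\<alpha>. f \<alpha> \<in> borel_measurable M" and g: "g \<in> borel_measurable M" and w: "integrable M w"
    and lim: "\<And>x. x \<in> space M \<Longrightarrow> ((\<lambda>\<alpha>. f \<alpha> x) \<longlongrightarrow> g x) (at c within S)"
    and bound: "eventually (\<lambda>\<alpha>. \<forall>x\<in>space M. \<bar>f \<alpha> x\<bar> \<le> w x) (at c within S)"
  shows "((\<lambda>\<alpha>. \<integral>x. f \<alpha> x \<partial>M) \<longlongrightarrow> (\<integral>x. g x \<partial>M)) (at c within S)"
  unfolding tendsto_at_iff_sequentially[of "\<lambda>\<alpha>. \<integral>x. f \<alpha> x \<partial>M"]
proof (intro allI impI)
  fix X :: "nat \<Rightarrow> real" assume X: "\<forall>i. X i \<in> S - {c}" "X \<longlonglongrightarrow> c"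
  have F: "filterlim X (at c within S) sequentially"
    unfolding filterlim_at using X by (auto intro!: always_eventually)
  obtain n0 where n0: "\<And>i. i \<ge> n0 \<Longrightarrow> \<forall>x\<in>space M. \<bar>f (X i) x\<bar> \<le> w x"
    using eventually_compose_filterlim[OF bound F] by (auto simp: eventually_sequentially)
  have "(\<lambda>i. \<integral>x. f (X (i + n0)) x \<partial>M) \<longlonglongrightarrow> (\<integral>x. g x \<partial>M)"
  proof (rule integral_dominated_convergence[OF g f w])
    show "AE x in M. (\<lambda>i. f (X (i + n0)) x) \<longlonglongrightarrow> g x"
      using filterlim_compose[OF lim F] by (intro AE_I2 LIMSEQ_ignore_initial_segment) auto
    show "AE x in M. norm (f (X (i + n0)) x) \<le> w x" for i
      using n0[of "i + n0"] by (intro AE_I2) simp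
  qed
  then show "((\<lambda>\<alpha>. \<integral>x. f \<alpha> x \<partial>M) \<circ> X) \<longlonglongrightarrow> (\<integral>x. g x \<partial>M)"
    unfolding comp_def by (rule LIMSEQ_offset)
qed

lemma Laplace_transform_continuous:
  assumes "prob_space Q" and Y[measurable]: "Y \<in> borel_measurable Q" and nonneg: "\<And>x. 0 \<le> Y x" and \<alpha>: "0 < \<alpha>"
  shows "isCont (\<lambda>\<alpha>. \<integral>x. exp (- \<alpha> * Y x) \<partial>Q :: real) \<alpha>"
  unfolding isCont_def
proof (rule integral_tendsto_dominated[where w="\<lambda>_. 1"])
  interpret prob_space Q by fact
  show "integrable Q (\<lambda>_. 1 :: real)" by simp
  have "eventually (\<lambda>\<beta>. 0 < \<beta>) (at \<alpha>)" by (rule order_tendstoD(1)[OF tendsto_ident_at \<alpha>])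
  then show "eventually (\<lambda>\<beta>. \<forall>x\<in>space Q. \<bar>exp (- \<beta> * Y x)\<bar> \<le> 1) (at \<alpha>)"
    by eventually_elim (use nonneg in simp)
qed (auto intro!: tendsto_intros)

text \<open>Monotonicity in the parameter extends convergence from the rationals, where one
  exceptional null set suffices, to all continuity points.\<close>

lemma antimono_family_tendsto:
  fixes f :: "real \<Rightarrow> 'b \<Rightarrow> real" and g :: "real \<Rightarrow> real"
  assumes mono: "\<And>\<alpha> \<beta>. 0 < \<alpha> \<Longrightarrow> \<alpha> \<le> \<beta> \<Longrightarrow> eventually (\<lambda>t. f \<beta> t \<le> f \<alpha> t) G"
    and rat: "\<And>q. q \<in> \<rat> \<Longrightarrow> 0 < q \<Longrightarrow> (f q \<longlongrightarrow> g q) G" and cont: "isCont g \<alpha>" and \<alpha>: "0 < \<alpha>"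
  shows "(f \<alpha> \<longlongrightarrow> g \<alpha>) G"
proof (rule tendstoI)
  fix e :: real assume e: "0 < e"
  obtain d where d: "0 < d" "\<And>x. \<bar>x - \<alpha>\<bar> < d \<Longrightarrow> \<bar>g x - g \<alpha>\<bar> < e / 2"
    using cont half_gt_zero[OF e] unfolding continuous_at_eps_delta dist_real_def by meson
  obtain q where q: "q \<in> \<rat>" "max 0 (\<alpha> - d) < q" "q < \<alpha>"
      using Rats_dense_in_real[of "max 0 (\<alpha> - d)" \<alpha>] d(1) \<alpha> by auto
  obtain r where r: "r \<in> \<rat>" "\<alpha> < r" "r < \<alpha> + d" using Rats_dense_in_real[of \<alpha> "\<alpha> + d"] d(1) by auto
  have "\<bar>g q - g \<alpha>\<bar> < e / 2" "\<bar>g r - g \<alpha>\<bar> < e / 2" using d(2)[of q] d(2)[of r] q r d(1) by auto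
  then have gq: "g q < g \<alpha> + e / 2" and gr: "g \<alpha> - e / 2 < g r" by linarith+
  have "eventually (\<lambda>t. f q t < g \<alpha> + e) G"
    by (rule order_tendstoD(2)[OF rat[OF q(1)]]) (use q gq e in auto)
  moreover have "eventually (\<lambda>t. g \<alpha> - e < f r t) G"
    by (rule order_tendstoD(1)[OF rat[OF r(1)]]) (use r gr e \<alpha> in auto)
  moreover have "eventually (\<lambda>t. f \<alpha> t \<le> f q t) G" by (rule mono) (use q in auto)
  moreover have "eventually (\<lambda>t. f r t \<le> f \<alpha> t) G" by (rule mono) (use r \<alpha> in auto)
  ultimately show "eventually (\<lambda>t. dist (f \<alpha> t) (g \<alpha>) < e) G"
    by eventually_elim (auto simp: dist_real_def abs_less_iff)
qed

context switched_path
begin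

abbreviation down_time :: "real \<Rightarrow> real" where "down_time t \<equiv> LBINT s:{0..t}. J s"

text \<open>The law of the content at a uniformly chosen instant of the down periods before time
  \<open>t\<close>. Cutting the path off outside \<open>{0..t}\<close>, where the density vanishes, makes the map
  measurable.\<close>

definition down_occupation :: "real \<Rightarrow> real \<Rightarrow> real measure" where
  "down_occupation w t = distr (density lborel (\<lambda>s. ennreal (indicator {0..t} s * J s / down_time t))) borel
     (\<lambda>s. indicator {0..t} s * reflected w X s)"

lemma down_occupation_Laplace:
  assumes t: "0 < down_time t"
  shows "real_distribution (down_occupation w t)"
    and "AE x in down_occupation w t. 0 \<le> x"
    and "0 \<le> a \<Longrightarrow> (\<integral>x. exp (- a * x) \<partial>down_occupation w t) = down_integral w a t / down_time t"
proof -
  let ?h = "\<lambda>s. indicator {0..t} s * J s / down_time t"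
  let ?v = "\<lambda>s. indicator {0..t} s * reflected w X s"
  have hm[measurable]: "?h \<in> borel_measurable lborel" and vm[measurable]: "?v \<in> borel_measurable borel"
    using right_cont_measurable[OF J_right_cont, of t] right_cont_measurable[OF reflected_right_cont, of t w]
    by (simp_all add: set_borel_measurable_def)
  have h0: "0 \<le> ?h s" for s using J_bounds[of s] t by (auto simp: indicator_def)
  have hi: "integrable lborel ?h" using integrable_J[of t] by (simp add: set_integrable_def)
  have one: "(\<integral>s. ?h s \<partial>lborel) = 1"
  proof -
    have "(\<integral>s. ?h s \<partial>lborel) = down_time t / down_time t"
      unfolding set_lebesgue_integral_def real_scaleR_def by (rule integral_divide_zero)
    then show ?thesis using t by simp
  qed
  have P: "prob_space (density lborel (\<lambda>s. ennreal (?h s)))"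
  proof (rule prob_spaceI)
    have "emeasure (density lborel (\<lambda>s. ennreal (?h s))) UNIV = (\<integral>\<^sup>+s. ennreal (?h s) \<partial>lborel)"
      by (subst emeasure_density) auto
    also have "\<dots> = ennreal (\<integral>s. ?h s \<partial>lborel)" by (rule nn_integral_eq_integral[OF hi]) (use h0 in auto)
    finally show "emeasure (density lborel (\<lambda>s. ennreal (?h s)))
        (space (density lborel (\<lambda>s. ennreal (?h s)))) = 1"
      by (simp only: one space_density space_lborel space_borel ennreal_1)
  qed
  interpret D: prob_space "density lborel (\<lambda>s. ennreal (?h s))" by (rule P)
  have "prob_space (down_occupation w t)" unfolding down_occupation_def by (rule D.prob_space_distr) simp
  then show "real_distribution (down_occupation w t)"
    unfolding real_distribution_def real_distribution_axioms_def by (simp add: down_occupation_def)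
  have "AE s in density lborel (\<lambda>s. ennreal (?h s)). 0 \<le> ?v s"
    using reflected_X_nonneg[of _ w] by (intro AE_I2) (auto simp: indicator_def)
  then show "AE x in down_occupation w t. 0 \<le> x"
    unfolding down_occupation_def by (subst AE_distr_iff) auto
  show "(\<integral>x. exp (- a * x) \<partial>down_occupation w t) = down_integral w a t / down_time t" if "0 \<le> a"
  proof -
    have "(\<integral>x. exp (- a * x) \<partial>down_occupation w t) = (\<integral>s. ?h s * exp (- a * ?v s) \<partial>lborel)"
      unfolding down_occupation_def
      by (subst integral_distr, simp, simp, subst integral_density) (use h0 in auto)
    also have "\<dots> = (\<integral>s. indicator {0..t} s * (exp (- a * reflected w X s) * J s) / down_time t \<partial>lborel)"
      by (rule Bochner_Integration.integral_cong) (auto simp: indicator_def)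
    also have "\<dots> = down_integral w a t / down_time t"
      unfolding set_lebesgue_integral_def real_scaleR_def by (rule integral_divide_zero)
    finally show ?thesis .
  qed
qed

lemma down_transform_realized:
  assumes pos: "eventually (\<lambda>t. 0 < down_time t) at_top"
    and A: "\<And>\<alpha>. \<alpha> \<in> A \<Longrightarrow> 0 < \<alpha>"
    and lim: "\<And>\<alpha>. \<alpha> \<in> A \<Longrightarrow> ((\<lambda>t. down_integral w \<alpha> t / down_time t) \<longlongrightarrow> g \<alpha>) at_top"
    and seq: "\<And>j::nat. z j \<in> A" "(\<lambda>j. g (z j)) \<longlonglongrightarrow> 1"
  shows "\<exists>Q. real_distribution Q \<and> (\<forall>\<alpha>\<in>A. (\<integral>x. exp (- \<alpha> * max 0 x) \<partial>Q) = g \<alpha>)"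
proof -
  obtain t0 where t0: "\<And>t. t \<ge> t0 \<Longrightarrow> 0 < down_time t" using pos by (auto simp: eventually_at_top_linorder)
  have p: "0 < down_time (t0 + real n)" for n by (rule t0) simp
  have "filterlim (\<lambda>n. t0 + real n) at_top sequentially"
    by (rule filterlim_tendsto_add_at_top[OF tendsto_const filterlim_real_sequentially])
  note l = filterlim_compose[OF lim this]
  show ?thesis
    by (rule Laplace_limit_is_transform[of
        "\<lambda>n. down_occupation w (t0 + real n)", OF down_occupation_Laplace(1)[OF p]
        down_occupation_Laplace(2)[OF p] A _ seq])
       (use l down_occupation_Laplace(3)[OF p] A in \<open>auto simp: less_imp_le\<close>)
qed

end

section \<open>The limiting content of the down periods\<close>

text \<open>Lets an almost sure statement about numbers that do not depend on the sample point be
  read off one point.\<close>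

lemma (in prob_space) AE_imp_ex: "(AE x in M. P x) \<Longrightarrow> \<exists>x. P x"
  using AE_False by (metis (mono_tags, lifting) eventually_mono)

lemma filterlim_real_square: "filterlim (\<lambda>n::nat. real (n\<^sup>2)) at_top sequentially"
  unfolding of_nat_power by (rule filterlim_pow_at_top[OF _ filterlim_real_sequentially]) simp

lemma filterlim_inverse_Suc: "filterlim (\<lambda>j. 1 / real (Suc j)) (at_right 0) sequentially"
  unfolding filterlim_at using LIMSEQ_inverse_real_of_nat by (simp add: inverse_eq_divide)

context updown_storage
begin

text \<open>Only countably many parameters are needed at once: \<open>\<alpha>\<close> itself and a sequence decreasing
  to zero, which determines the rate of the regulator. That rate then determines the time
  average of \<open>exp (- \<alpha> * W) * J\<close> through the balance.\<close>

lemma down_transform_ergodic: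
  assumes \<phi>_pos: "\<And>\<alpha>. 0 < \<alpha> \<Longrightarrow> 0 < \<phi> \<alpha>" and \<eta>_nonneg: "\<And>\<alpha>. 0 < \<alpha> \<Longrightarrow> 0 \<le> \<eta> \<alpha>"
    and \<phi>_lim: "((\<lambda>\<alpha>. \<phi> \<alpha> / \<alpha>) \<longlongrightarrow> \<phi>') (at_right 0)" and \<eta>_lim: "((\<lambda>\<alpha>. \<eta> \<alpha> / \<alpha>) \<longlongrightarrow> \<eta>') (at_right 0)"
    and E_lim: "(E \<longlongrightarrow> 1) (at_right 0)"
    and B_lim: "\<And>\<alpha>. 0 < \<alpha> \<Longrightarrow> AE \<omega> in M. ((\<lambda>t. (1 / t) * (LBINT s:{0..t}. exp (- \<alpha> * W s \<omega>))) \<longlongrightarrow> E \<alpha>) at_top"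
    and J_lim: "AE \<omega> in M. ((\<lambda>t. (1 / t) * down_total t \<omega>) \<longlongrightarrow> p) at_top"
    and \<alpha>: "0 < \<alpha>"
  shows "AE \<omega> in M. ((\<lambda>t. down_work \<alpha> t \<omega> / t) \<longlongrightarrow>
    (\<phi> \<alpha> * E \<alpha> - \<alpha> * (\<phi>' - (\<phi>' + \<eta>') * p)) / (\<phi> \<alpha> + \<eta> \<alpha>)) at_top"
proof -
  (* one parameter of interest and a sequence of parameters decreasing to zero *)
  define A where "A = insert \<alpha> (range (\<lambda>j. 1 / real (Suc j)))"
  have Ac: "countable A" by (simp add: A_def)
  have Apos: "0 < \<beta>" if "\<beta> \<in> A" for \<beta> using that \<alpha> by (auto simp: A_def)
  have "AE \<omega> in M. \<forall>\<beta>\<in>A. (\<lambda>n. (exp (- \<beta> * W (real (n\<^sup>2)) \<omega>) - exp (- \<beta> * W0 \<omega>) + \<beta> * L (real (n\<^sup>2)) \<omega>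
     - (\<phi> \<beta> * (LBINT s:{0..real (n\<^sup>2)}. exp (- \<beta> * W s \<omega>) * (1 - J s \<omega>))
        - \<eta> \<beta> * down_work \<beta> (real (n\<^sup>2)) \<omega>)) / (real n)\<^sup>2) \<longlonglongrightarrow> 0"
    by (subst AE_ball_countable[OF Ac]) (use Kella_Whitt_ergodic Apos in \<open>auto intro: less_imp_le\<close>)
  moreover have "AE \<omega> in M. \<forall>\<beta>\<in>A. ((\<lambda>t. (1 / t) * (LBINT s:{0..t}. exp (- \<beta> * W s \<omega>))) \<longlongrightarrow> E \<beta>) at_top"
    by (subst AE_ball_countable[OF Ac]) (use B_lim Apos in blast)
  ultimately show ?thesis using J_lim AE_switched_path
  proof eventually_elim
    case (elim \<omega>)
    then have w: "0 \<le> W0 \<omega>" by blast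
    from elim interpret switched_path "change_times \<omega>" "\<lambda>t. J t \<omega>" "\<lambda>t. Xu t \<omega>" "\<lambda>t. Xd t \<omega>" "\<lambda>t. X t \<omega>"
        by blast
    define I where "I \<beta> t = down_work \<beta> t \<omega>" for \<beta> t
    define B where "B \<beta> t = (LBINT s:{0..t}. exp (- \<beta> * W s \<omega>))" for \<beta> t
    define a where "a t = down_total t \<omega>" for t
    have up: "(LBINT s:{0..t}. exp (- \<beta> * W s \<omega>) * (1 - J s \<omega>)) = B \<beta> t - I \<beta> t" if "\<beta> \<in> A" for \<beta> t
      using integral_up[of \<beta> t "W0 \<omega>"] Apos[OF that] unfolding I_def B_def W_def by simp
    have sq: "(real n)\<^sup>2 = real (n\<^sup>2)" for n by simp
    have KW: "(\<lambda>n. \<beta> * (L (real (n\<^sup>2)) \<omega> / real (n\<^sup>2))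
        - (\<phi> \<beta> * (B \<beta> (real (n\<^sup>2)) / real (n\<^sup>2) - I \<beta> (real (n\<^sup>2)) / real (n\<^sup>2)) - \<eta> \<beta>
        * (I \<beta> (real (n\<^sup>2)) / real (n\<^sup>2)))) \<longlonglongrightarrow> 0"
      if \<beta>: "\<beta> \<in> A" for \<beta>
    proof -
      have normalise: "(d + \<beta> * l - (f * (b - i) - h * i)) / N - d / N
          = \<beta> * (l / N) - (f * (b / N - i / N) - h * (i / N))"
        for d l f b i h N :: real
        by (simp add: diff_divide_distrib add_divide_distrib algebra_simps)
      let ?d = "\<lambda>n. exp (- \<beta> * W (real (n\<^sup>2)) \<omega>) - exp (- \<beta> * W0 \<omega>)"
      have b0: "0 \<le> \<beta>" using Apos[OF \<beta>] by simp
      have d: "(\<lambda>n. ?d n / real (n\<^sup>2)) \<longlonglongrightarrow> 0"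
      proof (rule Lim_null_comparison)
        have inv: "(\<lambda>n. 1 / real (n\<^sup>2)) \<longlonglongrightarrow> 0"
          by (rule real_tendsto_divide_at_top[OF tendsto_const filterlim_real_square])
        then show "(\<lambda>n. 1 / real (n\<^sup>2)) \<longlonglongrightarrow> 0" .
        have "\<bar>?d n\<bar> \<le> 1" for n
        proof -
          have "0 < exp (- \<beta> * W0 \<omega>)" "exp (- \<beta> * W0 \<omega>) \<le> 1" using w b0 by (auto simp: mult_nonneg_nonneg)
          moreover have "0 < exp (- \<beta> * W (real (n\<^sup>2)) \<omega>)" "exp (- \<beta> * W (real (n\<^sup>2)) \<omega>) \<le> 1"
            unfolding W_def by (rule exp_reflected_bounds[OF of_nat_0_le_iff b0])+
          ultimately show ?thesis by linarith
        qed
        then show "eventually (\<lambda>n. norm (?d n / real (n\<^sup>2)) \<le> 1 / real (n\<^sup>2)) sequentially"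
          by (intro always_eventually allI) (simp add: divide_right_mono)
      qed
      have "(\<lambda>n. (?d n + \<beta> * L (real (n\<^sup>2)) \<omega>
         - (\<phi> \<beta> * (B \<beta> (real (n\<^sup>2)) - I \<beta> (real (n\<^sup>2))) - \<eta> \<beta> * I \<beta> (real (n\<^sup>2)))) / real (n\<^sup>2)) \<longlonglongrightarrow> 0"
        using elim(1)[rule_format, OF \<beta>] unfolding up[OF \<beta>] sq I_def[symmetric] .
      from tendsto_diff[OF this d] show ?thesis unfolding normalise diff_zero .
    qed
    have Bl: "(\<lambda>n. B \<beta> (real (n\<^sup>2)) / real (n\<^sup>2)) \<longlonglongrightarrow> E \<beta>" if "\<beta> \<in> A" for \<beta>
      using filterlim_compose[OF elim(2)[rule_format, OF that] filterlim_real_square] unfolding B_def by simp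
    have al: "(\<lambda>n. a (real (n\<^sup>2)) / real (n\<^sup>2)) \<longlonglongrightarrow> p"
      using filterlim_compose[OF elim(3) filterlim_real_square] unfolding a_def by simp
    have l: "(\<lambda>n. L (real (n\<^sup>2)) \<omega> / real (n\<^sup>2)) \<longlonglongrightarrow> \<phi>' - (\<phi>' + \<eta>') * p"
    proof (rule regulator_rate_squeeze[where A=A
        and x="\<lambda>j. 1 / real (Suc j)", OF KW Bl al _ _ _ _ filterlim_inverse_Suc \<phi>_lim \<eta>_lim E_lim])
      fix \<beta> assume \<beta>: "\<beta> \<in> A"
      then have b0: "0 \<le> \<beta>" using Apos[OF \<beta>] by simp
      show "I \<beta> (real (n\<^sup>2)) / real (n\<^sup>2) \<le> a (real (n\<^sup>2)) / real (n\<^sup>2)" for n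
        unfolding I_def a_def W_def by (intro divide_right_mono down_integral_le_down_time b0) simp
      show "eventually (\<lambda>n. a (real (n\<^sup>2)) / real (n\<^sup>2) - (1 - B \<beta> (real (n\<^sup>2)) / real (n\<^sup>2))
          \<le> I \<beta> (real (n\<^sup>2)) / real (n\<^sup>2)) sequentially"
        using eventually_gt_at_top[of 0]
      proof eventually_elim
        case (elim n)
        have "(a (real (n\<^sup>2)) - (real (n\<^sup>2) - B \<beta> (real (n\<^sup>2)))) / real (n\<^sup>2) \<le> I \<beta> (real (n\<^sup>2)) / real (n\<^sup>2)"
          unfolding I_def a_def B_def W_def by (intro divide_right_mono down_time_le b0) simp_all
        then show ?case using elim by (simp add: diff_divide_distrib)
      qed
      show "0 < \<beta> \<and> 0 \<le> \<phi> \<beta> + \<eta> \<beta>" using Apos[OF \<beta>] \<phi>_pos[of \<beta>] \<eta>_nonneg[of \<beta>] by simp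
    qed (auto simp: A_def)
    have "(\<lambda>n. I \<alpha> (real (n\<^sup>2)) / real (n\<^sup>2)) \<longlonglongrightarrow> (\<phi> \<alpha> * E \<alpha> - \<alpha> * (\<phi>' - (\<phi>' + \<eta>') * p)) / (\<phi> \<alpha> + \<eta> \<alpha>)"
      by (rule down_transform_limit[OF KW Bl l]) (use \<phi>_pos[OF \<alpha>] \<eta>_nonneg[OF \<alpha>] in \<open>auto simp: A_def\<close>)
    then have sqlim: "(\<lambda>n. I \<alpha> (real (n\<^sup>2)) / (real n)\<^sup>2)
        \<longlonglongrightarrow> (\<phi> \<alpha> * E \<alpha> - \<alpha> * (\<phi>' - (\<phi>' + \<eta>') * p)) / (\<phi> \<alpha> + \<eta> \<alpha>)"
      by (simp only: of_nat_power)
    have "((\<lambda>t. I \<alpha> t / t) \<longlongrightarrow> (\<phi> \<alpha> * E \<alpha> - \<alpha> * (\<phi>' - (\<phi>' + \<eta>') * p)) / (\<phi> \<alpha> + \<eta> \<alpha>)) at_top"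
      by (rule tendsto_interpolate_squares[OF _ _ sqlim])
         (use down_integral_mono_time down_integral_nonneg \<alpha> in \<open>auto simp: I_def W_def\<close>)
    then show ?case unfolding I_def .
  qed
qed

text \<open>A single good path produces the law \<open>Q\<close>, since the limits \<open>G\<close> are deterministic.
  Convergence for all parameters outside one null set follows from the rational ones by
  monotonicity.\<close>

lemma down_workload_exists:
  assumes p: "0 < p" and G: "\<And>\<alpha>. 0 < \<alpha> \<Longrightarrow>
      AE \<omega> in M. ((\<lambda>t. down_work \<alpha> t \<omega> / t) \<longlongrightarrow> G \<alpha>) at_top"
    and G0: "(G \<longlongrightarrow> p) (at_right 0)"
    and J_lim: "AE \<omega> in M. ((\<lambda>t. (1 / t) * down_total t \<omega>) \<longlongrightarrow> p) at_top"
  shows "\<exists>(Q :: real measure) Wd. prob_space Q \<and> Wd \<in> borel_measurable Q \<and> (\<forall>x. 0 \<le> (Wd x :: real)) \<and>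
    (AE \<omega> in M. \<forall>\<alpha>\<ge>0. ((\<lambda>t. down_work \<alpha> t \<omega> / down_total t \<omega>)
       \<longlongrightarrow> (\<integral>x. exp (- \<alpha> * Wd x) \<partial>Q)) at_top) \<and>
    (\<forall>\<alpha>>0. (\<integral>x. exp (- \<alpha> * Wd x) \<partial>Q) = G \<alpha> / p)"
proof -
  let ?r = "\<lambda>\<omega> \<alpha> t. down_work \<alpha> t \<omega> / down_total t \<omega>"
  let ?A = "{q \<in> \<rat>. 0 < q} :: real set"
  have Ac: "countable ?A" by (rule countable_subset[OF _ countable_rat]) auto
  have J_lim': "AE \<omega> in M. ((\<lambda>t. down_total t \<omega> / t) \<longlongrightarrow> p) at_top" using J_lim by simp
  have pos: "AE \<omega> in M. eventually (\<lambda>t. 0 < down_total t \<omega>) at_top"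
    using J_lim'
  proof eventually_elim
    case (elim \<omega>)
    have "eventually (\<lambda>t. 0 < down_total t \<omega> / t) at_top" by (rule order_tendstoD(1)[OF elim p])
    then show ?case using eventually_gt_at_top[of 0] by eventually_elim (simp add: zero_less_divide_iff)
  qed
  have ratio: "AE \<omega> in M. (?r \<omega> \<alpha> \<longlongrightarrow> G \<alpha> / p) at_top" if "0 < \<alpha>" for \<alpha>
    using G[OF that] J_lim'
  proof eventually_elim
    case (elim \<omega>)
    have "((\<lambda>t. (down_work \<alpha> t \<omega> / t) / (down_total t \<omega> / t)) \<longlongrightarrow> G \<alpha> / p) at_top"
      using p by (intro tendsto_divide elim) simp
    moreover have "eventually (\<lambda>t. (down_work \<alpha> t \<omega> / t) / (down_total t \<omega> / t) = ?r \<omega> \<alpha> t) at_top"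
      using eventually_gt_at_top[of 0] by eventually_elim simp
    ultimately show ?case by (rule Lim_transform_eventually)
  qed
  have rational: "AE \<omega> in M. \<forall>q\<in>?A. (?r \<omega> q \<longlongrightarrow> G q / p) at_top"
    by (subst AE_ball_countable[OF Ac]) (use ratio in blast)
  have "\<exists>\<omega>. (\<forall>q\<in>?A. (?r \<omega> q \<longlongrightarrow> G q / p) at_top) \<and> eventually (\<lambda>t. 0 < down_total t \<omega>) at_top \<and>
      good_path \<omega>"
    by (rule AE_imp_ex) (use rational pos AE_switched_path in eventually_elim, blast)
  then obtain \<omega> where \<omega>: "\<And>q. q \<in> ?A \<Longrightarrow> (?r \<omega> q \<longlongrightarrow> G q / p) at_top"
      "eventually (\<lambda>t. 0 < down_total t \<omega>) at_top"
    and sp: "good_path \<omega>" by blast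
  have "((\<lambda>\<alpha>. G \<alpha> / p) \<longlongrightarrow> p / p) (at_right 0)" by (intro tendsto_divide G0 tendsto_const) (use p in simp)
  then have z: "(\<lambda>j. G (1 / real (Suc j)) / p) \<longlonglongrightarrow> 1"
    using filterlim_compose[OF _ filterlim_inverse_Suc] p by simp
  have zA: "1 / real (Suc j) \<in> ?A" for j
    by (auto intro!: Rats_divide simp del: of_nat_Suc)
  obtain Q where Q: "real_distribution Q" "\<And>\<alpha>. \<alpha> \<in> ?A \<Longrightarrow> (\<integral>x. exp (- \<alpha> * max 0 x) \<partial>Q) = G \<alpha> / p"
    using switched_path.down_transform_realized[OF sp \<omega>(2) _ \<omega>(1)[unfolded W_def] zA z] by blast
  interpret Q: real_distribution Q by (rule Q(1))
  define Wd where "Wd x = max 0 x" for x :: real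
  let ?g = "\<lambda>\<alpha>. \<integral>x. exp (- \<alpha> * Wd x) \<partial>Q"
  have Wd: "Wd \<in> borel_measurable Q" "\<And>x. 0 \<le> Wd x" unfolding Wd_def[abs_def] by auto
  have cont: "isCont ?g \<alpha>" if "0 < \<alpha>" for \<alpha>
    by (rule Laplace_transform_continuous[OF Q.prob_space_axioms Wd(1) Wd(2) that])
  have all: "AE \<omega> in M. \<forall>\<alpha>\<ge>0. (?r \<omega> \<alpha> \<longlongrightarrow> ?g \<alpha>) at_top"
    using rational pos AE_switched_path
  proof eventually_elim
    case (elim \<omega>)
    from elim interpret switched_path "change_times \<omega>" "\<lambda>t. J t \<omega>" "\<lambda>t. Xu t \<omega>" "\<lambda>t. Xd t \<omega>" "\<lambda>t. X t \<omega>"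
        by blast
    show ?case
    proof (intro allI impI)
      fix \<alpha> :: real assume "0 \<le> \<alpha>"
      show "(?r \<omega> \<alpha> \<longlongrightarrow> ?g \<alpha>) at_top"
      proof (cases "\<alpha> = 0")
        case True
        have "eventually (\<lambda>t. 1 = ?r \<omega> 0 t) at_top" using elim(2) by eventually_elim simp
        then have "(?r \<omega> 0 \<longlongrightarrow> 1) at_top" by (rule Lim_transform_eventually[OF tendsto_const])
        then show ?thesis using True Q.prob_space by simp
      next
        case False
        then have a: "0 < \<alpha>" using \<open>0 \<le> \<alpha>\<close> by simp
        show ?thesis
        proof (rule antimono_family_tendsto[OF _ _ cont[OF a] a])
          fix \<beta> \<gamma> :: real assume bg: "0 < \<beta>" "\<beta> \<le> \<gamma>"
          show "eventually (\<lambda>t. ?r \<omega> \<gamma> t \<le> ?r \<omega> \<beta> t) at_top"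
            using elim(2)
          proof eventually_elim
            case (elim t)
            show ?case unfolding W_def
              by (intro divide_right_mono down_integral_antimono) (use bg elim in auto)
          qed
        next
          fix q :: real assume "q \<in> \<rat>" "0 < q"
          then show "(?r \<omega> q \<longlongrightarrow> ?g q) at_top" using elim(1) Q(2)[of q] unfolding Wd_def by simp
        qed
      qed
    qed
  qed
  have "?g \<alpha> = G \<alpha> / p" if "0 < \<alpha>" for \<alpha>
  proof -
    have "\<exists>\<omega>. (?r \<omega> \<alpha> \<longlongrightarrow> ?g \<alpha>) at_top \<and> (?r \<omega> \<alpha> \<longlongrightarrow> G \<alpha> / p) at_top"
    proof (rule AE_imp_ex)
      show "AE \<omega> in M. (?r \<omega> \<alpha> \<longlongrightarrow> ?g \<alpha>) at_top \<and> (?r \<omega> \<alpha> \<longlongrightarrow> G \<alpha> / p) at_top"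
        using all ratio[OF that] by eventually_elim (use that in auto)
    qed
    then show ?thesis using tendsto_unique[OF trivial_limit_at_top_linorder] by blast
  qed
  then show ?thesis using Q.prob_space_axioms Wd all by blast
qed

end

section \<open>Laplace exponents at the origin\<close>

lemma right_deriv_eqI: "(f has_real_derivative D) (at_right x) \<Longrightarrow> right_deriv f x = D"
  unfolding right_deriv_def
  by (rule the_equality) (auto simp: has_field_derivative_iff intro:
      tendsto_unique[OF trivial_limit_at_right_real])

lemma eventually_at_right_0_less_1: "eventually (\<lambda>\<alpha>::real. 0 < \<alpha> \<and> \<alpha> < 1) (at_right 0)"
  by (auto simp: eventually_at_right_field intro!: exI[of _ 1])

text \<open>The lower bound is \<open>1 + x \<le> exp x\<close>; the upper one is convexity, by which the chord of
  \<open>exp (- a * y)\<close> as a function of \<open>a\<close> is steepest over the whole interval up to one. The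
  bound does not depend on \<open>a\<close>.\<close>

lemma exp_neg_difference_quotient_bound:
  fixes y a :: real assumes a: "0 < a" "a \<le> 1"
  shows "\<bar>(exp (- a * y) - 1) / a\<bar> \<le> \<bar>y\<bar> + exp (- y)"
proof -
  have lo: "- \<bar>y\<bar> \<le> (exp (- a * y) - 1) / a"
  proof -
    have "- a * y \<le> exp (- a * y) - 1" using exp_ge_add_one_self[of "- a * y"] by simp
    moreover have "- (a * \<bar>y\<bar>) \<le> - a * y" using a by simp
    ultimately have "- \<bar>y\<bar> * a \<le> exp (- a * y) - 1" by (simp add: mult.commute)
    then show ?thesis using a by (simp add: pos_le_divide_eq)
  qed
  have "exp ((1 - a) *\<^sub>R 0 + a *\<^sub>R (- y)) \<le> (1 - a) * exp 0 + a * exp (- y)"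
    by (rule convex_onD[OF exp_convex]) (use a in auto)
  then have "exp (- a * y) - 1 \<le> a * (exp (- y) - 1)" by (simp add: algebra_simps)
  also have "\<dots> \<le> a * exp (- y)" using a by simp
  finally have hi: "(exp (- a * y) - 1) / a \<le> exp (- y)" using a by (simp add: pos_divide_le_eq mult.commute)
  show ?thesis using lo hi exp_gt_zero[of "- y"] by linarith
qed

context prob_space
begin

lemma Laplace_right_derivative:
  assumes Y: "integrable M Y" and e: "\<And>\<alpha>. 0 \<le> \<alpha> \<Longrightarrow> integrable M (\<lambda>\<omega>. exp (- \<alpha> * Y \<omega>))"
  shows "((\<lambda>\<alpha>. expectation (\<lambda>\<omega>. exp (- \<alpha> * Y \<omega>))) has_real_derivative - expectation Y) (at_right 0)"
proof -
  have [measurable]: "Y \<in> borel_measurable M" using Y by simp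
  note small = eventually_at_right_0_less_1
  have quot: "((\<lambda>\<alpha>. \<integral>\<omega>. (exp (- \<alpha> * Y \<omega>) - 1) / \<alpha> \<partial>M) \<longlongrightarrow> (\<integral>\<omega>. - Y \<omega> \<partial>M)) (at_right 0)"
  proof (rule integral_tendsto_dominated)
    show "integrable M (\<lambda>\<omega>. \<bar>Y \<omega>\<bar> + exp (- Y \<omega>))" using Y e[of 1] by simp
    show "((\<lambda>\<alpha>. (exp (- \<alpha> * Y \<omega>) - 1) / \<alpha>) \<longlongrightarrow> - Y \<omega>) (at_right 0)" for \<omega>
    proof -
      have "((\<lambda>\<alpha>. exp (- \<alpha> * Y \<omega>)) has_real_derivative - Y \<omega>) (at_right 0)"
        by (auto intro!: derivative_eq_intros)
      then show ?thesis by (simp add: has_field_derivative_iff)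
    qed
    show "eventually (\<lambda>\<alpha>. \<forall>\<omega>\<in>space M. \<bar>(exp (- \<alpha> * Y \<omega>) - 1) / \<alpha>\<bar> \<le> \<bar>Y \<omega>\<bar> + exp (- Y \<omega>)) (at_right 0)"
      using small by eventually_elim (intro ballI exp_neg_difference_quotient_bound, auto)
  qed auto
  have eq: "eventually (\<lambda>\<alpha>. (\<integral>\<omega>. (exp (- \<alpha> * Y \<omega>) - 1) / \<alpha> \<partial>M) =
      (expectation (\<lambda>\<omega>. exp (- \<alpha> * Y \<omega>)) - expectation (\<lambda>\<omega>. exp (- 0 * Y \<omega>))) / (\<alpha> - 0)) (at_right 0)"
    using small by eventually_elim (use e prob_space in simp)
  show ?thesis unfolding has_field_derivative_iff
    by (rule Lim_transform_eventually[OF quot[unfolded Bochner_Integration.integral_minus] eq])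
qed

text \<open>Differentiation under the integral sign at zero, dominated by means of the first moment
  and the exponential moment at \<open>1\<close>; the chain rule for the logarithm then gives the exponent.\<close>

lemma Laplace_exponent_right_derivative:
  assumes Y: "integrable M Y" and eall: "\<And>\<alpha>. 0 \<le> \<alpha> \<Longrightarrow> integrable M (\<lambda>\<omega>. exp (- \<alpha> * Y \<omega>))"
    and \<psi>: "\<And>\<alpha>. 0 \<le> \<alpha> \<Longrightarrow> expectation (\<lambda>\<omega>. exp (- \<alpha> * Y \<omega>)) = exp (\<psi> \<alpha>)"
  shows "\<psi> 0 = 0" and "(\<psi> has_real_derivative - expectation Y) (at_right 0)"
    and "((\<lambda>\<alpha>. \<psi> \<alpha> / \<alpha>) \<longlongrightarrow> - expectation Y) (at_right 0)"
proof -
  show 0: "\<psi> 0 = 0" using \<psi>[of 0] prob_space by simp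
  have d: "((\<lambda>\<alpha>. expectation (\<lambda>\<omega>. exp (- \<alpha> * Y \<omega>))) has_real_derivative - expectation Y) (at_right 0)"
    by (rule Laplace_right_derivative[OF Y eall])
  have dln: "((\<lambda>\<alpha>. ln (expectation (\<lambda>\<omega>. exp (- \<alpha> * Y \<omega>)))) has_real_derivative - expectation Y) (at_right 0)"
    using DERIV_chain2[OF DERIV_ln_divide[of "expectation (\<lambda>\<omega>. exp (- 0 * Y \<omega>))"] d] prob_space by simp
  show "(\<psi> has_real_derivative - expectation Y) (at_right 0)"
  proof -
    have "eventually (\<lambda>\<alpha>. (ln (expectation (\<lambda>\<omega>. exp (- \<alpha> * Y \<omega>))) - ln (expectation (\<lambda>\<omega>. exp (- 0 * Y \<omega>))))
        / (\<alpha> - 0)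
        = (\<psi> \<alpha> - \<psi> 0) / (\<alpha> - 0)) (at_right 0)"
      using eventually_at_right_less[of "0::real"]
    proof eventually_elim
      case (elim \<alpha>)
      then show ?case using \<psi>[of \<alpha>] \<psi>[of 0] by simp
    qed
    then show ?thesis using dln unfolding has_field_derivative_iff by (rule Lim_transform_eventually[rotated])
  qed
  then show "((\<lambda>\<alpha>. \<psi> \<alpha> / \<alpha>) \<longlongrightarrow> - expectation Y) (at_right 0)"
    by (simp add: has_field_derivative_iff 0)
qed

lemma Laplace_transform_at_zero:
  fixes Y :: "'a \<Rightarrow> real"
  assumes Y[measurable]: "Y \<in> borel_measurable M" and e: "integrable M (\<lambda>\<omega>. exp (- Y \<omega>))"
  shows "((\<lambda>\<alpha>. expectation (\<lambda>\<omega>. exp (- \<alpha> * Y \<omega>))) \<longlongrightarrow> 1) (at_right 0)"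
proof -
  have "((\<lambda>\<alpha>. expectation (\<lambda>\<omega>. exp (- \<alpha> * Y \<omega>))) \<longlongrightarrow> expectation (\<lambda>\<omega>. exp (- 0 * Y \<omega>))) (at_right 0)"
  proof (rule integral_tendsto_dominated)
    show "integrable M (\<lambda>\<omega>. 1 + exp (- Y \<omega>))" using e by simp
    show "eventually (\<lambda>\<alpha>. \<forall>\<omega>\<in>space M. \<bar>exp (- \<alpha> * Y \<omega>)\<bar> \<le> 1 + exp (- Y \<omega>)) (at_right 0)"
      using eventually_at_right_0_less_1
    proof eventually_elim
      case (elim \<alpha>)
      have "exp (- \<alpha> * y) \<le> 1 + exp (- y)" for y :: real
      proof (cases "0 \<le> y")
        case True
        then have "exp (- \<alpha> * y) \<le> 1" using elim by simp
        then show ?thesis using exp_gt_zero[of "- y"] by linarith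
      next
        case False
        then have "\<alpha> * (- y) \<le> 1 * (- y)" using elim by (intro mult_right_mono) auto
        then have "exp (- \<alpha> * y) \<le> exp (- y)" by simp
        then show ?thesis by linarith
      qed
      then show ?case by simp
    qed
    show "((\<lambda>\<alpha>. exp (- \<alpha> * Y \<omega>)) \<longlongrightarrow> exp (- 0 * Y \<omega>)) (at_right 0)" for \<omega> by (intro tendsto_intros)
  qed auto
  then show ?thesis using prob_space by simp
qed

end

section \<open>The decomposition\<close>

text \<open>If \<open>\<eta>' = 0\<close> then also \<open>\<eta> = 0\<close>, the weight \<open>\<eta>' / (\<eta>' + \<phi>')\<close> is zero and the product
  containing the quotient \<open>\<eta> / (\<eta>' * \<alpha>)\<close> vanishes, as it should.\<close>

lemma decomposition_identity:
  fixes \<phi> \<eta> \<phi>' \<eta>' \<alpha> p E D :: real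
  assumes pos: "0 < \<phi>" "0 < \<phi>'" "0 \<le> \<eta>" "0 \<le> \<eta>'" "0 < \<alpha>" and deg: "\<eta>' = 0 \<Longrightarrow> \<eta> = 0"
    and D: "(\<phi> * E - \<alpha> * (\<phi>' - (\<phi>' + \<eta>') * p)) / (\<phi> + \<eta>) = p * D"
  shows "E = (1 - (1 + \<eta>' / \<phi>') * p) * (\<phi>' * \<alpha> / \<phi>) +
    (1 - (1 - (1 + \<eta>' / \<phi>') * p)) *
      (1 - \<eta>' / (\<eta>' + \<phi>') + \<eta>' / (\<eta>' + \<phi>') * (\<eta> / (\<eta>' * \<alpha>)) * (\<phi>' * \<alpha> / \<phi>)) * D"
proof -
  have s: "0 < \<eta>' + \<phi>'" using pos by simp
  have "\<phi> * E - \<alpha> * (\<phi>' - (\<phi>' + \<eta>') * p) = p * D * (\<phi> + \<eta>)"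
    using D pos by (simp add: divide_eq_eq)
  then have "E = (\<alpha> * (\<phi>' - (\<phi>' + \<eta>') * p) + p * D * (\<phi> + \<eta>)) / \<phi>"
    using pos by (simp add: eq_divide_eq algebra_simps)
  have E: "E = \<alpha> * (\<phi>' - (\<phi>' + \<eta>') * p) / \<phi> + (1 + \<eta> / \<phi>) * (p * D)"
  proof -
    have "p * D * (\<phi> + \<eta>) / \<phi> = (1 + \<eta> / \<phi>) * (p * D)" using pos by (simp add: field_simps)
    with \<open>E = (\<alpha> * (\<phi>' - (\<phi>' + \<eta>') * p) + p * D * (\<phi> + \<eta>)) / \<phi>\<close> show ?thesis by (simp only: add_divide_distrib)
  qed
  have 1: "(1 - (1 + \<eta>' / \<phi>') * p) * (\<phi>' * \<alpha> / \<phi>) = \<alpha> * (\<phi>' - (\<phi>' + \<eta>') * p) / \<phi>"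
    using pos by (simp add: field_simps)
  have mix: "1 - \<eta>' / (\<eta>' + \<phi>') + \<eta>' / (\<eta>' + \<phi>') * (\<eta> / (\<eta>' * \<alpha>)) * (\<phi>' * \<alpha> / \<phi>) = \<phi>' / (\<eta>' + \<phi>') * (1 + \<eta> / \<phi>)"
  proof (cases "\<eta>' = 0")
    case True then show ?thesis using deg pos by simp
  next
    case False
    have "1 - \<eta>' / (\<eta>' + \<phi>') = \<phi>' / (\<eta>' + \<phi>')" using s by (simp add: field_simps)
    moreover have "\<eta>' / (\<eta>' + \<phi>') * (\<eta> / (\<eta>' * \<alpha>)) * (\<phi>' * \<alpha> / \<phi>) = \<phi>' / (\<eta>' + \<phi>') * (\<eta> / \<phi>)"
      using False pos by simp
    ultimately show ?thesis by (simp only: distrib_left mult_1_right)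
  qed
  have c: "(1 + \<eta>' / \<phi>') * (\<phi>' / (\<eta>' + \<phi>')) = 1"
  proof -
    have "1 + \<eta>' / \<phi>' = (\<eta>' + \<phi>') / \<phi>'" using pos by (simp add: field_simps)
    then show ?thesis using pos s by simp
  qed
  have "(1 - (1 - c * p)) * (k * h) * D = (c * k) * (h * (p * D))" for c k h :: real by simp
  from this[of "1 + \<eta>' / \<phi>'" "\<phi>' / (\<eta>' + \<phi>')" "1 + \<eta> / \<phi>"]
  have 2: "(1 - (1 - (1 + \<eta>' / \<phi>') * p)) * (\<phi>' / (\<eta>' + \<phi>') * (1 + \<eta> / \<phi>)) * D = (1 + \<eta> / \<phi>) * (p * D)"
    unfolding c by (simp only: mult_1_left)
  show ?thesis unfolding 1 mix 2 by (rule E)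
qed

context updown_storage
begin

text \<open>The transform of the down content is \<open>G \<alpha> / p\<close> if \<open>p > 0\<close>. If \<open>p = 0\<close>, the bounds
  \<open>0 \<le> G \<alpha> \<le> p\<close> force \<open>G \<alpha> = 0\<close>, so that the same identity holds with any choice of the law
  \<open>Q\<close>.\<close>

lemma ergodic_decomposition:
  fixes E :: "real \<Rightarrow> real" and p :: real
  defines "\<phi>' \<equiv> - expectation (Xu 1)" and "\<eta>' \<equiv> expectation (Xd 1)"
  defines "\<pi>\<^sub>l \<equiv> 1 - (1 + \<eta>' / \<phi>') * p" and "\<pi> \<equiv> \<eta>' / (\<eta>' + \<phi>')"
  assumes Xu1: "integrable M (Xu 1)" "expectation (Xu 1) < 0" and Xd1: "integrable M (Xd 1)"
    and E0: "E 0 = 1" and E_lim: "(E \<longlongrightarrow> 1) (at_right 0)"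
    and B_lim: "\<And>\<alpha>. 0 < \<alpha> \<Longrightarrow> AE \<omega> in M. ((\<lambda>t. (1 / t) * (LBINT s:{0..t}. exp (- \<alpha> * W s \<omega>))) \<longlongrightarrow> E \<alpha>) at_top"
    and J_lim: "AE \<omega> in M. ((\<lambda>t. (1 / t) * down_total t \<omega>) \<longlongrightarrow> p) at_top"
  shows "(\<phi> has_real_derivative \<phi>') (at_right 0)" and "(\<eta> has_real_derivative \<eta>') (at_right 0)"
    and "\<exists>(Q :: real measure) Wd. prob_space Q \<and> Wd \<in> borel_measurable Q \<and> (\<forall>x\<in>space Q. Wd x \<ge> (0 :: real)) \<and>
    (p > 0 \<longrightarrow> (AE \<omega> in M. \<forall>\<alpha>\<ge>0. ((\<lambda>t. down_work \<alpha> t \<omega> / down_total t \<omega>)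
       \<longlongrightarrow> (\<integral>x. exp (- \<alpha> * Wd x) \<partial>Q)) at_top)) \<and>
    (let R = (\<lambda>\<alpha>. \<pi>\<^sub>l * (\<phi>' * \<alpha> / \<phi> \<alpha>) +
       (1 - \<pi>\<^sub>l) * (1 - \<pi> + \<pi> * (\<eta> \<alpha> / (\<eta>' * \<alpha>)) * (\<phi>' * \<alpha> / \<phi> \<alpha>)) * (\<integral>x. exp (- \<alpha> * Wd x) \<partial>Q))
     in (\<forall>\<alpha>>0. E \<alpha> = R \<alpha>) \<and> (R \<longlongrightarrow> E 0) (at_right 0))"
    (is "\<exists>Q Wd. _ \<and> _ \<and> _ \<and> (_ \<longrightarrow> ?conv Q Wd) \<and> (let R = ?R Q Wd in _)")
proof -
  note up_exp = Laplace_exponent_right_derivative[OF Xu1(1) Laplace_u]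
  note down_exp = Laplace_exponent_right_derivative[OF Xd1 Laplace_d]
  show "(\<phi> has_real_derivative \<phi>') (at_right 0)" using up_exp(2) by (simp add: \<phi>'_def)
  show "(\<eta> has_real_derivative \<eta>') (at_right 0)" using DERIV_minus[OF down_exp(2)] by (simp add: \<eta>'_def)
  have \<phi>_lim: "((\<lambda>\<alpha>. \<phi> \<alpha> / \<alpha>) \<longlongrightarrow> \<phi>') (at_right 0)" using up_exp(3) by (simp add: \<phi>'_def)
  have \<eta>_lim: "((\<lambda>\<alpha>. \<eta> \<alpha> / \<alpha>) \<longlongrightarrow> \<eta>') (at_right 0)"
    using tendsto_minus[OF down_exp(3)] by (simp add: \<eta>'_def)
  have \<phi>'_pos: "0 < \<phi>'" using Xu1(2) by (simp add: \<phi>'_def)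
  have \<phi>_pos: "0 < \<phi> \<alpha>" if "0 < \<alpha>" for \<alpha>
  proof -
    (* Jensen's inequality in the form 1 + x \<le> exp x *)
    have "1 < 1 + \<alpha> * \<phi>'" using that \<phi>'_pos by simp
    also have "1 + \<alpha> * \<phi>' = (\<integral>\<omega>. 1 + (- \<alpha>) * Xu 1 \<omega> \<partial>M)"
      using Xu1(1) prob_space by (simp add: \<phi>'_def)
    also have "\<dots> \<le> expectation (\<lambda>\<omega>. exp (- \<alpha> * Xu 1 \<omega>))"
    proof (rule integral_mono)
      show "1 + (- \<alpha>) * Xu 1 \<omega> \<le> exp (- \<alpha> * Xu 1 \<omega>)" for \<omega> by (rule exp_ge_add_one_self)
    qed (use Xu1(1) Laplace_u(1)[of \<alpha>] that in auto)
    also have "\<dots> = exp (\<phi> \<alpha>)" using Laplace_u(2)[of \<alpha>] that by simp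
    finally show ?thesis by simp
  qed
  have Xd_nonneg: "AE \<omega> in M. 0 \<le> Xd 1 \<omega>"
  proof -
    have "AE \<omega> in M. Xd 0 \<omega> = 0" using levy_d unfolding levy_process_def by blast
    with down_mono[unfolded nondecreasing_paths_def] show ?thesis
      by eventually_elim (auto dest: mono_onD[of "{0..}" _ 0 1])
  qed
  have \<eta>'_nonneg: "0 \<le> \<eta>'" unfolding \<eta>'_def by (rule integral_nonneg_AE[OF Xd_nonneg])
  have \<eta>_nonneg: "0 \<le> \<eta> \<alpha>" if "0 < \<alpha>" for \<alpha>
  proof -
    have "expectation (\<lambda>\<omega>. exp (- \<alpha> * Xd 1 \<omega>)) \<le> (\<integral>\<omega>. 1 \<partial>M)"
    proof (rule integral_mono_AE)
      show "AE \<omega> in M. exp (- \<alpha> * Xd 1 \<omega>) \<le> 1"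
        using Xd_nonneg by eventually_elim (use that in simp)
    qed (use Laplace_d(1)[of \<alpha>] that in auto)
    then show ?thesis using Laplace_d(2)[of \<alpha>] that prob_space by simp
  qed
  have degenerate: "\<eta> \<alpha> = 0" if "\<eta>' = 0" "0 < \<alpha>" for \<alpha>
  proof -
    have "AE \<omega> in M. Xd 1 \<omega> = 0"
      using integral_nonneg_eq_0_iff_AE[OF Xd1 Xd_nonneg] that(1) unfolding \<eta>'_def by simp
    then have "AE \<omega> in M. exp (- \<alpha> * Xd 1 \<omega>) = 1" by eventually_elim simp
    then have "expectation (\<lambda>\<omega>. exp (- \<alpha> * Xd 1 \<omega>)) = (\<integral>\<omega>. 1 \<partial>M)"
      by (intro integral_cong_AE) (use down.Y_measurable[of 1] in measurable)
    then show ?thesis using Laplace_d(2)[of \<alpha>] that(2) prob_space by simp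
  qed
  define G where "G \<alpha> = (\<phi> \<alpha> * E \<alpha> - \<alpha> * (\<phi>' - (\<phi>' + \<eta>') * p)) / (\<phi> \<alpha> + \<eta> \<alpha>)" for \<alpha>
  have G: "AE \<omega> in M. ((\<lambda>t. down_work \<alpha> t \<omega> / t) \<longlongrightarrow> G \<alpha>) at_top" if "0 < \<alpha>" for \<alpha>
    unfolding G_def by (rule down_transform_ergodic[OF \<phi>_pos \<eta>_nonneg \<phi>_lim \<eta>_lim E_lim B_lim J_lim that])
  have G0: "(G \<longlongrightarrow> p) (at_right 0)"
  proof -
    have "((\<lambda>\<alpha>. ((\<phi> \<alpha> / \<alpha>) * E \<alpha> - (\<phi>' - (\<phi>' + \<eta>') * p)) / (\<phi> \<alpha> / \<alpha> + \<eta> \<alpha> / \<alpha>)) \<longlongrightarrow>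
        (\<phi>' * 1 - (\<phi>' - (\<phi>' + \<eta>') * p)) / (\<phi>' + \<eta>')) (at_right 0)"
      by (intro tendsto_intros \<phi>_lim \<eta>_lim E_lim) (use \<phi>'_pos \<eta>'_nonneg in simp)
    moreover have "(\<phi>' * 1 - (\<phi>' - (\<phi>' + \<eta>') * p)) / (\<phi>' + \<eta>') = p" using \<phi>'_pos \<eta>'_nonneg by simp
    moreover have "eventually (\<lambda>\<alpha>. ((\<phi> \<alpha> / \<alpha>) * E \<alpha> - (\<phi>' - (\<phi>' + \<eta>') * p)) / (\<phi> \<alpha> / \<alpha> + \<eta> \<alpha> / \<alpha>)
        = G \<alpha>) (at_right 0)"
      using eventually_at_right_less[of "0::real"]
    proof eventually_elim
      case (elim \<alpha>)
      have "((\<phi> \<alpha> / \<alpha>) * E \<alpha> - (\<phi>' - (\<phi>' + \<eta>') * p)) = (\<phi> \<alpha> * E \<alpha> - \<alpha> * (\<phi>' - (\<phi>' + \<eta>') * p)) / \<alpha>"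
        "\<phi> \<alpha> / \<alpha> + \<eta> \<alpha> / \<alpha> = (\<phi> \<alpha> + \<eta> \<alpha>) / \<alpha>"
        using elim by (simp_all add: diff_divide_distrib add_divide_distrib)
      then show ?case unfolding G_def using elim by simp
    qed
    ultimately show ?thesis using Lim_transform_eventually by force
  qed
  have G_bounds: "0 \<le> G \<alpha> \<and> G \<alpha> \<le> p" if a: "0 < \<alpha>" for \<alpha>
  proof -
    have "\<exists>\<omega>::'a. 0 \<le> G \<alpha> \<and> G \<alpha> \<le> p"
    proof (rule AE_imp_ex)
      show "AE \<omega> in M. 0 \<le> G \<alpha> \<and> G \<alpha> \<le> p" using G[OF a] J_lim AE_switched_path
      proof eventually_elim
        case (elim \<omega>)
        from elim interpret switched_path "change_times \<omega>" "\<lambda>t. J t \<omega>" "\<lambda>t. Xu t \<omega>" "\<lambda>t. Xd t \<omega>" "\<lambda>t. X t \<omega>"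
            by blast
        note I = elim(1)[unfolded W_def]
        have pos: "eventually (\<lambda>t::real. 0 < t) at_top" by (rule eventually_gt_at_top)
        have "0 \<le> G \<alpha>"
          by (rule tendsto_lowerbound[OF I eventually_mono[OF pos]]) (use down_integral_nonneg a in auto)
        moreover have "G \<alpha> \<le> p"
          by (rule tendsto_le[OF _ elim(2) I eventually_mono[OF pos]])
             (use down_integral_le_down_time a in \<open>auto intro!: divide_right_mono\<close>)
        ultimately show ?case by blast
      qed
    qed
    then show ?thesis by blast
  qed
  have identity: "let R = ?R Q Wd in (\<forall>\<alpha>>0. E \<alpha> = R \<alpha>) \<and> (R \<longlongrightarrow> E 0) (at_right 0)"
    if D: "\<And>\<alpha>. 0 < \<alpha> \<Longrightarrow> G \<alpha> = p * (\<integral>x. exp (- \<alpha> * Wd x) \<partial>Q)" for Q :: "real measure" and Wd :: "real \<Rightarrow> real"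
  proof -
    have ER: "E \<alpha> = ?R Q Wd \<alpha>" if a: "0 < \<alpha>" for \<alpha>
      unfolding \<pi>\<^sub>l_def \<pi>_def
      by (rule decomposition_identity[OF \<phi>_pos[OF a] \<phi>'_pos \<eta>_nonneg[OF a] \<eta>'_nonneg a degenerate[OF _ a]
          D[OF a, unfolded G_def]])
    have "(?R Q Wd \<longlongrightarrow> 1) (at_right 0)"
      by (rule Lim_transform_eventually[OF E_lim eventually_mono[OF eventually_at_right_less]]) (rule ER)
    then show ?thesis using ER E0 by simp
  qed
  show "\<exists>(Q :: real measure) Wd. prob_space Q \<and> Wd \<in> borel_measurable Q \<and> (\<forall>x\<in>space Q. Wd x \<ge> 0) \<and>
    (p > 0 \<longrightarrow> ?conv Q Wd) \<and> (let R = ?R Q Wd in (\<forall>\<alpha>>0. E \<alpha> = R \<alpha>) \<and> (R \<longlongrightarrow> E 0) (at_right 0))"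
  proof (cases "0 < p")
    case True
    obtain Q and Wd :: "real \<Rightarrow> real" where Q: "prob_space (Q :: real measure)" "Wd \<in> borel_measurable Q"
        "\<forall>x. 0 \<le> Wd x"
      "?conv Q Wd" "\<forall>\<alpha>>0. (\<integral>x. exp (- \<alpha> * Wd x) \<partial>Q) = G \<alpha> / p"
      using down_workload_exists[OF True G G0 J_lim] by blast
    show ?thesis
      by (rule exI[of _ Q], rule exI[of _ Wd], intro conjI impI identity) (use Q True in auto)
  next
    case False
    then have "p = 0" "0 < \<alpha> \<Longrightarrow> G \<alpha> = 0" for \<alpha> using G_bounds[of 1] G_bounds[of \<alpha>] by auto
    moreover have "prob_space (return borel (0 :: real))" by (rule prob_space_return) simp
    ultimately show ?thesis
      by (intro exI[of _ "return borel 0"] exI[of _ "\<lambda>_. 0"] conjI impI identity) auto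
  qed
qed

end

theorem theorem2:
  fixes M :: "'a measure" and F :: "real \<Rightarrow> 'a measure"
    and X\<^sub>u X\<^sub>d :: "real \<Rightarrow> 'a \<Rightarrow> real"
    and c\<^sub>u \<sigma>\<^sub>u c\<^sub>d p\<^sub>d :: real and \<nu>\<^sub>u \<nu>\<^sub>d :: "real measure"
    and \<phi> \<eta> :: "real \<Rightarrow> real" and \<phi>' \<eta>' :: real
    and S T :: "nat \<Rightarrow> 'a \<Rightarrow> ennreal"
    and W\<^sub>0 :: "'a \<Rightarrow> real" and J W :: "real \<Rightarrow> 'a \<Rightarrow> real"
    and P :: "'b measure" and W_inf :: "'b \<Rightarrow> real"
    and \<pi>\<^sub>l \<pi> :: real
  defines "\<phi> \<equiv> spectrally_positive_exponent c\<^sub>u \<sigma>\<^sub>u \<nu>\<^sub>u"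
    and "\<eta> \<equiv> subordinator_exponent c\<^sub>d \<nu>\<^sub>d"
    and "\<phi>' \<equiv> right_deriv \<phi> 0"
    and "\<eta>' \<equiv> right_deriv \<eta> 0"
    and "J \<equiv> \<lambda>t \<omega>. down_ind (\<lambda>n. S n \<omega>) (\<lambda>n. T n \<omega>) t"
    and "W \<equiv> \<lambda>t \<omega>. reflected (W\<^sub>0 \<omega>)
           (net_input (\<lambda>n. S n \<omega>) (\<lambda>n. T n \<omega>) (\<lambda>s. X\<^sub>u s \<omega>) (\<lambda>s. X\<^sub>d s \<omega>)) t"
    and "\<pi>\<^sub>l \<equiv> 1 - (1 + \<eta>' / \<phi>') * p\<^sub>d"
    and "\<pi> \<equiv> \<eta>' / (\<eta>' + \<phi>')"
  assumes "prob_space M" and "standard_filtration M F"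
    and "levy_process M F (\<lambda>t \<omega>. (X\<^sub>u t \<omega>, X\<^sub>d t \<omega>))"
    \<comment> \<open>the up process\<close>
    and "no_negative_jumps M X\<^sub>u" and "\<not> nondecreasing_paths M X\<^sub>u"
    and "levy_measure \<nu>\<^sub>u"
    and "\<And>\<alpha>. \<alpha> \<ge> 0 \<Longrightarrow> integrable M (\<lambda>\<omega>. exp (- \<alpha> * X\<^sub>u 1 \<omega>))"
    and "\<And>\<alpha>. \<alpha> \<ge> 0 \<Longrightarrow> ln (\<integral>\<omega>. exp (- \<alpha> * X\<^sub>u 1 \<omega>) \<partial>M) = \<phi> \<alpha>"
    and "integrable M (X\<^sub>u 1)" and "(\<integral>\<omega>. X\<^sub>u 1 \<omega> \<partial>M) < 0"
    \<comment> \<open>the down process\<close>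
    and "nondecreasing_paths M X\<^sub>d"
    and "c\<^sub>d \<ge> 0" and "subordinator_levy_measure \<nu>\<^sub>d"
    and "\<And>\<alpha>. \<alpha> \<ge> 0 \<Longrightarrow> (\<integral>\<omega>. exp (- \<alpha> * X\<^sub>d 1 \<omega>) \<partial>M) = exp (- \<eta> \<alpha>)"
    and "integrable M (X\<^sub>d 1)"
    \<comment> \<open>the switching times\<close>
    and "\<And>n. ext_stopping_time F (T n)" and "\<And>n. n \<ge> 1 \<Longrightarrow> ext_stopping_time F (S n)"
    and "AE \<omega> in M. T 0 \<omega> = 0"
    and "AE \<omega> in M. \<forall>n\<ge>1. T (n - 1) \<omega> \<le> S n \<omega> \<and> S n \<omega> \<le> T n \<omega> \<and>
           T (n - 1) \<omega> < T n \<omega> \<and> T n \<omega> < \<infinity>"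
    and "AE \<omega> in M. (\<lambda>n. T n \<omega>) \<longlonglongrightarrow> \<infinity>"
    \<comment> \<open>the initial content\<close>
    and "W\<^sub>0 \<in> borel_measurable (F 0)" and "AE \<omega> in M. W\<^sub>0 \<omega> \<ge> 0"
    \<comment> \<open>the two ergodic limits\<close>
    and "prob_space P" and "W_inf \<in> borel_measurable P"
    and "\<And>\<alpha>. \<alpha> \<ge> 0 \<Longrightarrow> integrable P (\<lambda>\<omega>. exp (- \<alpha> * W_inf \<omega>))"
    and "\<And>\<alpha>. \<alpha> \<ge> 0 \<Longrightarrow> AE \<omega> in M.
           ((\<lambda>t. (1 / t) * (LBINT s:{0..t}. exp (- \<alpha> * W s \<omega>)))
              \<longlongrightarrow> (\<integral>\<omega>'. exp (- \<alpha> * W_inf \<omega>') \<partial>P)) at_top"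
    and "AE \<omega> in M. ((\<lambda>t. (1 / t) * (LBINT s:{0..t}. J s \<omega>)) \<longlongrightarrow> p\<^sub>d) at_top"
    and "p\<^sub>d \<le> \<phi>' / (\<eta>' + \<phi>')"
  shows "\<exists>(Q :: real measure) (W\<^sub>d :: real \<Rightarrow> real).
    prob_space Q \<and> W\<^sub>d \<in> borel_measurable Q \<and> (\<forall>x\<in>space Q. W\<^sub>d x \<ge> 0) \<and>
    (p\<^sub>d > 0 \<longrightarrow>
      (AE \<omega> in M. \<forall>\<alpha>\<ge>0.
        ((\<lambda>t. (LBINT s:{0..t}. exp (- \<alpha> * W s \<omega>) * J s \<omega>) / (LBINT s:{0..t}. J s \<omega>))
           \<longlongrightarrow> (\<integral>x. exp (- \<alpha> * W\<^sub>d x) \<partial>Q)) at_top)) \<and>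
    (let R = (\<lambda>\<alpha>. \<pi>\<^sub>l * (\<phi>' * \<alpha> / \<phi> \<alpha>) +
           (1 - \<pi>\<^sub>l) * (1 - \<pi> + \<pi> * (\<eta> \<alpha> / (\<eta>' * \<alpha>)) * (\<phi>' * \<alpha> / \<phi> \<alpha>)) *
           (\<integral>x. exp (- \<alpha> * W\<^sub>d x) \<partial>Q))
     in (\<forall>\<alpha>>0. (\<integral>\<omega>'. exp (- \<alpha> * W_inf \<omega>') \<partial>P) = R \<alpha>) \<and>
        (R \<longlongrightarrow> (\<integral>\<omega>'. exp (- 0 * W_inf \<omega>') \<partial>P)) (at_right 0))"
proof -
  note M = assms(9) and filt = assms(10) and levy = assms(11) and Xu1 = assms(17,18) and Xd1 = assms(23)
    and Pp = assms(31) and Wm = assms(32)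
  interpret prob_space M by (rule M)
  interpret P: prob_space P by (rule Pp)
  have sub: "subalgebra M (F t)" if "0 \<le> t" for t
    using filt that by (simp add: standard_filtration_def)
  have F_mono: "sets (F s) \<subseteq> sets (F t)" if "0 \<le> s" "s \<le> t" for s t
    using filt that by (simp add: standard_filtration_def)
  have levy_u: "levy_process M F X\<^sub>u" and levy_d: "levy_process M F X\<^sub>d"
    using levy_process_compose_linear[OF levy M sub bounded_linear_fst]
      levy_process_compose_linear[OF levy M sub bounded_linear_snd] by simp_all
  have Lu: "integrable M (\<lambda>\<omega>. exp (- \<alpha> * X\<^sub>u 1 \<omega>))" "expectation (\<lambda>\<omega>. exp (- \<alpha> * X\<^sub>u 1 \<omega>)) = exp (\<phi> \<alpha>)"
      if a: "0 \<le> \<alpha>" for \<alpha>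
  proof -
    show int: "integrable M (\<lambda>\<omega>. exp (- \<alpha> * X\<^sub>u 1 \<omega>))"
      by (rule assms(15)[OF a])
    (* the logarithm can be undone once its argument is known to be positive *)
    have "0 \<le> - \<alpha> * expectation (X\<^sub>u 1)" using a Xu1(2) by (simp add: mult_nonneg_nonpos)
    then have "0 < (\<integral>\<omega>. 1 + (- \<alpha>) * X\<^sub>u 1 \<omega> \<partial>M)" using Xu1(1) prob_space by simp
    also have "\<dots> \<le> expectation (\<lambda>\<omega>. exp (- \<alpha> * X\<^sub>u 1 \<omega>))"
    proof (rule integral_mono[OF _ int])
      show "1 + (- \<alpha>) * X\<^sub>u 1 \<omega> \<le> exp (- \<alpha> * X\<^sub>u 1 \<omega>)" for \<omega> by (rule exp_ge_add_one_self)
    qed (use Xu1(1) in simp)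
    finally have "0 < expectation (\<lambda>\<omega>. exp (- \<alpha> * X\<^sub>u 1 \<omega>))" .
    moreover have "ln (expectation (\<lambda>\<omega>. exp (- \<alpha> * X\<^sub>u 1 \<omega>))) = \<phi> \<alpha>" by (rule assms(16)[OF a])
    ultimately show "expectation (\<lambda>\<omega>. exp (- \<alpha> * X\<^sub>u 1 \<omega>)) = exp (\<phi> \<alpha>)" by (metis exp_ln)
  qed
  have Ld: "integrable M (\<lambda>\<omega>. exp (- \<alpha> * X\<^sub>d 1 \<omega>))" "expectation (\<lambda>\<omega>. exp (- \<alpha> * X\<^sub>d 1 \<omega>)) = exp (- \<eta> \<alpha>)"
      if a: "0 \<le> \<alpha>" for \<alpha>
  proof -
    show e: "expectation (\<lambda>\<omega>. exp (- \<alpha> * X\<^sub>d 1 \<omega>)) = exp (- \<eta> \<alpha>)" by (rule assms(22)[OF a])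
    (* a non-integrable function has integral 0, which is not an exponential *)
    show "integrable M (\<lambda>\<omega>. exp (- \<alpha> * X\<^sub>d 1 \<omega>))"
      by (rule ccontr) (use e not_integrable_integral_eq in force)
  qed
  have switching: "AE \<omega> in M. switching_times (\<lambda>n. S n \<omega>) (\<lambda>n. T n \<omega>)"
    using assms(26-28)
  proof eventually_elim
    case (elim \<omega>)
    then show ?case by unfold_locales auto
  qed
  interpret storage: updown_storage M F X\<^sub>u X\<^sub>d S T W\<^sub>0 \<phi> \<eta>
  proof
    show "ext_stopping_time F (T n)" for n by (rule assms(24))
    show "ext_stopping_time F (S (Suc n))" for n by (rule assms(25)) simp
    show "no_negative_jumps M X\<^sub>u" "nondecreasing_paths M X\<^sub>d" by (rule assms(12), rule assms(19))
    show "W\<^sub>0 \<in> borel_measurable (F 0)" "AE \<omega> in M. 0 \<le> W\<^sub>0 \<omega>" by (rule assms(29), rule assms(30))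
  qed (fact sub F_mono levy_u levy_d Lu Ld switching)+
  have JW: "storage.J = J" "storage.W = W"
    unfolding storage.J_def[abs_def] storage.W_def[abs_def] storage.X_def J_def W_def by simp_all
  let ?E = "\<lambda>\<alpha>. \<integral>\<omega>'. exp (- \<alpha> * W_inf \<omega>') \<partial>P"
  have Wint: "integrable P (\<lambda>\<omega>. exp (- W_inf \<omega>))" using assms(33)[of 1] by simp
  have E_lim: "(?E \<longlongrightarrow> 1) (at_right 0)" by (rule P.Laplace_transform_at_zero[OF Wm Wint])
  have B_lim: "AE \<omega> in M. ((\<lambda>t. (1 / t) * (LBINT s:{0..t}. exp (- \<alpha> * storage.W s \<omega>))) \<longlongrightarrow> ?E \<alpha>) at_top" if
      "0 < \<alpha>" for \<alpha>
    unfolding JW by (rule assms(34)) (use that in simp)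
  have J_lim: "AE \<omega> in M. ((\<lambda>t. (1 / t) * (LBINT s:{0..t}. storage.J s \<omega>)) \<longlongrightarrow> p\<^sub>d) at_top"
    unfolding JW by (rule assms(35))
  have E0: "?E 0 = 1" using P.prob_space by simp
  note result = storage.ergodic_decomposition[of ?E, OF Xu1 Xd1 E0 E_lim B_lim J_lim]
  have d: "\<phi>' = - expectation (X\<^sub>u 1)" "\<eta>' = expectation (X\<^sub>d 1)"
    unfolding \<phi>'_def \<eta>'_def using right_deriv_eqI[OF result(1)] right_deriv_eqI[OF result(2)] by simp_all
  show ?thesis using result(3)[folded d] unfolding JW \<pi>\<^sub>l_def[symmetric] \<pi>_def[symmetric] .
qed

end
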